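(* Let $n\ge1$, let $y_0<y_1<\dots<y_{n+1}$ be real numbers and let $x_0\in(y_0,y_{n+1})$. Then the function $G:[0,\infty]^n\to\Pi^n$ defined in the context is surjective. Consequently, the discrete inverse problem has a solution: for every $(\pi_0,\dots,\pi_{n+1})\in[0,1]^{n+2}$ with $\sum_{i=0}^{n+1}\pi_i=1$ and $\sum_{i=0}^{n+1}y_i\pi_i=x_0$ there exist $b_1,\dots,b_n\in[0,\infty]$ such that the generalised diffusion $X$ started at $X_{0-}=x_0$ with speed measure $\nu=\sum_{i=0}^{n+1}b_i\delta_{y_i}$, where $b_0=b_{n+1}=\infty$, satisfies $\mathbb{P}(X_1=y_i)=\pi_i$ for $i=0,\dots,n+1$.
   Context: Generalised diffusion with speed measure $\nu$: let $\nu$ be a nonzero nonnegative Borel measure on $\mathbb{R}$ (infinite point masses are allowed). Let $B=(B_t)_{t\ge0}$ be a one-dimensional standard Brownian motion with $B_0=x_0$, and let $L_u^x$ be its local time at $x$ up to time $u$ (version jointly continuous in $(u,x)$, normalised so that $\int_0^u f(B_s)\,ds=\int_{\mathbb R} f(x)L_u^x\,dx$ for measurable $f\ge0$). Define $\Gamma_u:=\int_{\mathbb R}L_u^x\,\nu(dx)\in[0,\infty]$ and $A_t:=\inf\{u\ge0:\Gamma_u>t\}$ for $t\ge0$. Then almost surely $A_t<\infty$ for all $t\ge0$, and $X_t:=B_{A_t}$, $t\ge0$, is the generalised diffusion with speed measure $\nu$; by convention $X_{0-}:=x_0$. Definition of $G$: let $$\Pi^n:=\Bigl\{(\pi_0,\dots,\pi_{n+1})\in[0,1]^{n+2}:\sum_{i=0}^{n+1}\pi_i=1,\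 \sum_{i=0}^{n+1}y_i\pi_i=x_0\Bigr\}.$$ For $(b_1,\dots,b_n)\in[0,\infty]^n$ put $b_0=b_{n+1}=\infty$ and $\nu=\sum_{i=0}^{n+1}b_i\delta_{y_i}$ ($\delta_a$ is the unit point mass at $a$), let $X$ be the generalised diffusion with speed measure $\nu$ constructed from a Brownian motion started at $x_0$, and set $G(b_1,\dots,b_n):=(p_0,\dots,p_{n+1})$ with $p_i=\mathbb{P}(X_1=y_i)$. The process $(X_t)_{t\ge0}$ takes values in $\{y_0,\dots,y_{n+1}\}$ and is a bounded martingale with $\mathbb{E}X_t=x_0$, so $G$ indeed maps into $\Pi^n$. *)

theory Defs
  imports "HOL-Probability.Probability"
begin

section \<open>Brownian motion and its local time\<close>

text \<open>Processes are indexed by real times; only times \<open>t \<ge> 0\<close> are constrained.\<close>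

locale brownian_motion = prob_space M
  for M :: "'a measure" +
  fixes x\<^sub>0 :: real and B :: "real \<Rightarrow> 'a \<Rightarrow> real"
  assumes random_variable_B: "0 \<le> t \<Longrightarrow> random_variable borel (B t)"
    and start: "AE \<omega> in M. B 0 \<omega> = x\<^sub>0"
    and normal_increments: "0 \<le> s \<Longrightarrow> s < t \<Longrightarrow>
          distributed M lborel (\<lambda>\<omega>. B t \<omega> - B s \<omega>) (normal_density 0 (sqrt (t - s)))"
    and indep_increments: "0 \<le> \<tau> 0 \<Longrightarrow> mono_on {..k} \<tau> \<Longrightarrow>
          indep_vars (\<lambda>_. borel) (\<lambda>i \<omega>. B (\<tau> (Suc i)) \<omega> - B (\<tau> i) \<omega>) {..<k::nat}"
    and continuous_paths: "\<omega> \<in> space M \<Longrightarrow> continuous_on {0..} (\<lambda>t. B t \<omega>)"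

text \<open>
  \<open>L u x \<omega>\<close> is the local time at level \<open>x\<close> up to time \<open>u\<close>. The occupation time formula fixes the
  normalisation; the exceptional null set does not depend on \<open>u\<close> and \<open>f\<close>. Together with joint
  continuity it determines \<open>L\<close> almost surely.
\<close>

locale brownian_local_time = brownian_motion M x\<^sub>0 B
  for M :: "'a measure" and x\<^sub>0 :: real and B :: "real \<Rightarrow> 'a \<Rightarrow> real" +
  fixes L :: "real \<Rightarrow> real \<Rightarrow> 'a \<Rightarrow> real"
  assumes random_variable_L: "0 \<le> u \<Longrightarrow> random_variable borel (L u x)"
    and L_nonneg: "\<omega> \<in> space M \<Longrightarrow> 0 \<le> u \<Longrightarrow> 0 \<le> L u x \<omega>"
    and L_continuous: "\<omega> \<in> space M \<Longrightarrow> continuous_on ({0..} \<times> UNIV) (\<lambda>(u, x). L u x \<omega>)"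
    and occupation_formula: "AE \<omega> in M. \<forall>u\<ge>0. \<forall>f \<in> borel_measurable borel.
          (\<integral>\<^sup>+ s \<in> {0..u}. f (B s \<omega>) \<partial>lborel) = (\<integral>\<^sup>+ x. f x * ennreal (L u x \<omega>) \<partial>lborel)"


section \<open>Generalised diffusions\<close>

definition clock :: "(real \<Rightarrow> real \<Rightarrow> 'a \<Rightarrow> real) \<Rightarrow> real measure \<Rightarrow> real \<Rightarrow> 'a \<Rightarrow> ennreal" where
  "clock L \<nu> u \<omega> = (\<integral>\<^sup>+ x. ennreal (L u x \<omega>) \<partial>\<nu>)"

text \<open>The infimum is taken in \<open>[0, \<infinity>]\<close>, so that it is \<open>\<infinity>\<close> for the empty set.\<close>

definition time_change :: "(real \<Rightarrow> real \<Rightarrow> 'a \<Rightarrow> real) \<Rightarrow> real measure \<Rightarrow> real \<Rightarrow> 'a \<Rightarrow> ennreal" where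
  "time_change L \<nu> t \<omega> = Inf {ennreal u | u. 0 \<le> u \<and> ennreal t < clock L \<nu> u \<omega>}"

text \<open>
  If \<open>\<nu>\<close> is a nonzero Borel measure, the time change is almost surely finite; on the null event
  where it is infinite, \<^const>\<open>enn2real\<close> makes the value below \<open>B 0 \<omega>\<close>.
\<close>

definition gen_diffusion ::
  "(real \<Rightarrow> 'a \<Rightarrow> real) \<Rightarrow> (real \<Rightarrow> real \<Rightarrow> 'a \<Rightarrow> real) \<Rightarrow> real measure \<Rightarrow> real \<Rightarrow> 'a \<Rightarrow> real" where
  "gen_diffusion B L \<nu> t \<omega> = B (enn2real (time_change L \<nu> t \<omega>)) \<omega>"


section \<open>The discrete problem\<close>

text \<open>The Borel measure \<open>\<Sum>i = 0..n+1. b i * \<delta>\<^bsub>y i\<^esub>\<close>; the weights may be infinite.\<close>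

definition atomic_measure :: "nat \<Rightarrow> (nat \<Rightarrow> real) \<Rightarrow> (nat \<Rightarrow> ennreal) \<Rightarrow> real measure" where
  "atomic_measure n y b =
     measure_of UNIV (sets borel) (\<lambda>A. \<Sum>i = 0..n+1. b i * indicator A (y i))"

lemma sets_atomic_measure [measurable_cong, simp]: "sets (atomic_measure n y b) = sets borel"
  by (simp add: atomic_measure_def sets.sigma_sets_eq[of borel, simplified])

lemma emeasure_atomic_measure:
  assumes "A \<in> sets borel"
  shows "emeasure (atomic_measure n y b) A = (\<Sum>i = 0..n+1. b i * indicator A (y i))"
proof (rule emeasure_measure_of[OF atomic_measure_def])
  show "countably_additive (sets (atomic_measure n y b)) (\<lambda>A. \<Sum>i = 0..n+1. b i * indicator A (y i))"
  proof (rule countably_additiveI)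
    fix F :: "nat \<Rightarrow> real set"
    assume "disjoint_family F"
    then show "(\<Sum>k. \<Sum>i = 0..n+1. b i * indicator (F k) (y i)) =
        (\<Sum>i = 0..n+1. b i * indicator (\<Union>k. F k) (y i))"
      by (subst suminf_sum) (simp_all add: suminf_indicator)
  qed
qed (use assms in \<open>auto simp: positive_def\<close>)

text \<open>
  Tuples are functions that are \<^const>\<open>undefined\<close> outside their index set, which is
  \<open>{0..n+1}\<close> for \<open>\<pi>\<close> and \<open>{1..n}\<close> for \<open>b\<close>.
\<close>

definition Pi_set :: "nat \<Rightarrow> (nat \<Rightarrow> real) \<Rightarrow> real \<Rightarrow> (nat \<Rightarrow> real) set" where
  "Pi_set n y x\<^sub>0 = {\<pi> \<in> {0..n+1} \<rightarrow>\<^sub>E {0..1}.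
     (\<Sum>i = 0..n+1. \<pi> i) = 1 \<and> (\<Sum>i = 0..n+1. y i * \<pi> i) = x\<^sub>0}"

definition G_map :: "'a measure \<Rightarrow> (real \<Rightarrow> 'a \<Rightarrow> real) \<Rightarrow> (real \<Rightarrow> real \<Rightarrow> 'a \<Rightarrow> real) \<Rightarrow>
    nat \<Rightarrow> (nat \<Rightarrow> real) \<Rightarrow> (nat \<Rightarrow> ennreal) \<Rightarrow> (nat \<Rightarrow> real)" where
  "G_map M B L n y b = (\<lambda>i \<in> {0..n+1}. measure M {\<omega> \<in> space M.
     gen_diffusion B L (atomic_measure n y (b(0 := \<infinity>, n+1 := \<infinity>))) 1 \<omega> = y i})"

end

theory Submission
  imports Defs
begin

text \<open>
  Write \<open>p k\<close> for the law of \<open>X\<^sub>1\<close>. The weights solving \<open>p = \<pi>\<close> come from the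
  Poincare--Miranda theorem applied in the variables \<open>s k = b k / (1 + b k)\<close>, followed by a discrete
  maximum principle for the difference of the potentials of \<open>p\<close> and \<open>\<pi>\<close>. What is needed from
  probability is that \<open>p\<close> has mean \<open>x\<^sub>0\<close>, that \<open>X\<close> charges only atoms of the speed measure and does
  not cross infinite ones, and that \<open>p\<close> depends continuously on \<open>b\<close>. All of this follows from
  Tanaka's formula \<open>E (B\<^sub>\<tau> - a)\<^sup>+ = (x\<^sub>0 - a)\<^sup>+ + E L\<^sub>\<tau>\<^sup>a / 2\<close> for bounded optional times \<open>\<tau>\<close>.
  Tanaka's formula in turn is obtained without stochastic integration: Dynkin's formula for smooth
  functions is the limit of Taylor expansions along a time grid, and the occupation time formula
  allows the smooth functions to approach a kink.
\<close>


section \<open>Smoothed ramps and Riemann sums\<close>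

text \<open>The delicate probabilistic point is continuity of \<open>p\<close> on the whole cube,
  including faces where weights vanish or become infinite. Convergent weights make the clocks
  converge at each fixed time, but the time at which a clock passes a level converges only if the
  limiting clock does not rest at that level; \<open>AE_clock_neq\<close> excludes this. Infinite
  atoms make the clock jump to infinity, so only lower semicontinuity is available, and first
  passage is treated as entrance into a condition that is open in time. Optional times are therefore
  tested by the events \<open>u \<le> \<tau>\<close>, and the filtration is completed because local
  time is a functional of the path only almost surely. Tanaka's formula needs bounds on path and
  local time; every use also stops when a bound \<open>K\<close> is first exceeded, and
  \<open>K\<close> then runs through countably many values. On the deterministic side, the zero
  found in the cube belongs to a mixture of \<open>p - \<pi>\<close> with the potential difference.
  In this mixture mass surplus and potential surplus carry the same sign wherever \<open>s k\<close>
  is strictly between 0 and 1, and this rules out a nonzero extremum of the potential.\<close>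

definition smooth_ramp :: "real \<Rightarrow> real \<Rightarrow> real" where
  "smooth_ramp e x = (x + sqrt (x\<^sup>2 + e\<^sup>2)) / 2"

text \<open>The second derivative of \<open>smooth_ramp e\<close>. It is a positive kernel of mass 1
  concentrating at 0 as \<open>e\<close> tends to 0, so its occupation integrals approximate local
  time.\<close>

definition bump :: "real \<Rightarrow> real \<Rightarrow> real" where
  "bump e x = e\<^sup>2 / (2 * sqrt (x\<^sup>2 + e\<^sup>2) ^ 3)"

lemma sqrt_square_add_pos:
  fixes e x :: real
  assumes "e > 0"
  shows "0 < x\<^sup>2 + e\<^sup>2" "\<bar>x\<bar> \<le> sqrt (x\<^sup>2 + e\<^sup>2)" "e \<le> sqrt (x\<^sup>2 + e\<^sup>2)"
    "0 < sqrt (x\<^sup>2 + e\<^sup>2)"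
proof -
  show *: "0 < x\<^sup>2 + e\<^sup>2"
    using assms by (simp add: add_nonneg_pos)
  show "\<bar>x\<bar> \<le> sqrt (x\<^sup>2 + e\<^sup>2)" "e \<le> sqrt (x\<^sup>2 + e\<^sup>2)"
    by (auto intro: real_le_rsqrt)
  show "0 < sqrt (x\<^sup>2 + e\<^sup>2)"
    using * by simp
qed

lemma sqrt_square_add_deriv:
  fixes e x :: real
  assumes "e > 0"
  shows "((\<lambda>x. sqrt (x\<^sup>2 + e\<^sup>2)) has_real_derivative x / sqrt (x\<^sup>2 + e\<^sup>2)) (at x)"
  using sqrt_square_add_pos(1)[OF assms, of x]
  by (auto intro!: derivative_eq_intros simp: field_simps)

lemma smooth_ramp_deriv:
  assumes "e > 0"
  shows "(smooth_ramp e has_real_derivative (1 + x / sqrt (x\<^sup>2 + e\<^sup>2)) / 2) (at x)"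
  unfolding smooth_ramp_def[abs_def]
  by (rule derivative_eq_intros sqrt_square_add_deriv[OF assms] refl | simp)+

lemma smooth_ramp_deriv2:
  assumes "e > 0"
  shows "((\<lambda>x. (1 + x / sqrt (x\<^sup>2 + e\<^sup>2)) / 2) has_real_derivative bump e x) (at x)"
proof -
  define r where "r = sqrt (x\<^sup>2 + e\<^sup>2)"
  have r: "r > 0" "r\<^sup>2 = x\<^sup>2 + e\<^sup>2"
    using sqrt_square_add_pos[OF assms, of x] by (auto simp: r_def)
  have "((\<lambda>x. (1 + x / sqrt (x\<^sup>2 + e\<^sup>2)) / 2) has_real_derivative
     (0 + (1 * r - x * (x / r)) / (r * r)) / 2) (at x)"
    unfolding r_def
    by (intro DERIV_cdivide DERIV_add DERIV_const DERIV_divide DERIV_ident sqrt_square_add_deriv assms)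
      (use r assms in \<open>simp add: r_def\<close>)
  moreover have "(0 + (1 * r - x * (x / r)) / (r * r)) / 2 = (r\<^sup>2 - x\<^sup>2) / (2 * r ^ 3)"
    using r(1) by (simp add: field_simps power2_eq_square power3_eq_cube)
  ultimately show ?thesis
    using r by (simp add: bump_def r_def[symmetric])
qed

lemma bump_deriv:
  assumes "e > 0"
  shows "(bump e has_real_derivative - 3 * e\<^sup>2 * x / (2 * sqrt (x\<^sup>2 + e\<^sup>2) ^ 5)) (at x)"
proof -
  define r where "r = sqrt (x\<^sup>2 + e\<^sup>2)"
  have r: "r > 0"
    using sqrt_square_add_pos[OF assms, of x] by (auto simp: r_def)
  have "((\<lambda>x. e\<^sup>2 / 2 * inverse (sqrt (x\<^sup>2 + e\<^sup>2) ^ 3)) has_real_derivative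
      e\<^sup>2 / 2 * (- (inverse (r ^ 3) * (of_nat 3 * (x / r * r ^ (3 - Suc 0))) * inverse (r ^ 3)))) (at x)"
    unfolding r_def
    by (intro DERIV_cmult DERIV_inverse' DERIV_power sqrt_square_add_deriv assms)
      (use r assms in \<open>simp add: r_def\<close>)
  moreover have "(\<lambda>x. e\<^sup>2 / 2 * inverse (sqrt (x\<^sup>2 + e\<^sup>2) ^ 3)) = bump e"
    by (simp add: fun_eq_iff bump_def field_simps)
  moreover have "e\<^sup>2 / 2 * (- (inverse (r ^ 3) * (of_nat 3 * (x / r * r ^ (3 - Suc 0))) * inverse (r ^ 3)))
      = - 3 * e\<^sup>2 * x / (2 * r ^ 5)"
    using r by (simp add: field_simps eval_nat_numeral)
  ultimately show ?thesis
    by (simp add: r_def)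
qed

lemma bump_nonneg: "0 \<le> bump e x"
  by (simp add: bump_def)

lemma bump_le: "e > 0 \<Longrightarrow> bump e x \<le> 1 / (2 * e)"
proof -
  assume e: "e > 0"
  have "e ^ 3 \<le> sqrt (x\<^sup>2 + e\<^sup>2) ^ 3"
    using e sqrt_square_add_pos[OF e, of x] by (intro power_mono) auto
  then have "bump e x \<le> e\<^sup>2 / (2 * e ^ 3)"
    using e sqrt_square_add_pos[OF e, of x] unfolding bump_def by (intro divide_left_mono mult_pos_pos zero_less_power) auto
  also have "\<dots> = 1 / (2 * e)"
    using e by (simp add: field_simps eval_nat_numeral)
  finally show ?thesis .
qed

text \<open>With \<open>r\<close> the square root, both \<open>\<bar>x\<bar> \<le> r\<close> and
  \<open>e \<le> r\<close> hold, which leaves a negative power of \<open>e\<close>. The bound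
  explodes as \<open>e\<close> tends to 0; this is harmless because Dynkin's formula is used for
  each fixed \<open>e\<close> before the limit.\<close>

lemma bump_deriv_le:
  assumes e: "e > 0"
  shows "\<bar>- 3 * e\<^sup>2 * x / (2 * sqrt (x\<^sup>2 + e\<^sup>2) ^ 5)\<bar> \<le> 3 / (2 * e\<^sup>2)"
proof -
  define r where "r = sqrt (x\<^sup>2 + e\<^sup>2)"
  have r: "r > 0" "\<bar>x\<bar> \<le> r" "e \<le> r"
    using sqrt_square_add_pos[OF e, of x] by (auto simp: r_def)
  have "\<bar>- 3 * e\<^sup>2 * x / (2 * r ^ 5)\<bar> = 3 * e\<^sup>2 * \<bar>x\<bar> / (2 * r ^ 5)"
    using r e by (simp add: abs_mult)
  also have "\<dots> \<le> 3 * e\<^sup>2 * r / (2 * r ^ 5)"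
    using r e by (intro divide_right_mono mult_left_mono) auto
  also have "\<dots> = 3 * e\<^sup>2 / (2 * r ^ 4)"
    using r by (simp add: field_simps eval_nat_numeral)
  also have "\<dots> \<le> 3 * e\<^sup>2 / (2 * e ^ 4)"
    using r e by (intro divide_left_mono mult_left_mono power_mono) auto
  also have "\<dots> = 3 / (2 * e\<^sup>2)"
    using e by (simp add: field_simps eval_nat_numeral)
  finally show ?thesis
    by (simp add: r_def)
qed

lemma continuous_on_bump [continuous_intros]:
  assumes "e > 0" "continuous_on A f"
  shows "continuous_on A (\<lambda>x. bump e (f x))"
  unfolding bump_def using assms(2) sqrt_square_add_pos(1)[OF assms(1)]
  by (intro continuous_intros) (auto simp: less_imp_neq[symmetric])

lemma borel_measurable_bump [measurable]: "bump e \<in> borel_measurable borel"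
  unfolding bump_def[abs_def] by measurable

lemma smooth_ramp_tendsto:
  assumes "e \<longlonglongrightarrow> 0"
  shows "(\<lambda>m. smooth_ramp (e m) x) \<longlonglongrightarrow> max 0 x"
proof -
  have "(\<lambda>m. smooth_ramp (e m) x) \<longlonglongrightarrow> (x + sqrt (x\<^sup>2 + 0\<^sup>2)) / 2"
    unfolding smooth_ramp_def by (intro tendsto_intros assms) auto
  moreover have "(x + sqrt (x\<^sup>2 + 0\<^sup>2)) / 2 = max 0 x"
    by (simp add: max_def)
  ultimately show ?thesis
    by simp
qed

text \<open>The slope lies in \<open>[0,1]\<close>. Consequently the difference of two shifted ramps
  is bounded uniformly in \<open>e\<close>, although a single ramp is unbounded; this is the test
  function fed to Dynkin's formula.\<close>

lemma smooth_ramp_lipschitz: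
  assumes e: "e > 0" and "a \<le> b"
  shows "0 \<le> smooth_ramp e b - smooth_ramp e a" "smooth_ramp e b - smooth_ramp e a \<le> b - a"
proof -
  have d: "0 \<le> (1 + x / sqrt (x\<^sup>2 + e\<^sup>2)) / 2 \<and> (1 + x / sqrt (x\<^sup>2 + e\<^sup>2)) / 2 \<le> 1" for x
  proof -
    define q where "q = x / sqrt (x\<^sup>2 + e\<^sup>2)"
    have "\<bar>q\<bar> \<le> 1"
      using sqrt_square_add_pos[OF e, of x] by (simp add: q_def)
    then show ?thesis
      unfolding q_def[symmetric] by auto
  qed
  show "0 \<le> smooth_ramp e b - smooth_ramp e a"
  proof -
    have "smooth_ramp e a \<le> smooth_ramp e b"
      using \<open>a \<le> b\<close> by (rule DERIV_nonneg_imp_nondecreasing) (use d smooth_ramp_deriv[OF e] in blast)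
    then show ?thesis by simp
  qed
  have D: "((\<lambda>x. x - smooth_ramp e x) has_real_derivative 1 - (1 + x / sqrt (x\<^sup>2 + e\<^sup>2)) / 2) (at x)" for x
    by (intro DERIV_diff DERIV_ident smooth_ramp_deriv e)
  have "a - smooth_ramp e a \<le> b - smooth_ramp e b"
    using \<open>a \<le> b\<close>
  proof (rule DERIV_nonneg_imp_nondecreasing)
    fix x
    show "\<exists>y. ((\<lambda>x. x - smooth_ramp e x) has_real_derivative y) (at x) \<and> 0 \<le> y"
      using d[of x] D[of x] by (intro exI conjI) auto
  qed
  then show "smooth_ramp e b - smooth_ramp e a \<le> b - a"
    by simp
qed

lemma bump_scale:
  assumes "e > 0"
  shows "bump e (e * z) = bump 1 z / e"
proof -
  have "(e * z)\<^sup>2 + e\<^sup>2 = e\<^sup>2 * (z\<^sup>2 + 1)"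
    by (simp add: field_simps)
  then have "sqrt ((e * z)\<^sup>2 + e\<^sup>2) = e * sqrt (z\<^sup>2 + 1)"
    using assms by (simp add: real_sqrt_mult)
  then have "bump e (e * z) = e\<^sup>2 / (2 * (e * sqrt (z\<^sup>2 + 1)) ^ 3)"
    unfolding bump_def by (simp only:)
  also have "\<dots> = (1 / (2 * sqrt (z\<^sup>2 + 1) ^ 3)) / e"
    using assms by (simp only: power_mult_distrib) (simp add: power2_eq_square power3_eq_cube)
  finally show ?thesis
    by (simp add: bump_def)
qed

lemma bump_1_integral: "has_bochner_integral lborel (bump 1) 1"
proof -
  \<comment> \<open>\<open>F\<close> is the slope of the ramp with \<open>e = 1\<close>; the kernel
    has mass 1 because the slope rises from 0 to 1.\<close>
  define F :: "real \<Rightarrow> real" where "F x = (1 + x / sqrt (x\<^sup>2 + 1)) / 2" for x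
  have F: "(F has_real_derivative bump 1 x) (at x)" for x
    using smooth_ramp_deriv2[of 1 x] by (simp add: F_def[abs_def])
  have cont: "isCont (bump 1) x" for x
    using continuous_on_bump[of 1 UNIV "\<lambda>x. x"] by (simp add: continuous_on_eq_continuous_at)
  have bot: "(F \<longlongrightarrow> 0) at_bot" and top: "(F \<longlongrightarrow> 1) at_top"
    unfolding F_def by real_asymp+
  have *: "set_integrable lborel (einterval (-\<infinity>) \<infinity>) (bump 1)" "(LBINT x=-\<infinity>..\<infinity>. bump 1 x) = 1 - 0"
    using F cont bot top
    by (intro interval_integral_FTC_nonneg[of "-\<infinity>" \<infinity> F "bump 1" 0 1];
        auto simp: bump_nonneg ereal_tendsto_simps)+
  then have "integrable lborel (bump 1)"
    by (simp add: set_integrable_def)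
  moreover have "integral\<^sup>L lborel (bump 1) = 1"
    using *(2) by (simp add: interval_lebesgue_integral_def set_lebesgue_integral_def)
  ultimately show ?thesis
    by (simp add: has_bochner_integral_iff)
qed

text \<open>The substitution \<open>z = y + e * w\<close> moves \<open>e\<close> from the kernel
  into the argument of \<open>l\<close>, so that the fixed integrable function \<open>bump 1\<close>
  times \<open>C\<close> dominates.\<close>

lemma bump_delta:
  fixes l :: "real \<Rightarrow> real"
  assumes l: "continuous_on UNIV l" and bd: "\<And>z. \<bar>l z\<bar> \<le> C"
  shows "(\<lambda>m. \<integral>z. bump (1 / real (Suc m)) (z - y) * l z \<partial>lborel) \<longlonglongrightarrow> l y"
proof -
  have [measurable]: "l \<in> borel_measurable borel"
    using l by (rule borel_measurable_continuous_onI)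
  have lim: "(\<lambda>m. y + (1 / real (Suc m)) * z) \<longlonglongrightarrow> y + 0 * z" for z
    by (intro tendsto_intros LIMSEQ_Suc lim_1_over_n)
  have eq: "(\<integral>z. bump (1 / real (Suc m)) (z - y) * l z \<partial>lborel)
      = (\<integral>z. bump 1 z * l (y + 1 / real (Suc m) * z) \<partial>lborel)" for m
  proof -
    have "(\<integral>z. bump (1 / real (Suc m)) (z - y) * l z \<partial>lborel) =
      \<bar>1 / real (Suc m)\<bar> *\<^sub>R (\<integral>z. bump (1 / real (Suc m)) ((y + 1 / real (Suc m) * z) - y) * l (y + 1 / real (Suc m) * z) \<partial>lborel)"
      by (rule lborel_integral_real_affine) simp
    also have "\<dots> = (\<integral>z. 1 / real (Suc m) * (bump (1 / real (Suc m)) (1 / real (Suc m) * z) * l (y + 1 / real (Suc m) * z)) \<partial>lborel)"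
      by simp
    also have "\<dots> = (\<integral>z. bump 1 z * l (y + 1 / real (Suc m) * z) \<partial>lborel)"
      by (intro Bochner_Integration.integral_cong refl, subst bump_scale) auto
    finally show ?thesis .
  qed
  have "(\<lambda>m. \<integral>z. bump 1 z * l (y + 1 / real (Suc m) * z) \<partial>lborel) \<longlonglongrightarrow> (\<integral>z. bump 1 z * l y \<partial>lborel)"
  proof (rule integral_dominated_convergence[where w = "\<lambda>z. bump 1 z * C"])
    show "integrable lborel (\<lambda>z. bump 1 z * C)"
      using bump_1_integral by (intro integrable_mult_left) (simp add: has_bochner_integral_iff)
    show "AE z in lborel. (\<lambda>m. bump 1 z * l (y + 1 / real (Suc m) * z)) \<longlonglongrightarrow> bump 1 z * l y"
    proof (intro AE_I2 tendsto_intros)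
      fix z
      have "isCont l y"
        using l by (simp add: continuous_on_eq_continuous_at)
      then show "(\<lambda>m. l (y + 1 / real (Suc m) * z)) \<longlonglongrightarrow> l y"
        using lim[of z] by (auto intro: isCont_tendsto_compose)
    qed
    show "AE z in lborel. norm (bump 1 z * l (y + 1 / real (Suc m) * z)) \<le> bump 1 z * C" for m
      by (auto simp: abs_mult bump_nonneg intro!: mult_left_mono bd)
  qed auto
  then show ?thesis
    using bump_1_integral unfolding eq has_bochner_integral_iff by simp
qed

section \<open>Taylor remainders and Riemann sums\<close>

lemma taylor2_remainder_le:
  fixes g g1 g2 g3 :: "real \<Rightarrow> real"
  assumes "\<And>x. (g has_real_derivative g1 x) (at x)" "\<And>x. (g1 has_real_derivative g2 x) (at x)"
    "\<And>x. (g2 has_real_derivative g3 x) (at x)" and bd: "\<And>x. \<bar>g3 x\<bar> \<le> C"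
  shows "\<bar>g (x + d) - g x - g1 x * d - g2 x / 2 * d\<^sup>2\<bar> \<le> C * \<bar>d\<bar> ^ 3"
proof -
  define D where "D m t = (if m = 0 then g (x + t) else if m = 1 then g1 (x + t)
    else if m = 2 then g2 (x + t) else g3 (x + t))" for m :: nat and t
  have shift: "((\<lambda>t. f (x + t)) has_real_derivative f' (x + t)) (at t)"
    if "\<And>x. (f has_real_derivative f' x) (at x)" for f f' t
    using DERIV_shift[of f "f' (x + t)" t x] that[of "x + t"] by (simp add: add.commute)
  have "\<forall>m t. m < 3 \<and> \<bar>t\<bar> \<le> \<bar>d\<bar> \<longrightarrow> (D m has_real_derivative D (Suc m) t) (at t)"
  proof (intro allI impI)
    fix m :: nat and t assume "m < 3 \<and> \<bar>t\<bar> \<le> \<bar>d\<bar>"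
    then have "m = 0 \<or> m = 1 \<or> m = 2" by auto
    then show "(D m has_real_derivative D (Suc m) t) (at t)"
      using shift[OF assms(1)] shift[OF assms(2)] shift[OF assms(3)] by (auto simp: D_def[abs_def])
  qed
  from Maclaurin_bi_le[OF refl this] obtain t where
    "D 0 d = (\<Sum>m<3. D m 0 / fact m * d ^ m) + D 3 t / fact 3 * d ^ 3"
    by blast
  then have "g (x + d) - g x - g1 x * d - g2 x / 2 * d\<^sup>2 = g3 (x + t) / 6 * d ^ 3"
    by (simp add: D_def eval_nat_numeral fact_numeral)
  also have "\<bar>\<dots>\<bar> = \<bar>g3 (x + t)\<bar> / 6 * \<bar>d\<bar> ^ 3"
    by (simp add: abs_mult power_abs)
  also have "\<dots> \<le> C * \<bar>d\<bar> ^ 3"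
    using bd[of "x + t"] by (intro mult_right_mono) auto
  finally show ?thesis .
qed

text \<open>Left-endpoint Riemann sums up to a time \<open>\<tau>\<close>; the interval containing \<open>\<tau>\<close> is counted in full.\<close>

lemma riemann_sum_tendsto:
  fixes g :: "real \<Rightarrow> real"
  assumes T: "T > 0" and \<tau>: "0 \<le> \<tau>" "\<tau> \<le> T" and g: "continuous_on {0..T} g"
  shows "(\<lambda>N. T / real (Suc N) * (\<Sum>k<Suc N. of_bool (real k * T / real (Suc N) \<le> \<tau>) * g (real k * T / real (Suc N))))
    \<longlonglongrightarrow> (LINT s:{0..\<tau>}|lborel. g s)"
proof -
  define h where "h N = T / real (Suc N)" for N
  have h: "h N > 0" "h N * real (Suc N) = T" for N
    using T by (auto simp: h_def)
  \<comment> \<open>The last grid point at or before \<open>s\<close>.\<close>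
  define p where "p N s = real (nat \<lfloor>s / h N\<rfloor>) * h N" for N s
  obtain C where C: "\<And>s. s \<in> {0..T} \<Longrightarrow> \<bar>g s\<bar> \<le> C"
    using compact_imp_bounded[OF compact_continuous_image[OF g compact_Icc]]
    unfolding bounded_iff by (metis image_eqI real_norm_def)
  have p: "0 \<le> p N s" "p N s \<le> s" "s - h N < p N s" if "0 \<le> s" for N s
  proof -
    have *: "real (nat \<lfloor>s / h N\<rfloor>) = of_int \<lfloor>s / h N\<rfloor>"
      using that h(1)[of N] by simp
    have 1: "of_int \<lfloor>s / h N\<rfloor> \<le> s / h N" and 2: "s / h N - 1 < of_int \<lfloor>s / h N\<rfloor>"
      by linarith+
    show "0 \<le> p N s"
      using h(1)[of N] by (simp add: p_def)
    show "p N s \<le> s"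
      using mult_right_mono[OF 1, of "h N"] h(1)[of N] unfolding p_def * by simp
    show "s - h N < p N s"
      using mult_strict_right_mono[OF 2, of "h N"] h(1)[of N] unfolding p_def * by (simp add: left_diff_distrib)
  qed
  have h0: "h \<longlonglongrightarrow> 0"
    unfolding h_def using tendsto_mult_right_zero[OF LIMSEQ_Suc[OF lim_1_over_n], of T] by simp
  have p_lim: "(\<lambda>N. p N s) \<longlonglongrightarrow> s" if "0 \<le> s" for s
  proof (rule tendsto_sandwich)
    show "(\<lambda>N. s - h N) \<longlonglongrightarrow> s"
      using tendsto_diff[OF tendsto_const h0, of s] by simp
  qed (use p[OF that] in \<open>auto simp: less_imp_le\<close>)
  \<comment> \<open>A step function whose integral is the Riemann sum; the claim becomes dominated
    convergence.\<close>
  define F where "F N s = indicator {0..<T} s * (of_bool (p N s \<le> \<tau>) * g (p N s))" for N s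
  have F_eq: "F N s = (\<Sum>k<Suc N. indicator {real k * h N..<real (Suc k) * h N} s * (of_bool (real k * h N \<le> \<tau>) * g (real k * h N)))" for N s
  proof (cases "s \<in> {0..<T}")
    case True
    define k where "k = nat \<lfloor>s / h N\<rfloor>"
    have k: "s \<in> {real j * h N..<real (Suc j) * h N} \<longleftrightarrow> j = k" for j
    proof -
      have "j = k \<longleftrightarrow> int j = \<lfloor>s / h N\<rfloor>"
        using True h(1)[of N] by (auto simp: k_def)
      also have "\<dots> \<longleftrightarrow> of_int (int j) \<le> s / h N \<and> s / h N < of_int (int j) + 1"
        by (metis floor_eq_iff)
      also have "\<dots> \<longleftrightarrow> s \<in> {real j * h N..<real (Suc j) * h N}"
        using h(1)[of N] by (auto simp: field_simps)
      finally show ?thesis by simp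
    qed
    have "real k * h N < real (Suc N) * h N"
      using True k[of k] h(2)[of N] by (simp add: mult.commute)
    then have "k < Suc N"
      using h(1)[of N] by simp
    have "(\<Sum>j<Suc N. indicator {real j * h N..<real (Suc j) * h N} s * (of_bool (real j * h N \<le> \<tau>) * g (real j * h N)))
      = (\<Sum>j<Suc N. if j = k then of_bool (real k * h N \<le> \<tau>) * g (real k * h N) else 0)"
      unfolding indicator_def k by (intro sum.cong) auto
    also have "\<dots> = F N s"
      using \<open>k < Suc N\<close> True unfolding F_def p_def k_def[symmetric] by simp
    finally show ?thesis by simp
  next
    case False
    have "s \<notin> {real k * h N..<real (Suc k) * h N}" if "k < Suc N" for k
    proof -
      have "real (Suc k) * h N \<le> real (Suc N) * h N"
        using that h(1)[of N] by (intro mult_right_mono) auto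
      moreover have "0 \<le> real k * h N"
        using h(1)[of N] by simp
      ultimately show ?thesis
        using False h(2)[of N] by (auto simp: mult.commute)
    qed
    then show ?thesis
      using False by (simp add: F_def del: of_nat_Suc)
  qed
  have [measurable]: "F N \<in> borel_measurable lborel" for N
    unfolding F_eq[abs_def] by measurable
  have le: "real k * h N \<le> real (Suc k) * h N" for k N
    using h(1)[of N] by (intro mult_right_mono) auto
  have sum_eq: "integral\<^sup>L lborel (F N) = h N * (\<Sum>k<Suc N. of_bool (real k * h N \<le> \<tau>) * g (real k * h N))" for N
  proof -
    have "integral\<^sup>L lborel (F N) = (\<Sum>k<Suc N. (\<integral>s. indicator {real k * h N..<real (Suc k) * h N} s * (of_bool (real k * h N \<le> \<tau>) * g (real k * h N)) \<partial>lborel))"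
      unfolding F_eq[abs_def] by (intro Bochner_Integration.integral_sum integrable_mult_left integrable_real_indicator) (use le in \<open>simp_all del: of_nat_Suc\<close>)
    also have "\<dots> = (\<Sum>k<Suc N. h N * (of_bool (real k * h N \<le> \<tau>) * g (real k * h N)))"
      using le[of _ N] by (intro sum.cong) (auto simp: measure_def algebra_simps)
    finally show ?thesis
      by (simp only: sum_distrib_left)
  qed
  have "(\<lambda>N. integral\<^sup>L lborel (F N)) \<longlonglongrightarrow> (\<integral>s. indicator {0..\<tau>} s * g s \<partial>lborel)"
  proof (rule integral_dominated_convergence[where w = "\<lambda>s. indicator {0..<T} s * C"])
    have "set_integrable lborel {0..\<tau>} g"
      using \<tau> continuous_on_subset[OF g, of "{0..\<tau>}"] by (intro borel_integrable_atLeastAtMost') auto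
    then show "(\<lambda>s. indicator {0..\<tau>} s * g s) \<in> borel_measurable lborel"
      by (simp add: set_integrable_def borel_measurable_integrable)
    show "AE s in lborel. norm (F N s) \<le> indicator {0..<T} s * C" for N
    proof (intro AE_I2)
      fix s
      show "norm (F N s) \<le> indicator {0..<T} s * C"
      proof (cases "s \<in> {0..<T}")
        case True
        then have "p N s \<in> {0..T}"
          using p[of s N] by auto
        then show ?thesis
          using True C[of "p N s"] by (auto simp: F_def abs_mult)
      qed (simp add: F_def)
    qed
    \<comment> \<open>At \<open>s = \<tau>\<close> the cut-off is discontinuous, and at
      \<open>s = T\<close> the step functions vanish by definition; both points are null.\<close>
    have "AE s in lborel. s \<noteq> \<tau> \<and> s \<noteq> T"
      using AE_lborel_singleton[of \<tau>] AE_lborel_singleton[of T] by eventually_elim auto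
    then show "AE s in lborel. (\<lambda>N. F N s) \<longlonglongrightarrow> indicator {0..\<tau>} s * g s"
    proof eventually_elim
      case (elim s)
      show ?case
      proof (cases "s \<in> {0..<T}")
        case True
        then have s: "0 \<le> s" "s < T" by auto
        have "((\<lambda>N. g (p N s)) \<longlongrightarrow> g s) sequentially"
        proof (rule continuous_on_tendsto_compose[OF g p_lim[OF s(1)]])
          have "p N s \<in> {0..T}" for N
            using p(1,2)[OF s(1), of N] s(2) by simp
          then show "\<forall>\<^sub>F N in sequentially. p N s \<in> {0..T}"
            by simp
        qed (use s in auto)
        moreover have "\<forall>\<^sub>F N in sequentially. of_bool (p N s \<le> \<tau>) = (of_bool (s \<le> \<tau>) :: real)"
        proof (cases "s < \<tau>")
          case True
          then have "p N s \<le> \<tau>" for N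
            using p(2)[OF s(1), of N] by simp
          then show ?thesis using True by simp
        next
          case False
          then have "\<forall>\<^sub>F N in sequentially. \<tau> < p N s"
            using elim by (intro order_tendstoD(1)[OF p_lim[OF s(1)]]) auto
          then show ?thesis
            by eventually_elim (use False elim in auto)
        qed
        then have "((\<lambda>N. of_bool (p N s \<le> \<tau>)) \<longlongrightarrow> (of_bool (s \<le> \<tau>) :: real)) sequentially"
          by (rule tendsto_eventually)
        ultimately have "(\<lambda>N. of_bool (p N s \<le> \<tau>) * g (p N s)) \<longlonglongrightarrow> of_bool (s \<le> \<tau>) * g s"
          by (intro tendsto_mult)
        then show ?thesis
          using True by (simp add: F_def indicator_def)
      next
        case False
        then show ?thesis
          using \<tau> elim by (auto simp: F_def indicator_def)
      qed
    qed
    show "integrable lborel (\<lambda>s. indicator {0..<T} s * C)"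
      using T by (intro integrable_mult_left integrable_real_indicator) auto
  qed auto
  then show ?thesis
    unfolding sum_eq by (simp add: h_def set_lebesgue_integral_def)
qed

section \<open>The completed Brownian filtration\<close>

context brownian_motion
begin

text \<open>The natural filtration of the path with the null sets of \<open>M\<close> adjoined:
  local time at \<open>u\<close> agrees only almost surely with a functional of the path up to
  \<open>u\<close>.\<close>

definition filt :: "real \<Rightarrow> 'a measure" where
  "filt u = sigma (space M) ({B r -` A \<inter> space M | r A. 0 \<le> r \<and> r \<le> u \<and> A \<in> sets borel} \<union> null_sets M)"

lemma filt_generators_subset:
  "{B r -` A \<inter> space M | r A. 0 \<le> r \<and> r \<le> u \<and> A \<in> sets borel} \<union> null_sets M \<subseteq> sets M"
  using measurable_sets[OF random_variable_B] by (auto dest: null_setsD2)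

lemma space_filt [simp]: "space (filt u) = space M"
  by (simp add: filt_def space_measure_of_conv)

lemma sets_filt: "sets (filt u) = sigma_sets (space M)
    ({B r -` A \<inter> space M | r A. 0 \<le> r \<and> r \<le> u \<and> A \<in> sets borel} \<union> null_sets M)"
  unfolding filt_def using filt_generators_subset[of u] sets.space_closed[of M]
  by (intro sets_measure_of) blast

lemma sets_filt_subset: "sets (filt u) \<subseteq> sets M"
  unfolding sets_filt using filt_generators_subset[of u] by (rule sets.sigma_sets_subset)

lemma sets_filtD: "E \<in> sets (filt u) \<Longrightarrow> E \<in> sets M"
  using sets_filt_subset by blast

lemma sets_filt_mono: "u \<le> v \<Longrightarrow> sets (filt u) \<subseteq> sets (filt v)"
  unfolding sets_filt
proof (intro sigma_sets_mono' Un_mono subset_refl subsetI)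
  fix E assume "u \<le> v" "E \<in> {B r -` A \<inter> space M |r A. 0 \<le> r \<and> r \<le> u \<and> A \<in> sets borel}"
  then obtain r A where "E = B r -` A \<inter> space M" "0 \<le> r" "r \<le> v" "A \<in> sets borel"
    using order_trans[of _ u v] by blast
  then show "E \<in> {B r -` A \<inter> space M |r A. 0 \<le> r \<and> r \<le> v \<and> A \<in> sets borel}"
    by blast
qed

lemma null_sets_filt: "N \<in> null_sets M \<Longrightarrow> N \<in> sets (filt u)"
  unfolding sets_filt by (rule sigma_sets.Basic) (rule UnI2)

lemma measurable_filtD: "f \<in> measurable (filt u) N \<Longrightarrow> f \<in> measurable M N"
  using sets_filt_subset[of u] unfolding measurable_def space_filt by blast

lemma B_measurable_filt: "0 \<le> r \<Longrightarrow> r \<le> u \<Longrightarrow> B r \<in> borel_measurable (filt u)"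
proof (rule measurableI)
  fix A :: "real set" assume "0 \<le> r" "r \<le> u" "A \<in> sets borel"
  then show "B r -` A \<inter> space (filt u) \<in> sets (filt u)"
    unfolding sets_filt space_filt by (intro sigma_sets.Basic UnI1) blast
qed simp

text \<open>The symmetric difference is a null set and hence lies in \<open>filt u\<close>. Since
  \<open>M\<close> itself may be incomplete, measurability of \<open>E'\<close> in \<open>M\<close>
  is a separate hypothesis.\<close>

lemma filt_AE_cong:
  assumes E: "E \<in> sets (filt u)" and E': "E' \<in> sets M" and eq: "AE \<omega> in M. \<omega> \<in> E \<longleftrightarrow> \<omega> \<in> E'"
  shows "E' \<in> sets (filt u)"
proof -
  have "{\<omega> \<in> space M. \<not> (\<omega> \<in> E \<longleftrightarrow> \<omega> \<in> E')} = (E - E') \<union> (E' - E)"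
    using sets.sets_into_space[OF E'] sets.sets_into_space[OF sets_filtD[OF E]] by auto
  moreover have EM: "E \<in> sets M"
    using E by (rule sets_filtD)
  then have "(E - E') \<union> (E' - E) \<in> sets M"
    using E' by simp
  ultimately have N: "(E - E') \<union> (E' - E) \<in> null_sets M"
    using AE_iff_null[of M "\<lambda>\<omega>. \<omega> \<in> E \<longleftrightarrow> \<omega> \<in> E'"] eq by simp
  have "E - E' \<in> null_sets M" "E' - E \<in> null_sets M"
    by (rule null_sets_subset[OF N]; use EM E' in blast)+
  then have "E - (E - E') \<union> (E' - E) \<in> sets (filt u)"
    using E by (auto intro: null_sets_filt)
  also have "E - (E - E') \<union> (E' - E) = E'"
    by auto
  finally show ?thesis .
qed

lemma measurable_filt_AE_cong:
  assumes f: "f \<in> measurable (filt u) N" and g: "g \<in> measurable M N" and eq: "AE \<omega> in M. f \<omega> = g \<omega>"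
  shows "g \<in> measurable (filt u) N"
proof (rule measurableI)
  fix A assume A: "A \<in> sets N"
  have "f -` A \<inter> space M \<in> sets (filt u)"
    using measurable_sets[OF f A] by simp
  moreover have "g -` A \<inter> space M \<in> sets M"
    using measurable_sets[OF g A] .
  moreover have "AE \<omega> in M. \<omega> \<in> f -` A \<inter> space M \<longleftrightarrow> \<omega> \<in> g -` A \<inter> space M"
    using eq by eventually_elim auto
  ultimately show "g -` A \<inter> space (filt u) \<in> sets (filt u)"
    by (simp add: filt_AE_cong)
qed (use measurable_space[OF g] in simp)

text \<open>
  Along dyadic grids the events generated by the past increments are nested, hence stable under
  intersection, and by continuity of the paths they generate the filtration up to null sets.
\<close>

lemma indep_set_filt:
  assumes s: "0 \<le> s" and t: "s < t"
  shows "indep_set (sets (filt s))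
    (sigma_sets (space M) {(\<lambda>\<omega>. B t \<omega> - B s \<omega>) -` A \<inter> space M | A. A \<in> sets borel})"
proof -
  \<comment> \<open>The dyadic grid of level \<open>m\<close> on \<open>[0,s]\<close>, followed by
    the single point \<open>t\<close>: increment number \<open>2 ^ m\<close> is then
    \<open>B t - B s\<close>, and the increments before it form the past.\<close>
  define \<tau> where "\<tau> m j = (if j \<le> 2 ^ m then s * (real j / 2 ^ m) else t)" for m j :: nat
  define inc where "inc m j \<omega> = B (\<tau> m (Suc j)) \<omega> - B (\<tau> m j) \<omega>" for m j \<omega>
  define I where "I m = {..<2 ^ m :: nat}" for m :: nat
  define V where "V m \<omega> = (\<lambda>j\<in>I m. inc m j \<omega>)" for m \<omega>
  define P where "P m = {V m -` S \<inter> space M | S. S \<in> sets (PiM (I m) (\<lambda>_. borel))}" for m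
  define D where "D = {(\<lambda>\<omega>. B t \<omega> - B s \<omega>) -` A \<inter> space M | A. A \<in> sets (borel :: real measure)}"
  have \<tau>: "0 \<le> \<tau> m j" for m j
    using s t by (auto simp: \<tau>_def)
  have \<tau>_le: "\<tau> m j \<le> s" if "j \<le> 2 ^ m" for m j
    using that s mult_left_mono[of "real j / 2 ^ m" 1 s] by (simp add: \<tau>_def)
  have \<tau>_mono: "mono_on {..2 ^ m + 1} (\<tau> m)" for m
  proof (rule mono_onI)
    fix i j :: nat assume ij: "i \<in> {..2 ^ m + 1}" "j \<in> {..2 ^ m + 1}" "i \<le> j"
    show "\<tau> m i \<le> \<tau> m j"
    proof (cases "j \<le> 2 ^ m")
      case True
      then show ?thesis
        using ij s mult_left_mono[of "real i / 2 ^ m" "real j / 2 ^ m" s] by (simp add: \<tau>_def divide_right_mono)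
    next
      case False
      then show ?thesis
        using ij t \<tau>_le[of i m] by (cases "i \<le> 2 ^ m") (auto simp: \<tau>_def)
    qed
  qed
  have inc_meas [measurable]: "random_variable borel (inc m j)" for m j
    unfolding inc_def using random_variable_B[OF \<tau>] by measurable
  have V_meas [measurable]: "random_variable (PiM (I m) (\<lambda>_. borel)) (V m)" for m
    unfolding V_def by measurable
  have last: "inc m (2 ^ m) = (\<lambda>\<omega>. B t \<omega> - B s \<omega>)" for m
    by (simp add: fun_eq_iff inc_def \<tau>_def)
  have indep1: "prob (E \<inter> F) = prob E * prob F" if E: "E \<in> P m" and F: "F \<in> D" for E F m
  proof -
    obtain S where S: "S \<in> sets (PiM (I m) (\<lambda>_. borel))" "E = V m -` S \<inter> space M"
      using E by (auto simp: P_def)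
    obtain A where A: "A \<in> sets borel" "F = (\<lambda>\<omega>. B t \<omega> - B s \<omega>) -` A \<inter> space M"
      using F by (auto simp: D_def)
    have "indep_vars (\<lambda>_. borel) (inc m) {..<2 ^ m + 1}"
      unfolding inc_def[abs_def] using \<tau> \<tau>_mono by (intro indep_increments) auto
    then have "indep_var (PiM (I m) (\<lambda>_. borel)) (\<lambda>\<omega>. restrict (\<lambda>i. inc m i \<omega>) (I m))
        (PiM {2 ^ m} (\<lambda>_. borel)) (\<lambda>\<omega>. restrict (\<lambda>i. inc m i \<omega>) {2 ^ m})"
      by (rule indep_var_restrict) (auto simp: I_def)
    note iv = this[unfolded indep_var_eq]
    define A' where "A' = (\<lambda>f. f (2 ^ m)) -` A \<inter> space (PiM {2 ^ m :: nat} (\<lambda>_. borel :: real measure))"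
    have "A' \<in> sets (PiM {2 ^ m} (\<lambda>_. borel))"
      unfolding A'_def using A by (intro measurable_sets[OF measurable_component_singleton]) auto
    moreover have "F = (\<lambda>\<omega>. restrict (\<lambda>i. inc m i \<omega>) {2 ^ m}) -` A' \<inter> space M"
      using A(2) by (auto simp: A'_def space_PiM fun_cong[OF last])
    moreover have "E = (\<lambda>\<omega>. restrict (\<lambda>i. inc m i \<omega>) (I m)) -` S \<inter> space M"
      using S(2) by (simp add: V_def[abs_def])
    ultimately show ?thesis
      using S(1) by (intro indep_setD[OF conjunct2[OF iv]] sigma_sets.Basic) blast+
  qed
  \<comment> \<open>A coarse increment is the sum of two increments of the next level, so the coarse
    vector is a measurable function of the finer one.\<close>
  have mono1: "P m \<subseteq> P (Suc m)" for m
  proof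
    fix E assume "E \<in> P m"
    then obtain S where S: "S \<in> sets (PiM (I m) (\<lambda>_. borel))" "E = V m -` S \<inter> space M"
      by (auto simp: P_def)
    define h where "h f = (\<lambda>j\<in>I m. f (2 * j) + f (2 * j + 1))" for f :: "nat \<Rightarrow> real"
    have h: "h \<in> measurable (PiM (I (Suc m)) (\<lambda>_. borel)) (PiM (I m) (\<lambda>_. borel))"
      unfolding h_def
    proof (rule measurable_restrict)
      fix j assume "j \<in> I m"
      then have "2 * j \<in> I (Suc m)" "2 * j + 1 \<in> I (Suc m)"
        by (auto simp: I_def)
      then show "(\<lambda>f. f (2 * j) + f (2 * j + 1) :: real) \<in> borel_measurable (PiM (I (Suc m)) (\<lambda>_. borel))"
        by measurable
    qed
    have "V m \<omega> = h (V (Suc m) \<omega>)" for \<omega>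
    proof -
      have "inc m j \<omega> = inc (Suc m) (2 * j) \<omega> + inc (Suc m) (2 * j + 1) \<omega>"
        "2 * j \<in> I (Suc m)" "2 * j + 1 \<in> I (Suc m)" if "j \<in> I m" for j
      proof -
        have "j < 2 ^ m"
          using that by (simp add: I_def)
        then have "Suc j \<le> 2 ^ m" "2 * j + 1 + 1 \<le> 2 * 2 ^ m" "2 * j \<le> 2 * 2 ^ m" "j \<le> 2 ^ m" by auto
        then have "\<tau> m (Suc j) = \<tau> (Suc m) (Suc (2 * j + 1))" "\<tau> m j = \<tau> (Suc m) (2 * j)"
          by (auto simp: \<tau>_def field_simps)
        then show "inc m j \<omega> = inc (Suc m) (2 * j) \<omega> + inc (Suc m) (2 * j + 1) \<omega>"
          by (simp add: inc_def)
        show "2 * j \<in> I (Suc m)" "2 * j + 1 \<in> I (Suc m)"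
          using \<open>j < 2 ^ m\<close> by (simp_all add: I_def)
      qed
      then show ?thesis
        by (auto simp: V_def h_def fun_eq_iff)
    qed
    then have "E = V (Suc m) -` (h -` S \<inter> space (PiM (I (Suc m)) (\<lambda>_. borel))) \<inter> space M"
      using S(2) measurable_space[OF V_meas[of "Suc m"]] by auto
    then show "E \<in> P (Suc m)"
      using measurable_sets[OF h S(1)] unfolding P_def by blast
  qed
  have mono: "P m \<subseteq> P n" if "m \<le> n" for m n
    using that mono1 by (rule lift_Suc_mono_le[rotated])
  define Q where "Q = (\<Union>m. P m)"
  have Q_events: "Q \<subseteq> sets M"
    unfolding Q_def P_def using measurable_sets[OF V_meas] by auto
  have D_events: "D \<subseteq> sets M"
    unfolding D_def using s t random_variable_B[of s] random_variable_B[of t] by (auto intro!: measurable_sets)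
  have Int_Q: "Int_stable Q"
  proof (rule Int_stableI)
    fix E F assume "E \<in> Q" "F \<in> Q"
    then obtain m n where "E \<in> P m" "F \<in> P n"
      by (auto simp: Q_def)
    then have "E \<in> P (max m n)" "F \<in> P (max m n)"
      using mono[of m "max m n"] mono[of n "max m n"] by auto
    then obtain S S' where S: "S \<in> sets (PiM (I (max m n)) (\<lambda>_. borel))" "E = V (max m n) -` S \<inter> space M"
      "S' \<in> sets (PiM (I (max m n)) (\<lambda>_. borel))" "F = V (max m n) -` S' \<inter> space M"
      by (auto simp: P_def)
    then have "E \<inter> F = V (max m n) -` (S \<inter> S') \<inter> space M" "S \<inter> S' \<in> sets (PiM (I (max m n)) (\<lambda>_. borel))"
      by auto
    then show "E \<inter> F \<in> Q"
      unfolding Q_def P_def by blast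
  qed
  have Int_D: "Int_stable D"
  proof (rule Int_stableI)
    fix E F assume "E \<in> D" "F \<in> D"
    then obtain A A' where A: "A \<in> sets borel" "A' \<in> sets borel" "E = (\<lambda>\<omega>. B t \<omega> - B s \<omega>) -` A \<inter> space M"
      "F = (\<lambda>\<omega>. B t \<omega> - B s \<omega>) -` A' \<inter> space M"
      by (auto simp: D_def)
    then have "E \<inter> F = (\<lambda>\<omega>. B t \<omega> - B s \<omega>) -` (A \<inter> A') \<inter> space M" "A \<inter> A' \<in> sets borel"
      by auto
    then show "E \<inter> F \<in> D"
      unfolding D_def by blast
  qed
  have "indep_set Q D"
    using indep1 Q_events D_events by (intro indep_setI) (auto simp: Q_def)
  then have indep2: "indep_set (sigma_sets (space M) Q) (sigma_sets (space M) D)"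
    using Int_Q Int_D by (rule indep_set_sigma_sets)
  define G where "G = sigma (space M) Q"
  have G: "sets G = sigma_sets (space M) Q" "space G = space M"
    unfolding G_def using Q_events sets.space_closed[of M] by (auto intro!: sets_measure_of)
  have G_sub: "sets G \<subseteq> sets M"
    unfolding G using Q_events by (rule sets.sigma_sets_subset)
  have inc_G: "inc m j \<in> borel_measurable G" if "j \<in> I m" for m j
  proof (rule measurableI)
    fix A :: "real set" assume A: "A \<in> sets borel"
    have "inc m j -` A \<inter> space G = V m -` ((\<lambda>f. f j) -` A \<inter> space (PiM (I m) (\<lambda>_. borel))) \<inter> space M"
      using that measurable_space[OF V_meas[of m]] G(2) by (auto simp: V_def)
    moreover have "(\<lambda>f. f j) -` A \<inter> space (PiM (I m) (\<lambda>_. borel)) \<in> sets (PiM (I m) (\<lambda>_. borel))"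
      using that A by (intro measurable_sets[OF measurable_component_singleton]) auto
    ultimately have "inc m j -` A \<inter> space G \<in> P m"
      unfolding P_def by blast
    then show "inc m j -` A \<inter> space G \<in> sets G"
      unfolding G(1) Q_def by (intro sigma_sets.Basic) blast
  qed simp
  have grid_G: "(\<lambda>\<omega>. B (\<tau> m j) \<omega> - B 0 \<omega>) \<in> borel_measurable G" if "j \<le> 2 ^ m" for m j
  proof -
    have "(\<lambda>\<omega>. B (\<tau> m j) \<omega> - B 0 \<omega>) = (\<lambda>\<omega>. \<Sum>i<j. inc m i \<omega>)"
    proof
      fix \<omega>
      have "\<tau> m 0 = 0" by (simp add: \<tau>_def)
      then show "B (\<tau> m j) \<omega> - B 0 \<omega> = (\<Sum>i<j. inc m i \<omega>)"
        unfolding inc_def using sum_lessThan_telescope[of "\<lambda>i. B (\<tau> m i) \<omega>" j] by simp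
    qed
    moreover have "(\<lambda>\<omega>. \<Sum>i<j. inc m i \<omega>) \<in> borel_measurable G"
      using that by (intro borel_measurable_sum inc_G) (auto simp: I_def)
    ultimately show ?thesis by simp
  qed
  have B_G: "(\<lambda>\<omega>. B r \<omega> - B 0 \<omega>) \<in> borel_measurable G" if r: "0 \<le> r" "r \<le> s" for r
  proof (rule borel_measurable_LIMSEQ_real)
    \<comment> \<open>Dyadic approximation of \<open>r\<close> from below. For \<open>s = 0\<close>
      also \<open>r = 0\<close>, and the convention for division by zero gives
      \<open>j m = 0\<close>, so that \<open>s * (r / s) = r\<close> still holds.\<close>
    define j where "j m = nat \<lfloor>r / s * 2 ^ m\<rfloor>" for m :: nat
    have j: "j m \<le> 2 ^ m" "real (j m) \<le> r / s * 2 ^ m" "r / s * 2 ^ m - 1 \<le> real (j m)" for m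
    proof -
      have "0 \<le> r / s" "r / s \<le> 1"
        using r by (auto simp: divide_le_eq_1)
      then have *: "0 \<le> r / s * 2 ^ m" "r / s * 2 ^ m \<le> 2 ^ m"
        using mult_right_mono[of "r / s" 1 "2 ^ m"] mult_nonneg_nonneg[of "r / s" "2 ^ m"] by simp_all
      then show "real (j m) \<le> r / s * 2 ^ m" "r / s * 2 ^ m - 1 \<le> real (j m)"
        unfolding j_def by linarith+
      then have "real (j m) \<le> real (2 ^ m)"
        using * \<open>real (j m) \<le> r / s * 2 ^ m\<close> by (simp only: of_nat_power of_nat_numeral)
      then show "j m \<le> 2 ^ m"
        by (simp only: of_nat_le_iff)
    qed
    have rs: "s * (r / s) = r"
      using r by auto
    have lim: "(\<lambda>m. \<tau> m (j m)) \<longlonglongrightarrow> r"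
    proof (rule tendsto_sandwich)
      have "(\<lambda>m. r - s * (1 / 2) ^ m) \<longlonglongrightarrow> r - s * 0"
        by (intro tendsto_intros) auto
      then show "(\<lambda>m. r - s * (1 / 2) ^ m) \<longlonglongrightarrow> r" by simp
      show "\<forall>\<^sub>F m in sequentially. r - s * (1 / 2) ^ m \<le> \<tau> m (j m)"
      proof (rule always_eventually, rule allI)
        fix m :: nat
        have "(r / s * 2 ^ m - 1) / 2 ^ m \<le> real (j m) / 2 ^ m"
          using j(3)[of m] by (rule divide_right_mono) simp
        then have "r / s - (1 / 2) ^ m \<le> real (j m) / 2 ^ m"
          by (simp add: diff_divide_distrib power_one_over)
        from mult_left_mono[OF this s] show "r - s * (1 / 2) ^ m \<le> \<tau> m (j m)"
          using j(1)[of m] rs by (simp add: \<tau>_def right_diff_distrib)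
      qed
      show "\<forall>\<^sub>F m in sequentially. \<tau> m (j m) \<le> r"
      proof (rule always_eventually, rule allI)
        fix m :: nat
        have "real (j m) / 2 ^ m \<le> r / s"
          using j(2)[of m] by (simp add: pos_divide_le_eq)
        from mult_left_mono[OF this s] show "\<tau> m (j m) \<le> r"
          using j(1)[of m] rs by (simp add: \<tau>_def)
      qed
    qed simp
    show "(\<lambda>\<omega>. B (\<tau> m (j m)) \<omega> - B 0 \<omega>) \<in> borel_measurable G" for m
      using j(1) by (rule grid_G)
    show "(\<lambda>m. B (\<tau> m (j m)) \<omega> - B 0 \<omega>) \<longlonglongrightarrow> B r \<omega> - B 0 \<omega>" if "\<omega> \<in> space G" for \<omega>
      using that r \<tau> G(2)
      by (intro tendsto_diff tendsto_const continuous_on_tendsto_compose[OF continuous_paths lim]) auto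
  qed
  have approx: "\<exists>E'\<in>sets G. AE \<omega> in M. \<omega> \<in> E \<longleftrightarrow> \<omega> \<in> E'" if "E \<in> sets (filt s)" for E
    using that unfolding sets_filt
  proof (induction rule: sigma_sets.induct)
    case (Basic E)
    then consider r A where "0 \<le> r" "r \<le> s" "A \<in> sets borel" "E = B r -` A \<inter> space M" | "E \<in> null_sets M"
      by blast
    then show ?case
    proof cases
      case 1
      \<comment> \<open>\<open>G\<close> knows increments only. The missing starting value is almost
        surely the constant \<open>x\<^sub>0\<close>, which is why events are matched only up to
        null sets.\<close>
      have "(\<lambda>\<omega>. x\<^sub>0 + (B r \<omega> - B 0 \<omega>)) \<in> borel_measurable G"
        using B_G[OF 1(1,2)] by measurable
      from measurable_sets[OF this 1(3)] show ?thesis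
      proof (rule bexI[rotated])
        show "AE \<omega> in M. (\<omega> \<in> E) = (\<omega> \<in> (\<lambda>\<omega>. x\<^sub>0 + (B r \<omega> - B 0 \<omega>)) -` A \<inter> space G)"
          using start by eventually_elim (simp add: 1(4) G)
      qed
    next
      case 2
      then show ?thesis
        by (intro bexI[of _ "{}"]) (auto dest: AE_not_in)
    qed
  next
    case Empty
    then show ?case by (intro bexI[of _ "{}"]) auto
  next
    case (Compl E)
    then obtain E' where "E' \<in> sets G" "AE \<omega> in M. \<omega> \<in> E \<longleftrightarrow> \<omega> \<in> E'" by blast
    then show ?case
      by (intro bexI[of _ "space G - E'"] sets.compl_sets) (auto simp: G(2) elim!: eventually_mono)
  next
    case (Union E)
    then obtain E' where E': "\<And>i. E' i \<in> sets G" "\<And>i. AE \<omega> in M. \<omega> \<in> E i \<longleftrightarrow> \<omega> \<in> E' i" by metis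
    from E'(2) have "AE \<omega> in M. \<forall>i. \<omega> \<in> E i \<longleftrightarrow> \<omega> \<in> E' i"
      by (simp add: AE_all_countable)
    then have "AE \<omega> in M. \<omega> \<in> (\<Union>i. E i) \<longleftrightarrow> \<omega> \<in> (\<Union>i. E' i)"
      by eventually_elim auto
    with E'(1) show ?case
      by (intro bexI[of _ "\<Union>i. E' i"]) auto
  qed
  show ?thesis
    unfolding D_def[symmetric]
  proof (rule indep_setI)
    show "sets (filt s) \<subseteq> sets M" by (rule sets_filt_subset)
    show D_sig: "sigma_sets (space M) D \<subseteq> sets M"
      using D_events by (rule sets.sigma_sets_subset)
    fix E F assume E: "E \<in> sets (filt s)" and F: "F \<in> sigma_sets (space M) D"
    obtain E' where E': "E' \<in> sets G" "AE \<omega> in M. \<omega> \<in> E \<longleftrightarrow> \<omega> \<in> E'"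
      using approx[OF E] by blast
    have [measurable]: "E \<in> sets M" "E' \<in> sets M" "F \<in> sets M"
      using E E' F G_sub D_sig sets_filt_subset by auto
    have "prob (E \<inter> F) = prob (E' \<inter> F)" "prob E = prob E'"
      using E'(2) by (auto intro!: finite_measure_eq_AE elim!: eventually_mono)
    moreover have "prob (E' \<inter> F) = prob E' * prob F"
      using indep_setD[OF indep2] E' F G by auto
    ultimately show "prob (E \<inter> F) = prob E * prob F" by simp
  qed
qed

end

section \<open>Dynkin's formula for optional times\<close>

text \<open>Rounding \<open>\<tau>\<close> up to a multiple of \<open>1 / (m+1)\<close> gives a time
  with countably many values, for which measurability is immediate; continuity of the path passes to
  the limit.\<close>

lemma (in prob_space) random_time_measurable:
  fixes Z :: "real \<Rightarrow> 'a \<Rightarrow> real"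
  assumes Z: "\<And>t. 0 \<le> t \<Longrightarrow> Z t \<in> borel_measurable M"
    and cont: "\<And>\<omega>. \<omega> \<in> space M \<Longrightarrow> continuous_on {0..} (\<lambda>t. Z t \<omega>)"
    and \<tau> [measurable]: "\<tau> \<in> borel_measurable M" and nonneg: "\<And>\<omega>. \<omega> \<in> space M \<Longrightarrow> 0 \<le> \<tau> \<omega>"
  shows "(\<lambda>\<omega>. Z (\<tau> \<omega>) \<omega>) \<in> borel_measurable M"
proof (rule borel_measurable_LIMSEQ_real)
  define J where "J m \<omega> = nat \<lceil>\<tau> \<omega> * real (Suc m)\<rceil>" for m \<omega>
  have [measurable]: "J m \<in> measurable M (count_space UNIV)" for m
    unfolding J_def by measurable
  show "(\<lambda>\<omega>. Z (real (J m \<omega>) / real (Suc m)) \<omega>) \<in> borel_measurable M" for m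
    by (rule measurable_compose_countable[where g = "J m" and f = "\<lambda>j. Z (real j / real (Suc m))"]) (auto intro: Z)
  fix \<omega> assume \<omega>: "\<omega> \<in> space M"
  have J: "\<tau> \<omega> \<le> real (J m \<omega>) / real (Suc m)" "real (J m \<omega>) / real (Suc m) \<le> \<tau> \<omega> + 1 / real (Suc m)" for m
  proof -
    have "0 \<le> \<tau> \<omega> * real (Suc m)"
      using nonneg[OF \<omega>] by (intro mult_nonneg_nonneg) auto
    then have "\<tau> \<omega> * real (Suc m) \<le> real (J m \<omega>)" "real (J m \<omega>) \<le> \<tau> \<omega> * real (Suc m) + 1"
      unfolding J_def by linarith+
    from divide_right_mono[OF this(1), of "real (Suc m)"] divide_right_mono[OF this(2), of "real (Suc m)"]
    show "\<tau> \<omega> \<le> real (J m \<omega>) / real (Suc m)" "real (J m \<omega>) / real (Suc m) \<le> \<tau> \<omega> + 1 / real (Suc m)"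
      by (simp_all add: add_divide_distrib del: of_nat_Suc)
  qed
  have lim: "(\<lambda>m. real (J m \<omega>) / real (Suc m)) \<longlonglongrightarrow> \<tau> \<omega>"
  proof (rule Lim_transform)
    have "(\<lambda>m. 1 / real (Suc m)) \<longlonglongrightarrow> 0"
      by (intro LIMSEQ_Suc lim_1_over_n)
    then show "(\<lambda>m. real (J m \<omega>) / real (Suc m) - \<tau> \<omega>) \<longlonglongrightarrow> 0"
    proof (rule Lim_null_comparison[rotated], intro always_eventually allI)
      fix m
      show "norm (real (J m \<omega>) / real (Suc m) - \<tau> \<omega>) \<le> 1 / real (Suc m)"
        using J[of m] by (simp add: abs_le_iff del: of_nat_Suc)
    qed
  qed simp
  show "(\<lambda>m. Z (real (J m \<omega>) / real (Suc m)) \<omega>) \<longlonglongrightarrow> Z (\<tau> \<omega>) \<omega>"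
    using nonneg[OF \<omega>] by (intro continuous_on_tendsto_compose[OF cont[OF \<omega>] lim]) auto
qed

text \<open>Collapses a grid sum cut off at a random index into one evaluation at the stopped grid
  point.\<close>

lemma sum_stopped_telescope:
  fixes a :: "nat \<Rightarrow> real"
  shows "(\<Sum>k<n. of_bool (k < J) * (a (Suc k) - a k)) = a (min n J) - a 0"
proof (induction n)
  case (Suc n)
  have "J \<le> n \<Longrightarrow> min (Suc n) J = min n J" "\<not> J \<le> n \<Longrightarrow> min (Suc n) J = Suc n \<and> min n J = n"
    by auto
  with Suc show ?case
    by (cases "J \<le> n") simp_all
qed simp

context brownian_motion
begin

text \<open>The exact third absolute moment carries the factor \<open>2 * sqrt (2 / pi)\<close>,
  rounded up to 2. What matters is the order \<open>(t - s)\<close> to the power 3/2: summed over a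
  grid of fixed total length it still tends to 0.\<close>

lemma increment_moments:
  assumes "0 \<le> s" "s < t"
  shows "integrable M (\<lambda>\<omega>. B t \<omega> - B s \<omega>)" "expectation (\<lambda>\<omega>. B t \<omega> - B s \<omega>) = 0"
    "integrable M (\<lambda>\<omega>. (B t \<omega> - B s \<omega>)\<^sup>2)" "expectation (\<lambda>\<omega>. (B t \<omega> - B s \<omega>)\<^sup>2) = t - s"
    "integrable M (\<lambda>\<omega>. \<bar>B t \<omega> - B s \<omega>\<bar> ^ 3)"
    "expectation (\<lambda>\<omega>. \<bar>B t \<omega> - B s \<omega>\<bar> ^ 3) \<le> 2 * sqrt (t - s) ^ 3"
proof -
  define \<sigma> where "\<sigma> = sqrt (t - s)"
  have \<sigma>: "0 < \<sigma>" "\<sigma>\<^sup>2 = t - s"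
    using assms by (auto simp: \<sigma>_def)
  have D: "distributed M lborel (\<lambda>\<omega>. B t \<omega> - B s \<omega>) (normal_density 0 \<sigma>)"
    unfolding \<sigma>_def using assms by (rule normal_increments)
  note int = distributed_integrable[OF D _ normal_density_nonneg]
    and exp = distributed_integral[OF D _ normal_density_nonneg]
  have m1: "has_bochner_integral lborel (\<lambda>x. normal_density 0 \<sigma> x * x) 0"
    using normal_moment_nz_1[OF \<sigma>(1), of 0] .
  have m2: "has_bochner_integral lborel (\<lambda>x. normal_density 0 \<sigma> x * x\<^sup>2) (t - s)"
    using normal_moment_even[OF \<sigma>(1), of 0 1] \<sigma> by (simp add: diff_divide_distrib)
  have m3: "has_bochner_integral lborel (\<lambda>x. normal_density 0 \<sigma> x * \<bar>x\<bar> ^ 3) (2 * \<sigma> ^ 3 * sqrt (2 / pi))"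
    using normal_moment_abs_odd[OF \<sigma>(1), of 0 1] by (simp add: eval_nat_numeral)
  show "integrable M (\<lambda>\<omega>. B t \<omega> - B s \<omega>)" "expectation (\<lambda>\<omega>. B t \<omega> - B s \<omega>) = 0"
    using int[of "\<lambda>x. x"] exp[of "\<lambda>x. x"] m1 by (simp_all add: has_bochner_integral_iff)
  show "integrable M (\<lambda>\<omega>. (B t \<omega> - B s \<omega>)\<^sup>2)" "expectation (\<lambda>\<omega>. (B t \<omega> - B s \<omega>)\<^sup>2) = t - s"
    using int[of "\<lambda>x. x\<^sup>2"] exp[of "\<lambda>x. x\<^sup>2"] m2 by (simp_all add: has_bochner_integral_iff)
  show "integrable M (\<lambda>\<omega>. \<bar>B t \<omega> - B s \<omega>\<bar> ^ 3)"
    using int[of "\<lambda>x. \<bar>x\<bar> ^ 3"] m3 by (simp add: has_bochner_integral_iff)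
  have "expectation (\<lambda>\<omega>. \<bar>B t \<omega> - B s \<omega>\<bar> ^ 3) = 2 * \<sigma> ^ 3 * sqrt (2 / pi)"
    using exp[of "\<lambda>x. \<bar>x\<bar> ^ 3"] m3 by (simp add: has_bochner_integral_iff)
  also have "\<dots> \<le> 2 * \<sigma> ^ 3 * 1"
    using \<sigma> pi_gt3 by (intro mult_left_mono) auto
  finally show "expectation (\<lambda>\<omega>. \<bar>B t \<omega> - B s \<omega>\<bar> ^ 3) \<le> 2 * sqrt (t - s) ^ 3"
    by (simp add: \<sigma>_def)
qed

text \<open>Used with \<open>\<phi>\<close> the identity and the square: a factor known at time
  \<open>s\<close> splits off, so the linear Taylor term has mean zero and the squared increment may
  be replaced by \<open>t - s\<close>.\<close>

lemma filt_indep_increment: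
  fixes Y :: "'a \<Rightarrow> real" and \<phi> :: "real \<Rightarrow> real"
  assumes s: "0 \<le> s" "s < t" and Y: "Y \<in> borel_measurable (filt s)" and bd: "\<And>\<omega>. \<bar>Y \<omega>\<bar> \<le> K"
    and \<phi> [measurable]: "\<phi> \<in> borel_measurable borel" and int: "integrable M (\<lambda>\<omega>. \<phi> (B t \<omega> - B s \<omega>))"
  shows "integrable M (\<lambda>\<omega>. Y \<omega> * \<phi> (B t \<omega> - B s \<omega>))"
    "expectation (\<lambda>\<omega>. Y \<omega> * \<phi> (B t \<omega> - B s \<omega>)) = expectation Y * expectation (\<lambda>\<omega>. \<phi> (B t \<omega> - B s \<omega>))"
proof -
  have YM: "Y \<in> borel_measurable M"
    using Y by (rule measurable_filtD)
  have DM [measurable]: "(\<lambda>\<omega>. B t \<omega> - B s \<omega>) \<in> borel_measurable M"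
    using s by (intro borel_measurable_diff random_variable_B) auto
  have "indep_var borel Y borel (\<lambda>\<omega>. B t \<omega> - B s \<omega>)"
    unfolding indep_var_eq
  proof (intro conjI YM DM)
    have "{Y -` A \<inter> space M |A. A \<in> sets borel} \<subseteq> sets (filt s)"
      using measurable_sets[OF Y] by auto
    then have "sigma_sets (space M) {Y -` A \<inter> space M |A. A \<in> sets borel} \<subseteq> sets (filt s)"
      using sets.sigma_sets_subset[of _ "filt s"] by simp
    then show "indep_set (sigma_sets (space M) {Y -` A \<inter> space M |A. A \<in> sets borel})
       (sigma_sets (space M) {(\<lambda>\<omega>. B t \<omega> - B s \<omega>) -` A \<inter> space M |A. A \<in> sets borel})"
      using indep_set_filt[OF s] by (intro indep_setI) (auto dest: indep_setD indep_setD_ev1 indep_setD_ev2)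
  qed
  from indep_var_compose[OF this measurable_ident \<phi>]
  have iv: "indep_var borel Y borel (\<lambda>\<omega>. \<phi> (B t \<omega> - B s \<omega>))"
    by (simp add: comp_def)
  have iY: "integrable M Y"
    using YM bd by (intro integrable_const_bound[of _ K]) auto
  show "integrable M (\<lambda>\<omega>. Y \<omega> * \<phi> (B t \<omega> - B s \<omega>))"
    "expectation (\<lambda>\<omega>. Y \<omega> * \<phi> (B t \<omega> - B s \<omega>)) = expectation Y * expectation (\<lambda>\<omega>. \<phi> (B t \<omega> - B s \<omega>))"
    by (rule indep_var_integrable[OF iv iY int] indep_var_lebesgue_integral[OF iv iY int])+
qed

text \<open>A Taylor expansion at \<open>B s\<close>: the linear term vanishes in mean, the
  quadratic one yields the generator term, and the third absolute moment controls the
  remainder.\<close>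

lemma dynkin_step:
  fixes g g1 g2 g3 :: "real \<Rightarrow> real"
  assumes g: "\<And>x. (g has_real_derivative g1 x) (at x)" "\<And>x. (g1 has_real_derivative g2 x) (at x)"
      "\<And>x. (g2 has_real_derivative g3 x) (at x)"
    and bd: "\<And>x. \<bar>g x\<bar> \<le> C" "\<And>x. \<bar>g1 x\<bar> \<le> C" "\<And>x. \<bar>g2 x\<bar> \<le> C" "\<And>x. \<bar>g3 x\<bar> \<le> C"
    and s: "0 \<le> s" "s < t" and E: "E \<in> sets (filt s)"
  shows "\<bar>expectation (\<lambda>\<omega>. indicator E \<omega> * (g (B t \<omega>) - g (B s \<omega>)))
      - (t - s) / 2 * expectation (\<lambda>\<omega>. indicator E \<omega> * g2 (B s \<omega>))\<bar> \<le> 2 * C * sqrt (t - s) ^ 3"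
proof -
  have C: "0 \<le> C"
    using bd(1)[of 0] by linarith
  have cont: "isCont g x" "isCont g1 x" "isCont g2 x" for x
    using g DERIV_isCont by blast+
  have [measurable]: "g \<in> borel_measurable borel" "g1 \<in> borel_measurable borel" "g2 \<in> borel_measurable borel"
    using cont by (auto intro!: borel_measurable_continuous_onI simp: continuous_on_eq_continuous_at)
  have [measurable]: "B s \<in> borel_measurable M" "B t \<in> borel_measurable M" "E \<in> sets M"
    using s random_variable_B sets_filtD[OF E] by auto
  define D where "D \<omega> = B t \<omega> - B s \<omega>" for \<omega>
  have [measurable]: "D \<in> borel_measurable M"
    unfolding D_def by measurable
  note mom = increment_moments[OF s, folded D_def]
  have Bs: "B s \<in> borel_measurable (filt s)"
    using s by (intro B_measurable_filt) auto
  define Y1 where "Y1 \<omega> = indicator E \<omega> * g1 (B s \<omega>)" for \<omega>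
  define Y2 where "Y2 \<omega> = indicator E \<omega> * g2 (B s \<omega>)" for \<omega>
  have Y: "Y1 \<in> borel_measurable (filt s)" "Y2 \<in> borel_measurable (filt s)"
    unfolding Y1_def Y2_def using E Bs by measurable
  have Ybd: "\<bar>Y1 \<omega>\<bar> \<le> C" "\<bar>Y2 \<omega>\<bar> \<le> C" for \<omega>
    using bd(2,3)[of "B s \<omega>"] C by (auto simp: Y1_def Y2_def indicator_def)
  note i1 = filt_indep_increment[OF s Y(1) Ybd(1), of "\<lambda>x. x", folded D_def, simplified, OF mom(1)]
  note i2 = filt_indep_increment[OF s Y(2) Ybd(2), of "\<lambda>x. x\<^sup>2", folded D_def, simplified, OF mom(3)]
  define R where "R \<omega> = indicator E \<omega> * (g (B t \<omega>) - g (B s \<omega>)) - Y1 \<omega> * D \<omega> - Y2 \<omega> * (D \<omega>)\<^sup>2 / 2" for \<omega>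
  have R: "\<bar>R \<omega>\<bar> \<le> C * \<bar>D \<omega>\<bar> ^ 3" for \<omega>
  proof (cases "\<omega> \<in> E")
    case True
    then show ?thesis
      using taylor2_remainder_le[OF g bd(4), of "B s \<omega>" "D \<omega>"] by (simp add: R_def Y1_def Y2_def D_def)
  next
    case False
    then show ?thesis
      using C by (simp add: R_def Y1_def Y2_def)
  qed
  have i0: "integrable M (\<lambda>\<omega>. indicator E \<omega> * (g (B t \<omega>) - g (B s \<omega>)))"
  proof (rule integrable_const_bound[of _ "2 * C"])
    show "AE \<omega> in M. norm (indicator E \<omega> * (g (B t \<omega>) - g (B s \<omega>))) \<le> 2 * C"
    proof (intro AE_I2)
      fix \<omega>
      show "norm (indicator E \<omega> * (g (B t \<omega>) - g (B s \<omega>))) \<le> 2 * C"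
        using bd(1)[of "B t \<omega>"] bd(1)[of "B s \<omega>"] C by (auto simp: indicator_def)
    qed
  qed measurable
  have i3: "integrable M (\<lambda>\<omega>. Y2 \<omega> * (D \<omega>)\<^sup>2 / 2)"
    using i2(1) by simp
  have "expectation R = expectation (\<lambda>\<omega>. indicator E \<omega> * (g (B t \<omega>) - g (B s \<omega>))) - (t - s) / 2 * expectation Y2"
    unfolding R_def using i0 i1 i2 i3 mom by simp
  moreover have "\<bar>expectation R\<bar> \<le> expectation (\<lambda>\<omega>. C * \<bar>D \<omega>\<bar> ^ 3)"
  proof -
    have "integrable M R"
      unfolding R_def using i0 i1 i3 by (intro Bochner_Integration.integrable_diff)
    moreover have "integrable M (\<lambda>\<omega>. C * \<bar>D \<omega>\<bar> ^ 3)"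
      using mom(5) by simp
    ultimately have "expectation (\<lambda>\<omega>. \<bar>R \<omega>\<bar>) \<le> expectation (\<lambda>\<omega>. C * \<bar>D \<omega>\<bar> ^ 3)"
      by (intro integral_mono R) auto
    then show ?thesis
      using integral_abs_bound[of M R] by linarith
  qed
  moreover have "expectation (\<lambda>\<omega>. C * \<bar>D \<omega>\<bar> ^ 3) \<le> 2 * C * sqrt (t - s) ^ 3"
    using mult_left_mono[OF mom(6) C] by simp
  ultimately show ?thesis
    unfolding Y2_def by linarith
qed

text \<open>The events \<open>u \<le> \<tau>\<close> decide whether a grid interval starting at
  \<open>u\<close> is counted, and this must be known at time \<open>u\<close>. First entrance times
  into open conditions have this form.\<close>

definition optional_time :: "real \<Rightarrow> ('a \<Rightarrow> real) \<Rightarrow> bool" where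
  "optional_time T \<tau> \<longleftrightarrow> \<tau> \<in> borel_measurable M \<and> (\<forall>\<omega>\<in>space M. 0 \<le> \<tau> \<omega> \<and> \<tau> \<omega> \<le> T) \<and>
    (\<forall>u. 0 \<le> u \<and> u \<le> T \<longrightarrow> {\<omega> \<in> space M. u \<le> \<tau> \<omega>} \<in> sets (filt u))"

lemma B_optional_measurable: "optional_time T \<tau> \<Longrightarrow> (\<lambda>\<omega>. B (\<tau> \<omega>) \<omega>) \<in> borel_measurable M"
  by (rule random_time_measurable[OF random_variable_B continuous_paths]) (auto simp: optional_time_def)

text \<open>Each of the \<open>N + 1\<close> grid intervals contributes an error of order
  \<open>h\<close> to the power 3/2, in total \<open>T * sqrt h\<close>. The sums \<open>S N\<close>
  of increments and \<open>Q N\<close> of generator terms converge pathwise and boundedly.\<close>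

lemma dynkin_formula:
  fixes g g1 g2 g3 :: "real \<Rightarrow> real"
  assumes g: "\<And>x. (g has_real_derivative g1 x) (at x)" "\<And>x. (g1 has_real_derivative g2 x) (at x)"
      "\<And>x. (g2 has_real_derivative g3 x) (at x)"
    and bd: "\<And>x. \<bar>g x\<bar> \<le> C" "\<And>x. \<bar>g1 x\<bar> \<le> C" "\<And>x. \<bar>g2 x\<bar> \<le> C" "\<And>x. \<bar>g3 x\<bar> \<le> C"
    and T: "0 < T" and \<tau>: "optional_time T \<tau>"
  shows "expectation (\<lambda>\<omega>. g (B (\<tau> \<omega>) \<omega>)) - g x\<^sub>0
      = expectation (\<lambda>\<omega>. LINT s:{0..\<tau> \<omega>}|lborel. g2 (B s \<omega>)) / 2" (is ?eq)
    and "(\<lambda>\<omega>. LINT s:{0..\<tau> \<omega>}|lborel. g2 (B s \<omega>)) \<in> borel_measurable M" (is ?meas)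
proof -
  have C: "0 \<le> C"
    using bd(1)[of 0] by linarith
  have cont: "isCont g x" "isCont g1 x" "isCont g2 x" for x
    using g DERIV_isCont by blast+
  have cont_on: "continuous_on UNIV g" "continuous_on UNIV g2"
    using cont by (simp_all add: continuous_on_eq_continuous_at)
  have g_meas [measurable]: "g \<in> borel_measurable borel" "g2 \<in> borel_measurable borel"
    using cont_on by (auto intro!: borel_measurable_continuous_onI)
  note \<tau>' = \<tau>[unfolded optional_time_def]
  have [measurable]: "\<tau> \<in> borel_measurable M" using \<tau>' by simp
  define h where "h N = T / real (Suc N)" for N
  define t where "t N k = real k * T / real (Suc N)" for N k
  have h: "0 < h N" for N
    using T by (simp add: h_def)
  have t_h: "t N k = real k * h N" for N k
    by (simp add: t_def h_def)
  have t_nonneg: "0 \<le> t N k" for N k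
    using T by (simp add: t_def)
  have t_le: "t N k \<le> T" if "k \<le> Suc N" for N k
  proof -
    have "real k * T \<le> real (Suc N) * T"
      using that T by (intro mult_right_mono) auto
    then show ?thesis
      by (simp add: t_def pos_divide_le_eq mult.commute)
  qed
  have B_meas [measurable]: "B (t N k) \<in> borel_measurable M" for N k
    using t_nonneg by (rule random_variable_B)
  define E where "E N k = {\<omega> \<in> space M. t N k \<le> \<tau> \<omega>}" for N k
  have E: "E N k \<in> sets (filt (t N k))" if "k < Suc N" for N k
    using \<tau>' t_nonneg t_le[of k N] that by (simp add: E_def)
  define S where "S N \<omega> = (\<Sum>k<Suc N. indicator (E N k) \<omega> * (g (B (t N (Suc k)) \<omega>) - g (B (t N k) \<omega>)))" for N \<omega>
  define Q where "Q N \<omega> = h N * (\<Sum>k<Suc N. indicator (E N k) \<omega> * g2 (B (t N k) \<omega>))" for N \<omega>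
  have h0: "h \<longlonglongrightarrow> 0"
    unfolding h_def using tendsto_mult_right_zero[OF LIMSEQ_Suc[OF lim_1_over_n], of T] by simp
  have E_meas [measurable]: "E N k \<in> sets M" for N k
    unfolding E_def by measurable
  have S_meas: "S N \<in> borel_measurable M" and Q_meas: "Q N \<in> borel_measurable M" for N
    unfolding S_def Q_def by measurable
  have path: "continuous_on {0..T} (\<lambda>s. g2 (B s \<omega>))" if "\<omega> \<in> space M" for \<omega>
    using continuous_on_compose2[OF cont_on(2), of "{0..T}" "\<lambda>s. B s \<omega>"]
      continuous_on_subset[OF continuous_paths[OF that], of "{0..T}"] by auto
  have Q_lim: "(\<lambda>N. Q N \<omega>) \<longlonglongrightarrow> (LINT s:{0..\<tau> \<omega>}|lborel. g2 (B s \<omega>))" if "\<omega> \<in> space M" for \<omega>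
    using riemann_sum_tendsto[OF T _ _ path[OF that], of "\<tau> \<omega>"] \<tau>' that
    by (simp add: Q_def h_def t_def E_def indicator_def of_bool_def del: sum.lessThan_Suc of_nat_Suc)
  show ?meas
    using Q_meas Q_lim by (rule borel_measurable_LIMSEQ_real[rotated])
  \<comment> \<open>The intervals counted are those that start at or before \<open>\<tau>\<close>,
    so the sum telescopes to the first grid point after \<open>\<tau>\<close>, or to
    \<open>T\<close> if there is none on the grid.\<close>
  have S_eq: "\<exists>\<sigma>. S N \<omega> = g (B \<sigma> \<omega>) - g (B 0 \<omega>) \<and> 0 \<le> \<sigma> \<and> \<bar>\<sigma> - \<tau> \<omega>\<bar> \<le> h N" if \<omega>: "\<omega> \<in> space M" for \<omega> N
  proof -
    define J where "J = Suc (nat \<lfloor>\<tau> \<omega> / h N\<rfloor>)"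
    have \<tau>0: "0 \<le> \<tau> \<omega>" "\<tau> \<omega> \<le> T" using \<tau>' \<omega> by auto
    have J1: "real J - 1 \<le> \<tau> \<omega> / h N" "\<tau> \<omega> / h N < real J"
      using \<tau>0 h[of N] unfolding J_def by (simp_all, linarith+)
    have J: "t N J \<le> \<tau> \<omega> + h N" "\<tau> \<omega> < t N J"
      using J1 h[of N] by (simp_all add: t_h field_simps)
    have "k < J \<longleftrightarrow> t N k \<le> \<tau> \<omega>" for k
    proof -
      have "t N k \<le> \<tau> \<omega> \<longleftrightarrow> real k \<le> \<tau> \<omega> / h N"
        using h[of N] by (simp add: t_h pos_le_divide_eq)
      also have "\<dots> \<longleftrightarrow> k \<le> nat \<lfloor>\<tau> \<omega> / h N\<rfloor>"
        using \<tau>0 h[of N] by (simp add: le_nat_iff le_floor_iff)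
      finally show ?thesis by (auto simp: J_def)
    qed
    then have "S N \<omega> = (\<Sum>k<Suc N. of_bool (k < J) * (g (B (t N (Suc k)) \<omega>) - g (B (t N k) \<omega>)))"
      unfolding S_def using \<omega> by (intro sum.cong) (auto simp: E_def)
    also have "\<dots> = g (B (t N (min (Suc N) J)) \<omega>) - g (B (t N 0) \<omega>)"
      by (rule sum_stopped_telescope)
    finally have "S N \<omega> = g (B (t N (min (Suc N) J)) \<omega>) - g (B 0 \<omega>)"
      by (simp add: t_def)
    moreover have "\<bar>t N (min (Suc N) J) - \<tau> \<omega>\<bar> \<le> h N"
    proof (cases "J \<le> Suc N")
      case True
      then show ?thesis using J by (simp add: min_def)
    next
      case False
      have "t N (Suc N) = T"
        by (simp add: t_def)
      moreover have "t N (Suc N) \<le> t N J"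
        using False h[of N] by (simp add: t_h)
      ultimately show ?thesis
        using False J \<tau>0 by (simp add: min_def)
    qed
    ultimately show ?thesis
      using t_nonneg by blast
  qed
  have S_lim: "(\<lambda>N. S N \<omega>) \<longlonglongrightarrow> g (B (\<tau> \<omega>) \<omega>) - g (B 0 \<omega>)" if \<omega>: "\<omega> \<in> space M" for \<omega>
  proof -
    obtain \<sigma> where \<sigma>: "\<And>N. S N \<omega> = g (B (\<sigma> N) \<omega>) - g (B 0 \<omega>)" "\<And>N. 0 \<le> \<sigma> N" "\<And>N. \<bar>\<sigma> N - \<tau> \<omega>\<bar> \<le> h N"
      using S_eq[OF \<omega>] by metis
    have "(\<lambda>N. \<sigma> N - \<tau> \<omega>) \<longlonglongrightarrow> 0"
      by (rule Lim_null_comparison[OF _ h0]) (use \<sigma>(3) in simp)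
    then have "\<sigma> \<longlonglongrightarrow> \<tau> \<omega>"
      by (simp add: LIM_zero_iff)
    then have "(\<lambda>N. B (\<sigma> N) \<omega>) \<longlonglongrightarrow> B (\<tau> \<omega>) \<omega>"
      using \<sigma>(2) \<tau>' \<omega> by (intro continuous_on_tendsto_compose[OF continuous_paths[OF \<omega>]]) auto
    then show ?thesis
      unfolding \<sigma>(1) by (intro tendsto_diff tendsto_const isCont_tendsto_compose[OF cont(1)])
  qed
  have S_bd: "\<bar>S N \<omega>\<bar> \<le> 2 * C" if \<omega>: "\<omega> \<in> space M" for N \<omega>
  proof -
    obtain \<sigma> where "S N \<omega> = g (B \<sigma> \<omega>) - g (B 0 \<omega>)"
      using S_eq[OF \<omega>] by blast
    then show ?thesis
      using bd(1)[of "B \<sigma> \<omega>"] bd(1)[of "B 0 \<omega>"] by linarith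
  qed
  have Q_bd: "\<bar>Q N \<omega>\<bar> \<le> T * C" for N \<omega>
  proof -
    have "\<bar>\<Sum>k<Suc N. indicator (E N k) \<omega> * g2 (B (t N k) \<omega>)\<bar> \<le> (\<Sum>k<Suc N. C)"
      using bd(3) C by (intro order_trans[OF sum_abs] sum_mono) (auto simp: indicator_def)
    then have "\<bar>Q N \<omega>\<bar> \<le> h N * (real (Suc N) * C)"
      unfolding Q_def abs_mult using h[of N] by (simp del: sum.lessThan_Suc)
    also have "\<dots> = T * C"
      by (simp add: h_def)
    finally show ?thesis .
  qed
  have B_opt [measurable]: "(\<lambda>\<omega>. B (\<tau> \<omega>) \<omega>) \<in> borel_measurable M"
    using \<tau> by (rule B_optional_measurable)
  have [measurable]: "B 0 \<in> borel_measurable M"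
    by (rule random_variable_B) simp
  have ES: "(\<lambda>N. expectation (S N)) \<longlonglongrightarrow> expectation (\<lambda>\<omega>. g (B (\<tau> \<omega>) \<omega>) - g (B 0 \<omega>))"
    by (rule integral_dominated_convergence[where w = "\<lambda>_. 2 * C"]) (use S_meas S_lim S_bd in auto)
  have EQ: "(\<lambda>N. expectation (Q N)) \<longlonglongrightarrow> expectation (\<lambda>\<omega>. LINT s:{0..\<tau> \<omega>}|lborel. g2 (B s \<omega>))"
    by (rule integral_dominated_convergence[where w = "\<lambda>_. T * C"]) (use Q_meas Q_lim Q_bd \<open>?meas\<close> in auto)
  have err: "\<bar>expectation (S N) - expectation (Q N) / 2\<bar> \<le> 2 * C * T * sqrt (h N)" for N
  proof -
    have iS: "integrable M (\<lambda>\<omega>. indicator (E N k) \<omega> * (g (B (t N (Suc k)) \<omega>) - g (B (t N k) \<omega>)))" for k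
      by (rule integrable_const_bound[of _ "2 * C"], rule AE_I2)
        (use bd(1) C in \<open>auto simp: indicator_def intro: order_trans[OF abs_triangle_ineq4 add_mono, of _ C _ C, simplified]\<close>)
    have iQ: "integrable M (\<lambda>\<omega>. indicator (E N k) \<omega> * g2 (B (t N k) \<omega>))" for k
      by (rule integrable_const_bound[of _ C]) (use bd(3) C in \<open>auto simp: indicator_def\<close>)
    have eS: "expectation (S N) = (\<Sum>k<Suc N. expectation (\<lambda>\<omega>. indicator (E N k) \<omega> * (g (B (t N (Suc k)) \<omega>) - g (B (t N k) \<omega>))))"
      unfolding S_def by (rule Bochner_Integration.integral_sum) (rule iS)
    have "expectation (Q N) = h N * (\<Sum>k<Suc N. expectation (\<lambda>\<omega>. indicator (E N k) \<omega> * g2 (B (t N k) \<omega>)))"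
      unfolding Q_def by (subst integral_mult_right_zero, subst Bochner_Integration.integral_sum) (auto intro: iQ)
    then have eQ: "expectation (Q N) / 2 = (\<Sum>k<Suc N. h N / 2 * expectation (\<lambda>\<omega>. indicator (E N k) \<omega> * g2 (B (t N k) \<omega>)))"
      by (simp only: sum_distrib_left) (simp only: sum_divide_distrib times_divide_eq_left)
    have "\<bar>expectation (S N) - expectation (Q N) / 2\<bar> \<le> (\<Sum>k<Suc N. 2 * C * sqrt (h N) ^ 3)"
      unfolding eS eQ sum_subtractf[symmetric]
    proof (intro order_trans[OF sum_abs] sum_mono)
      fix k assume "k \<in> {..<Suc N}"
      then have k: "k < Suc N" by simp
      have d: "t N (Suc k) - t N k = h N"
        by (simp add: t_h algebra_simps)
      have lt: "t N k < t N (Suc k)"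
        using d h[of N] by linarith
      show "\<bar>expectation (\<lambda>\<omega>. indicator (E N k) \<omega> * (g (B (t N (Suc k)) \<omega>) - g (B (t N k) \<omega>)))
         - h N / 2 * expectation (\<lambda>\<omega>. indicator (E N k) \<omega> * g2 (B (t N k) \<omega>))\<bar> \<le> 2 * C * sqrt (h N) ^ 3"
        using dynkin_step[OF g bd t_nonneg lt E[OF k]] unfolding d .
    qed
    \<comment> \<open>The cube of \<open>sqrt (h N)\<close> is split as
      \<open>h N * sqrt (h N)\<close>; the first factor and the number of steps combine to
      \<open>T\<close>.\<close>
    also have "\<dots> = 2 * C * (real (Suc N) * h N) * sqrt (h N)"
      using h[of N] by (simp add: power3_eq_cube del: sum.lessThan_Suc)
    also have "real (Suc N) * h N = T"
      by (simp add: h_def)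
    finally show ?thesis .
  qed
  have "(\<lambda>N. 2 * C * T * sqrt (h N)) \<longlonglongrightarrow> 2 * C * T * sqrt 0"
    by (intro tendsto_intros h0)
  then have err0: "(\<lambda>N. 2 * C * T * sqrt (h N)) \<longlonglongrightarrow> 0"
    by simp
  have "(\<lambda>N. expectation (S N) - expectation (Q N) / 2) \<longlonglongrightarrow> 0"
    by (rule Lim_null_comparison[OF _ err0]) (use err in simp)
  moreover have "(\<lambda>N. expectation (S N) - expectation (Q N) / 2) \<longlonglongrightarrow>
     expectation (\<lambda>\<omega>. g (B (\<tau> \<omega>) \<omega>) - g (B 0 \<omega>)) - expectation (\<lambda>\<omega>. LINT s:{0..\<tau> \<omega>}|lborel. g2 (B s \<omega>)) / 2"
    by (intro tendsto_intros ES EQ) simp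
  ultimately have "expectation (\<lambda>\<omega>. g (B (\<tau> \<omega>) \<omega>) - g (B 0 \<omega>)) = expectation (\<lambda>\<omega>. LINT s:{0..\<tau> \<omega>}|lborel. g2 (B s \<omega>)) / 2"
    using LIMSEQ_unique by fastforce
  moreover have "expectation (\<lambda>\<omega>. g (B (\<tau> \<omega>) \<omega>) - g (B 0 \<omega>)) = expectation (\<lambda>\<omega>. g (B (\<tau> \<omega>) \<omega>) - g x\<^sub>0)"
    using start by (intro integral_cong_AE) (auto elim: eventually_mono)
  moreover have "integrable M (\<lambda>\<omega>. g (B (\<tau> \<omega>) \<omega>))"
    by (rule integrable_const_bound[of _ C]) (use bd(1) in auto)
  ultimately show ?eq
    by (simp add: prob_space)
qed

end

section \<open>Local time and Tanaka's formula\<close>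

lemma bump_integral:
  assumes "e > 0"
  shows "has_bochner_integral lborel (\<lambda>x. bump e (x - a)) 1"
proof -
  have "has_bochner_integral lborel (\<lambda>x. bump 1 (- a / e + 1 / e * x)) (1 /\<^sub>R \<bar>1 / e\<bar>)"
    using assms bump_1_integral by (intro lborel_has_bochner_integral_real_affine_iff[THEN iffD1]) auto
  from has_bochner_integral_mult_left[OF this, of "1 / e"]
  have "has_bochner_integral lborel (\<lambda>x. bump 1 ((x - a) / e) / e) 1"
    using assms by (simp add: diff_divide_distrib)
  moreover have "bump 1 ((x - a) / e) / e = bump e (x - a)" for x
    using bump_scale[OF assms, of "(x - a) / e"] assms by simp
  ultimately show ?thesis by simp
qed

context brownian_local_time
begin

text \<open>One event of full measure on which every pathwise statement below holds for all times
  and levels at once, so that exceptional sets need no further bookkeeping.\<close>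

definition regular :: "'a \<Rightarrow> bool" where
  "regular \<omega> \<longleftrightarrow> \<omega> \<in> space M \<and> B 0 \<omega> = x\<^sub>0 \<and> (\<forall>u\<ge>0. \<forall>f \<in> borel_measurable borel.
    (\<integral>\<^sup>+ s \<in> {0..u}. f (B s \<omega>) \<partial>lborel) = (\<integral>\<^sup>+ x. f x * ennreal (L u x \<omega>) \<partial>lborel))"

lemma AE_regular: "AE \<omega> in M. regular \<omega>"
  using occupation_formula start AE_space unfolding regular_def by eventually_elim blast

lemma regular_space: "regular \<omega> \<Longrightarrow> \<omega> \<in> space M"
  by (simp add: regular_def)

lemma regular_start: "regular \<omega> \<Longrightarrow> B 0 \<omega> = x\<^sub>0"
  by (simp add: regular_def)

lemma L_continuous_space: "\<omega> \<in> space M \<Longrightarrow> 0 \<le> u \<Longrightarrow> continuous_on UNIV (\<lambda>x. L u x \<omega>)"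
  using continuous_on_compose2[OF L_continuous, of \<omega> UNIV "\<lambda>x. (u, x)"]
  by (simp add: continuous_on_Pair image_subset_iff)

lemma L_continuous_time: "\<omega> \<in> space M \<Longrightarrow> continuous_on {0..} (\<lambda>u. L u x \<omega>)"
  using continuous_on_compose2[OF L_continuous, of \<omega> "{0..}" "\<lambda>u. (u, x)"]
  by (simp add: continuous_on_Pair image_subset_iff)

lemma L_measurable_space: "\<omega> \<in> space M \<Longrightarrow> 0 \<le> u \<Longrightarrow> (\<lambda>x. L u x \<omega>) \<in> borel_measurable borel"
  by (intro borel_measurable_continuous_onI L_continuous_space)

text \<open>By continuity a positive value at \<open>x\<close> would persist on an interval outside
  the range, whereas the occupation formula for the indicator of the outside gives total local time
  0 there.\<close>

lemma L_eq_0_outside_range: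
  assumes \<omega>: "regular \<omega>" and u: "0 \<le> u" and R: "\<And>s. 0 \<le> s \<Longrightarrow> s \<le> u \<Longrightarrow> \<bar>B s \<omega>\<bar> \<le> R" and x: "R < \<bar>x\<bar>"
  shows "L u x \<omega> = 0"
proof (rule ccontr)
  assume "L u x \<omega> \<noteq> 0"
  then have pos: "0 < L u x \<omega>"
    using L_nonneg[OF regular_space[OF \<omega>] u, of x] by simp
  define U where "U = {z. R < \<bar>z\<bar>} \<inter> {z. 0 < L u z \<omega>}"
  have "open U"
    unfolding U_def using L_continuous_space[OF regular_space[OF \<omega>] u]
    by (intro open_Int open_Collect_less continuous_intros) auto
  moreover have "x \<in> U"
    using pos x by (simp add: U_def)
  ultimately obtain d where d: "0 < d" "cball x d \<subseteq> U"
    using open_contains_cball by blast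
  have Lm [measurable]: "(\<lambda>x. L u x \<omega>) \<in> borel_measurable borel"
    by (rule L_measurable_space[OF regular_space[OF \<omega>] u])
  have Um: "{z. R < \<bar>z\<bar>} \<in> sets borel"
    by measurable
  define f where "f = (indicator {z. R < \<bar>z\<bar>} :: real \<Rightarrow> ennreal)"
  have fm [measurable]: "f \<in> borel_measurable borel"
    unfolding f_def by (rule borel_measurable_indicator[OF Um])
  have "(\<integral>\<^sup>+ s \<in> {0..u}. f (B s \<omega>) \<partial>lborel) = (\<integral>\<^sup>+ s. 0 \<partial>(lborel :: real measure))"
  proof (rule nn_integral_cong)
    fix s
    show "f (B s \<omega>) * indicator {0..u} s = 0"
    proof (cases "s \<in> {0..u}")
      case True
      then have "B s \<omega> \<notin> {z. R < \<bar>z\<bar>}"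
        using R[of s] by simp
      then show ?thesis
        by (simp add: f_def)
    qed simp
  qed
  then have "(\<integral>\<^sup>+ x. f x * ennreal (L u x \<omega>) \<partial>lborel) = 0"
    using \<omega> u fm unfolding regular_def by auto
  then have "AE z in lborel. f z * ennreal (L u z \<omega>) = 0"
    by (subst (asm) nn_integral_0_iff_AE) auto
  then have "AE z in lborel. z \<notin> {x - d..x + d}"
  proof eventually_elim
    case (elim z)
    show ?case
    proof
      assume "z \<in> {x - d..x + d}"
      then have "z \<in> U"
        using d by (auto simp: dist_real_def subset_iff)
      then show False
        using elim by (auto simp: U_def f_def)
    qed
  qed
  then have "emeasure lborel {x - d..x + d} = 0"
    by (subst (asm) AE_iff_measurable[where N = "{x - d..x + d}"]) auto
  then show False
    using d by (simp add: ennreal_eq_0_iff)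
qed

lemma B_bounded:
  assumes "\<omega> \<in> space M"
  obtains R where "\<And>s. 0 \<le> s \<Longrightarrow> s \<le> u \<Longrightarrow> \<bar>B s \<omega>\<bar> \<le> R"
proof -
  have "compact ((\<lambda>s. B s \<omega>) ` {0..u})"
    by (intro compact_continuous_image continuous_on_subset[OF continuous_paths[OF assms]]) auto
  then have "bounded ((\<lambda>s. B s \<omega>) ` {0..u})"
    by (rule compact_imp_bounded)
  then obtain R where "\<forall>y \<in> (\<lambda>s. B s \<omega>) ` {0..u}. norm y \<le> R"
    unfolding bounded_iff by blast
  then show thesis
    by (intro that[of R]) auto
qed

lemma L_bounded:
  assumes \<omega>: "regular \<omega>" and u: "0 \<le> u"
  obtains C where "\<And>x. L u x \<omega> \<le> C"
proof -
  obtain R where R: "\<And>s. 0 \<le> s \<Longrightarrow> s \<le> u \<Longrightarrow> \<bar>B s \<omega>\<bar> \<le> R"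
    using B_bounded[OF regular_space[OF \<omega>], of u] by blast
  have "compact ((\<lambda>x. L u x \<omega>) ` {-R..R})"
    by (intro compact_continuous_image continuous_on_subset[OF L_continuous_space[OF regular_space[OF \<omega>] u]]) auto
  then have "bounded ((\<lambda>x. L u x \<omega>) ` {-R..R})"
    by (rule compact_imp_bounded)
  then obtain C where C: "\<forall>y \<in> (\<lambda>x. L u x \<omega>) ` {-R..R}. norm y \<le> C"
    unfolding bounded_iff by blast
  have "L u x \<omega> \<le> max C 0" for x
  proof (cases "x \<in> {-R..R}")
    case True
    then have "\<bar>L u x \<omega>\<bar> \<le> C"
      using C by auto
    then show ?thesis by simp
  next
    case False
    then have "L u x \<omega> = 0"
      using R by (intro L_eq_0_outside_range[OF \<omega> u]) auto
    then show ?thesis by simp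
  qed
  then show thesis by (rule that)
qed

lemma occupation_bump:
  assumes \<omega>: "regular \<omega>" and u: "0 \<le> u"
  shows "(LINT s:{0..u}|lborel. bump e (B s \<omega> - y)) = (LINT x|lborel. bump e (x - y) * L u x \<omega>)"
proof -
  \<comment> \<open>Paths are continuous only on nonnegative times; freezing them at
    \<open>B 0\<close> for negative times gives a Borel function on the whole line.\<close>
  have "continuous_on UNIV (\<lambda>s. B (max 0 s) \<omega>)"
    by (rule continuous_on_compose2[OF continuous_paths[OF regular_space[OF \<omega>]], of UNIV "max 0"])
      (auto intro!: continuous_intros)
  then have [measurable]: "(\<lambda>s. B (max 0 s) \<omega>) \<in> borel_measurable borel"
    by (rule borel_measurable_continuous_onI)
  have [measurable]: "(\<lambda>x. L u x \<omega>) \<in> borel_measurable borel"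
    by (rule L_measurable_space[OF regular_space[OF \<omega>] u])
  have "(LINT s:{0..u}|lborel. bump e (B s \<omega> - y)) = (LINT s:{0..u}|lborel. bump e (B (max 0 s) \<omega> - y))"
    by (intro set_lebesgue_integral_cong) auto
  also have "\<dots> = enn2real (\<integral>\<^sup>+s. ennreal (indicator {0..u} s * bump e (B (max 0 s) \<omega> - y)) \<partial>lborel)"
    unfolding set_lebesgue_integral_def real_scaleR_def
    by (intro integral_eq_nn_integral) (auto simp: bump_nonneg)
  also have "(\<integral>\<^sup>+s. ennreal (indicator {0..u} s * bump e (B (max 0 s) \<omega> - y)) \<partial>lborel)
      = (\<integral>\<^sup>+s \<in> {0..u}. ennreal (bump e (B s \<omega> - y)) \<partial>lborel)"
    by (intro nn_integral_cong) (auto simp: indicator_def max_def)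
  also have "\<dots> = (\<integral>\<^sup>+x. ennreal (bump e (x - y)) * ennreal (L u x \<omega>) \<partial>lborel)"
  proof -
    have "(\<lambda>x. ennreal (bump e (x - y))) \<in> borel_measurable borel"
      by measurable
    moreover have "\<forall>f\<in>borel_measurable borel. (\<integral>\<^sup>+x\<in>{0..u}. f (B x \<omega>) \<partial>lborel) = (\<integral>\<^sup>+x. f x * ennreal (L u x \<omega>) \<partial>lborel)"
      using \<omega> u unfolding regular_def by blast
    ultimately show ?thesis
      by (rule bspec[rotated])
  qed
  also have "\<dots> = (\<integral>\<^sup>+x. ennreal (bump e (x - y) * L u x \<omega>) \<partial>lborel)"
    by (simp add: ennreal_mult'' L_nonneg[OF regular_space[OF \<omega>] u])
  also have "enn2real \<dots> = (LINT x|lborel. bump e (x - y) * L u x \<omega>)"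
    by (intro integral_eq_nn_integral[symmetric]) (auto simp: bump_nonneg L_nonneg[OF regular_space[OF \<omega>] u])
  finally show ?thesis .
qed

lemma occupation_bump_tendsto:
  assumes \<omega>: "regular \<omega>" and u: "0 \<le> u"
  shows "(\<lambda>m. LINT s:{0..u}|lborel. bump (1 / real (Suc m)) (B s \<omega> - y)) \<longlonglongrightarrow> L u y \<omega>"
proof -
  obtain C where "\<And>x. L u x \<omega> \<le> C"
    using L_bounded[OF \<omega> u] by blast
  then have "\<bar>L u x \<omega>\<bar> \<le> C" for x
    using L_nonneg[OF regular_space[OF \<omega>] u, of x] by simp
  then show ?thesis
    unfolding occupation_bump[OF \<omega> u]
    by (rule bump_delta[OF L_continuous_space[OF regular_space[OF \<omega>] u]])
qed

text \<open>The kernel has mass 1, so the bound does not depend on \<open>e\<close>. It supplies the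
  dominating constant when the smoothing is removed.\<close>

lemma occupation_bump_le:
  assumes \<omega>: "regular \<omega>" and u: "0 \<le> u" and e: "0 < e" and K: "\<And>x. L u x \<omega> \<le> K"
  shows "\<bar>LINT s:{0..u}|lborel. bump e (B s \<omega> - y)\<bar> \<le> K"
proof -
  note nn = L_nonneg[OF regular_space[OF \<omega>] u]
  have Lm [measurable]: "(\<lambda>x. L u x \<omega>) \<in> borel_measurable borel"
    by (rule L_measurable_space[OF regular_space[OF \<omega>] u])
  have i: "integrable lborel (\<lambda>x. bump e (x - y) * K)"
    using bump_integral[OF e, of y] by (intro integrable_mult_left) (simp add: has_bochner_integral_iff)
  have le: "bump e (x - y) * L u x \<omega> \<le> bump e (x - y) * K" for x
    by (intro mult_left_mono K bump_nonneg)
  have "integrable lborel (\<lambda>x. bump e (x - y) * L u x \<omega>)"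
    by (rule Bochner_Integration.integrable_bound[OF i])
      (auto simp: abs_mult bump_nonneg nn abs_of_nonneg[OF order_trans[OF nn K]] intro!: mult_left_mono K)
  then have "(LINT x|lborel. bump e (x - y) * L u x \<omega>) \<le> (LINT x|lborel. bump e (x - y) * K)"
    using i le by (intro integral_mono) auto
  also have "\<dots> = K"
    using bump_integral[OF e, of y] by (simp add: has_bochner_integral_iff)
  finally have "(LINT x|lborel. bump e (x - y) * L u x \<omega>) \<le> K" .
  moreover have "0 \<le> (LINT x|lborel. bump e (x - y) * L u x \<omega>)"
    by (rule Bochner_Integration.integral_nonneg) (simp add: bump_nonneg nn)
  ultimately show ?thesis
    unfolding occupation_bump[OF \<omega> u] by simp
qed

lemma set_integrable_bump_path:
  assumes "\<omega> \<in> space M" "0 \<le> a" "0 < e"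
  shows "set_integrable lborel {a..b} (\<lambda>s. bump e (B s \<omega> - y))"
  using assms by (intro borel_integrable_atLeastAtMost' continuous_intros continuous_on_subset[OF continuous_paths]) auto

text \<open>Local time is the limit of occupation integrals of nonnegative kernels, which grow with
  the time interval.\<close>

lemma L_mono:
  assumes \<omega>: "regular \<omega>" and uv: "0 \<le> u" "u \<le> v"
  shows "L u y \<omega> \<le> L v y \<omega>"
proof (rule LIMSEQ_le)
  show "(\<lambda>m. LINT s:{0..u}|lborel. bump (1 / real (Suc m)) (B s \<omega> - y)) \<longlonglongrightarrow> L u y \<omega>"
    "(\<lambda>m. LINT s:{0..v}|lborel. bump (1 / real (Suc m)) (B s \<omega> - y)) \<longlonglongrightarrow> L v y \<omega>"
    by (rule occupation_bump_tendsto[OF \<omega>]; use uv in simp)+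
  have "(LINT s:{0..u}|lborel. bump (1 / real (Suc m)) (B s \<omega> - y))
      \<le> (LINT s:{0..v}|lborel. bump (1 / real (Suc m)) (B s \<omega> - y))" for m
    unfolding set_lebesgue_integral_def
    using set_integrable_bump_path[OF regular_space[OF \<omega>], of 0 "1 / real (Suc m)" _ y] uv
    by (intro integral_mono) (auto simp: set_integrable_def indicator_def bump_nonneg)
  then show "\<exists>N. \<forall>m\<ge>N. (LINT s:{0..u}|lborel. bump (1 / real (Suc m)) (B s \<omega> - y))
      \<le> (LINT s:{0..v}|lborel. bump (1 / real (Suc m)) (B s \<omega> - y))" by blast
qed

lemma L_0:
  assumes \<omega>: "regular \<omega>"
  shows "L 0 y \<omega> = 0"
proof -
  have "(LINT s:{0..0}|lborel. bump (1 / real (Suc m)) (B s \<omega> - y)) = 0" for m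
    unfolding set_lebesgue_integral_def
    by (rule integral_eq_zero_AE, rule AE_mp[OF AE_lborel_singleton[of 0]]) (auto simp: indicator_def)
  then show ?thesis
    using occupation_bump_tendsto[OF \<omega>, of 0 y] by (simp add: LIMSEQ_const_iff)
qed

text \<open>On the compact interval the path keeps a distance \<open>d > 0\<close> from
  \<open>y\<close>. At that distance the kernel is at most \<open>e\<^sup>2 / (2 * d ^ 3)\<close>,
  so no occupation survives the limit.\<close>

lemma L_eq_if_not_hit:
  assumes \<omega>: "regular \<omega>" and uv: "0 \<le> u" "u \<le> v" and ne: "\<And>s. u \<le> s \<Longrightarrow> s \<le> v \<Longrightarrow> B s \<omega> \<noteq> y"
  shows "L u y \<omega> = L v y \<omega>"
proof -
  have cont: "continuous_on {u..v} (\<lambda>s. B s \<omega> - y)"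
    using uv by (intro continuous_intros continuous_on_subset[OF continuous_paths[OF regular_space[OF \<omega>]]]) auto
  have "\<exists>s\<in>{u..v}. \<forall>r\<in>{u..v}. \<bar>B s \<omega> - y\<bar> \<le> \<bar>B r \<omega> - y\<bar>"
    using uv by (intro continuous_attains_inf continuous_on_rabs cont) auto
  then obtain d where d: "0 < d" "\<And>r. r \<in> {u..v} \<Longrightarrow> d \<le> \<bar>B r \<omega> - y\<bar>"
    using ne by (metis atLeastAtMost_iff right_minus_eq zero_less_abs_iff)
  define e where "e m = 1 / real (Suc m)" for m
  have e: "0 < e m" for m
    by (simp add: e_def)
  have e0: "e \<longlonglongrightarrow> 0"
    unfolding e_def by (intro LIMSEQ_Suc lim_1_over_n)
  have diff: "(LINT s:{0..v}|lborel. bump (e m) (B s \<omega> - y)) - (LINT s:{0..u}|lborel. bump (e m) (B s \<omega> - y))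
      = (LINT s:{u<..v}|lborel. bump (e m) (B s \<omega> - y))" for m
  proof -
    have "{0..v} = {0..u} \<union> {u<..v}" using uv by auto
    moreover have "set_integrable lborel {u<..v} (\<lambda>s. bump (e m) (B s \<omega> - y))"
      by (rule set_integrable_subset[OF set_integrable_bump_path[OF regular_space[OF \<omega>] uv(1) e, of v m]]) auto
    ultimately show ?thesis
      using set_integrable_bump_path[OF regular_space[OF \<omega>] order_refl e, of u]
      by (subst (1) \<open>{0..v} = _\<close>, subst set_integral_Un) auto
  qed
  have small: "bump (e m) (B s \<omega> - y) \<le> (e m)\<^sup>2 / (2 * d ^ 3)" if "s \<in> {u..v}" for s m
  proof -
    have "d \<le> sqrt ((B s \<omega> - y)\<^sup>2 + (e m)\<^sup>2)"
      using sqrt_square_add_pos(2)[OF e, of "B s \<omega> - y"] d(2)[OF that] by (rule order_trans[rotated])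
    then show ?thesis
      using d(1) sqrt_square_add_pos(4)[OF e[of m], of "B s \<omega> - y"] unfolding bump_def
      by (intro divide_left_mono mult_left_mono power_mono mult_pos_pos zero_less_power) auto
  qed
  have bound: "norm ((LINT s:{0..v}|lborel. bump (e m) (B s \<omega> - y)) - (LINT s:{0..u}|lborel. bump (e m) (B s \<omega> - y)))
      \<le> (e m)\<^sup>2 / (2 * d ^ 3) * (v - u)" for m
  proof -
    have "0 \<le> (LINT s:{u<..v}|lborel. bump (e m) (B s \<omega> - y))"
        unfolding set_lebesgue_integral_def
      by (rule Bochner_Integration.integral_nonneg) (simp add: indicator_def bump_nonneg)
    moreover have "(LINT s:{u<..v}|lborel. bump (e m) (B s \<omega> - y)) \<le> (LINT s:{u<..v}|lborel. (e m)\<^sup>2 / (2 * d ^ 3))"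
    proof (rule set_integral_mono)
      show "set_integrable lborel {u<..v} (\<lambda>s. bump (e m) (B s \<omega> - y))"
        by (rule set_integrable_subset[OF set_integrable_bump_path[OF regular_space[OF \<omega>] uv(1) e, of v m]]) auto
      show "set_integrable lborel {u<..v} (\<lambda>s. (e m)\<^sup>2 / (2 * d ^ 3))"
        unfolding set_integrable_def real_scaleR_def by (rule integrable_mult_left[OF integrable_real_indicator]) (use uv in auto)
    qed (use small in auto)
    moreover have "(LINT s:{u<..v}|lborel. (e m)\<^sup>2 / (2 * d ^ 3)) = (e m)\<^sup>2 / (2 * d ^ 3) * (v - u)"
      using uv by (simp add: set_lebesgue_integral_def measure_def)
    ultimately show ?thesis
      unfolding diff real_norm_def by (metis abs_of_nonneg)
  qed
  have "(\<lambda>m. (e m)\<^sup>2 / (2 * d ^ 3) * (v - u)) \<longlonglongrightarrow> 0\<^sup>2 / (2 * d ^ 3) * (v - u)"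
    using d by (intro tendsto_intros e0) auto
  then have "(\<lambda>m. (e m)\<^sup>2 / (2 * d ^ 3) * (v - u)) \<longlonglongrightarrow> 0" by simp
  then have "(\<lambda>m. (LINT s:{0..v}|lborel. bump (e m) (B s \<omega> - y)) - (LINT s:{0..u}|lborel. bump (e m) (B s \<omega> - y))) \<longlonglongrightarrow> 0"
    by (rule Lim_null_comparison[rotated]) (use bound in auto)
  moreover have "(\<lambda>m. (LINT s:{0..v}|lborel. bump (e m) (B s \<omega> - y)) - (LINT s:{0..u}|lborel. bump (e m) (B s \<omega> - y)))
      \<longlonglongrightarrow> L v y \<omega> - L u y \<omega>"
    unfolding e_def using uv by (intro tendsto_diff occupation_bump_tendsto[OF \<omega>]) auto
  ultimately have "0 = L v y \<omega> - L u y \<omega>"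
    by (rule LIMSEQ_unique)
  then show ?thesis by simp
qed

text \<open>Each smoothed occupation integral is a limit of Riemann sums in the path up to
  \<open>u\<close>; local time is their limit on the regular event only, and here the null sets in
  \<open>filt\<close> are used.\<close>

lemma L_measurable_filt:
  assumes u: "0 \<le> u"
  shows "L u y \<in> borel_measurable (filt u)"
proof (cases "u = 0")
  case True
  have "AE \<omega> in M. 0 = L u y \<omega>"
    using AE_regular by eventually_elim (simp add: True L_0)
  then show ?thesis
    by (rule measurable_filt_AE_cong[OF _ random_variable_L[OF u], rotated]) simp
next
  case False
  with u have u': "0 < u" by simp
  define F where "F m \<omega> = (LINT s:{0..u}|lborel. bump (1 / real (Suc m)) (B s \<omega> - y))" for m \<omega>
  have F [measurable]: "F m \<in> borel_measurable (filt u)" for m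
  proof (rule borel_measurable_LIMSEQ_real)
    define S where "S N \<omega> = u / real (Suc N) * (\<Sum>k<Suc N. of_bool (real k * u / real (Suc N) \<le> u) *
      bump (1 / real (Suc m)) (B (real k * u / real (Suc N)) \<omega> - y))" for N \<omega>
    show "(\<lambda>N. S N \<omega>) \<longlonglongrightarrow> F m \<omega>" if "\<omega> \<in> space (filt u)" for \<omega>
      unfolding S_def F_def using u' that
      by (intro riemann_sum_tendsto continuous_intros continuous_on_subset[OF continuous_paths]) auto
    show "S N \<in> borel_measurable (filt u)" for N
    proof -
      have "B (real k * u / real (Suc N)) \<in> borel_measurable (filt u)" if "k < Suc N" for k
      proof (rule B_measurable_filt)
        have "real k * u \<le> real (Suc N) * u"
          using that u by (intro mult_right_mono) auto
        then show "real k * u / real (Suc N) \<le> u"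
          by (simp add: pos_divide_le_eq mult.commute)
      qed (use u in auto)
      then show ?thesis
        unfolding S_def by (intro borel_measurable_times borel_measurable_const borel_measurable_sum
          measurable_compose[OF _ borel_measurable_bump] borel_measurable_diff) auto
    qed
  qed
  have eq: "AE \<omega> in M. lim (\<lambda>m. F m \<omega>) = L u y \<omega>"
    using AE_regular by eventually_elim (unfold F_def, rule limI, rule occupation_bump_tendsto[OF _ u])
  have "(\<lambda>\<omega>. lim (\<lambda>m. F m \<omega>)) \<in> borel_measurable (filt u)"
    by measurable
  then show ?thesis
    using random_variable_L[OF u] eq by (rule measurable_filt_AE_cong)
qed

lemma L_optional_measurable: "optional_time T \<tau> \<Longrightarrow> (\<lambda>\<omega>. L (\<tau> \<omega>) y \<omega>) \<in> borel_measurable M"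
  by (rule random_time_measurable[OF random_variable_L L_continuous_time]) (auto simp: optional_time_def)

text \<open>Two ramps with opposite signs keep the test function bounded, as Dynkin's formula
  demands. The bound \<open>K\<close> on local time dominates the right-hand side as the smoothing
  vanishes.\<close>

lemma tanaka_difference:
  assumes T: "0 < T" and \<tau>: "optional_time T \<tau>"
    and bd: "AE \<omega> in M. \<forall>x. L (\<tau> \<omega>) x \<omega> \<le> K"
  shows "expectation (\<lambda>\<omega>. max 0 (B (\<tau> \<omega>) \<omega> - a) - max 0 (B (\<tau> \<omega>) \<omega> - c)) - (max 0 (x\<^sub>0 - a) - max 0 (x\<^sub>0 - c))
    = expectation (\<lambda>\<omega>. L (\<tau> \<omega>) a \<omega> - L (\<tau> \<omega>) c \<omega>) / 2"
proof -
  define e where "e m = 1 / real (Suc m)" for m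
  have e: "0 < e m" for m
    by (simp add: e_def)
  have e0: "e \<longlonglongrightarrow> 0"
    unfolding e_def by (intro LIMSEQ_Suc lim_1_over_n)
  have \<tau>0: "\<omega> \<in> space M \<Longrightarrow> 0 \<le> \<tau> \<omega>" for \<omega>
    using \<tau> by (simp add: optional_time_def)
  note [measurable] = B_optional_measurable[OF \<tau>] L_optional_measurable[OF \<tau>]
  define g where "g m x = smooth_ramp (e m) (x - a) - smooth_ramp (e m) (x - c)" for m x
  define g1 where "g1 m x = (1 + (x - a) / sqrt ((x - a)\<^sup>2 + (e m)\<^sup>2)) / 2 - (1 + (x - c) / sqrt ((x - c)\<^sup>2 + (e m)\<^sup>2)) / 2" for m x
  define g2 where "g2 m x = bump (e m) (x - a) - bump (e m) (x - c)" for m x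
  define g3 where "g3 m x = - 3 * (e m)\<^sup>2 * (x - a) / (2 * sqrt ((x - a)\<^sup>2 + (e m)\<^sup>2) ^ 5)
    - (- 3 * (e m)\<^sup>2 * (x - c) / (2 * sqrt ((x - c)\<^sup>2 + (e m)\<^sup>2) ^ 5))" for m x
  have shift: "((\<lambda>x. f (x - b)) has_real_derivative f' (x - b)) (at x)"
    if "\<And>x. (f has_real_derivative f' x) (at x)" for f f' b x
    using that[of "x - b"] DERIV_shift[of f "f' (x - b)" x "- b"] by simp
  have d: "(g m has_real_derivative g1 m x) (at x)" "(g1 m has_real_derivative g2 m x) (at x)"
    "(g2 m has_real_derivative g3 m x) (at x)" for m x
    unfolding g_def[abs_def] g1_def[abs_def] g2_def[abs_def] g3_def
    by (intro DERIV_diff shift[OF smooth_ramp_deriv[OF e]] shift[OF smooth_ramp_deriv2[OF e]] shift[OF bump_deriv[OF e]])+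
  have b0: "\<bar>g m x\<bar> \<le> \<bar>a - c\<bar>" for m x
  proof (cases "a \<le> c")
    case True
    then show ?thesis
      using smooth_ramp_lipschitz[OF e[of m], of "x - c" "x - a"] unfolding g_def by linarith
  next
    case False
    then show ?thesis
      using smooth_ramp_lipschitz[OF e[of m], of "x - a" "x - c"] unfolding g_def by linarith
  qed
  have b1: "\<bar>g1 m x\<bar> \<le> 1" for m x
  proof -
    have "\<bar>z / sqrt (z\<^sup>2 + (e m)\<^sup>2)\<bar> \<le> 1" for z
      using sqrt_square_add_pos(2,4)[OF e[of m], of z] by simp
    note q = this
    have "\<bar>(1 + p) / 2 - (1 + q) / 2\<bar> \<le> 1" if "\<bar>p\<bar> \<le> 1" "\<bar>q\<bar> \<le> 1" for p q :: real
      using that by (auto simp: abs_le_iff field_simps)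
    from this[OF q q] show ?thesis
      unfolding g1_def .
  qed
  have b2: "\<bar>g2 m x\<bar> \<le> 1 / (2 * e m)" for m x
    unfolding g2_def
    using bump_le[OF e[of m], of "x - a"] bump_le[OF e[of m], of "x - c"] bump_nonneg[of "e m" "x - a"] bump_nonneg[of "e m" "x - c"]
    by linarith
  have b3: "\<bar>g3 m x\<bar> \<le> 3 / (2 * (e m)\<^sup>2) + 3 / (2 * (e m)\<^sup>2)" for m x
    unfolding g3_def by (intro order_trans[OF abs_triangle_ineq4] add_mono bump_deriv_le e)
  \<comment> \<open>Dynkin's formula asks for one constant bounding the function and three
    derivatives, so their bounds are added. Its growth in \<open>m\<close> has no effect, because
    the formula itself is free of \<open>C\<close>.\<close>
  define C where "C m = \<bar>a - c\<bar> + 1 + 1 / (2 * e m) + (3 / (2 * (e m)\<^sup>2) + 3 / (2 * (e m)\<^sup>2))" for m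
  have Cb: "\<bar>a - c\<bar> \<le> C m" "1 \<le> C m" "1 / (2 * e m) \<le> C m" "3 / (2 * (e m)\<^sup>2) + 3 / (2 * (e m)\<^sup>2) \<le> C m" for m
    using e[of m] by (auto simp: C_def)
  note dyn = dynkin_formula[OF d order_trans[OF b0 Cb(1)] order_trans[OF b1 Cb(2)] order_trans[OF b2 Cb(3)] order_trans[OF b3 Cb(4)] T \<tau>]
  have g_lim: "(\<lambda>m. g m x) \<longlonglongrightarrow> max 0 (x - a) - max 0 (x - c)" for x
    unfolding g_def by (intro tendsto_diff smooth_ramp_tendsto e0)
  have [measurable]: "g m \<in> borel_measurable borel" for m
    unfolding g_def[abs_def] smooth_ramp_def by measurable
  have lhs: "(\<lambda>m. expectation (\<lambda>\<omega>. g m (B (\<tau> \<omega>) \<omega>)) - g m x\<^sub>0) \<longlonglongrightarrow>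
    expectation (\<lambda>\<omega>. max 0 (B (\<tau> \<omega>) \<omega> - a) - max 0 (B (\<tau> \<omega>) \<omega> - c)) - (max 0 (x\<^sub>0 - a) - max 0 (x\<^sub>0 - c))"
  proof (intro tendsto_diff[OF _ g_lim])
    show "(\<lambda>m. expectation (\<lambda>\<omega>. g m (B (\<tau> \<omega>) \<omega>))) \<longlonglongrightarrow> expectation (\<lambda>\<omega>. max 0 (B (\<tau> \<omega>) \<omega> - a) - max 0 (B (\<tau> \<omega>) \<omega> - c))"
      by (rule integral_dominated_convergence[where w = "\<lambda>_. \<bar>a - c\<bar>"]) (use g_lim b0 in auto)
  qed
  have split: "(LINT s:{0..\<tau> \<omega>}|lborel. g2 m (B s \<omega>)) = (LINT s:{0..\<tau> \<omega>}|lborel. bump (e m) (B s \<omega> - a))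
      - (LINT s:{0..\<tau> \<omega>}|lborel. bump (e m) (B s \<omega> - c))" if "regular \<omega>" for \<omega> m
    unfolding g2_def
    by (intro set_integral_diff set_integrable_bump_path[OF regular_space[OF that] order_refl e])
  have rhs: "(\<lambda>m. expectation (\<lambda>\<omega>. LINT s:{0..\<tau> \<omega>}|lborel. g2 m (B s \<omega>)) / 2) \<longlonglongrightarrow>
    expectation (\<lambda>\<omega>. L (\<tau> \<omega>) a \<omega> - L (\<tau> \<omega>) c \<omega>) / 2"
  proof (intro tendsto_divide tendsto_const integral_dominated_convergence[where w = "\<lambda>_. 2 * K"])
    show "(\<lambda>\<omega>. LINT s:{0..\<tau> \<omega>}|lborel. g2 m (B s \<omega>)) \<in> borel_measurable M" for m
      by (rule dyn(2))
    show "AE \<omega> in M. (\<lambda>m. LINT s:{0..\<tau> \<omega>}|lborel. g2 m (B s \<omega>)) \<longlonglongrightarrow> L (\<tau> \<omega>) a \<omega> - L (\<tau> \<omega>) c \<omega>"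
      using AE_regular
    proof eventually_elim
      case (elim \<omega>)
      show ?case
        unfolding split[OF elim] unfolding e_def
        by (intro tendsto_diff occupation_bump_tendsto elim \<tau>0 regular_space)
    qed
    show "AE \<omega> in M. norm (LINT s:{0..\<tau> \<omega>}|lborel. g2 m (B s \<omega>)) \<le> 2 * K" for m
      using AE_regular bd
    proof eventually_elim
      case (elim \<omega>)
      then have "\<bar>LINT s:{0..\<tau> \<omega>}|lborel. bump (e m) (B s \<omega> - y)\<bar> \<le> K" for y
        by (intro occupation_bump_le \<tau>0 regular_space e) auto
      from this[of a] this[of c] show ?case
        unfolding split[OF elim(1)] by simp
    qed
  qed auto
  show ?thesis
    using LIMSEQ_unique[OF lhs rhs[folded dyn(1)]] .
qed

text \<open>If the path stays in \<open>[-K,K]\<close>, the ramp and the local time at level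
  \<open>K + 1\<close> both vanish, which removes the auxiliary level of
  \<open>tanaka_difference\<close>.\<close>

lemma
  assumes T: "0 < T" and \<tau>: "optional_time T \<tau>"
    and bd: "AE \<omega> in M. (\<forall>s. 0 \<le> s \<longrightarrow> s \<le> \<tau> \<omega> \<longrightarrow> \<bar>B s \<omega>\<bar> \<le> K) \<and> (\<forall>x. L (\<tau> \<omega>) x \<omega> \<le> K)"
  shows integrable_L_optional: "integrable M (\<lambda>\<omega>. L (\<tau> \<omega>) a \<omega>)"
    and integrable_B_optional: "integrable M (\<lambda>\<omega>. B (\<tau> \<omega>) \<omega>)"
    and tanaka: "expectation (\<lambda>\<omega>. max 0 (B (\<tau> \<omega>) \<omega> - a)) = max 0 (x\<^sub>0 - a) + expectation (\<lambda>\<omega>. L (\<tau> \<omega>) a \<omega>) / 2"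
    and expectation_B_optional: "expectation (\<lambda>\<omega>. B (\<tau> \<omega>) \<omega>) = x\<^sub>0"
proof -
  note [measurable] = B_optional_measurable[OF \<tau>] L_optional_measurable[OF \<tau>]
  have \<tau>0: "\<omega> \<in> space M \<Longrightarrow> 0 \<le> \<tau> \<omega>" for \<omega>
    using \<tau> by (simp add: optional_time_def)
  have bdL: "AE \<omega> in M. \<forall>x. L (\<tau> \<omega>) x \<omega> \<le> K"
    using bd by eventually_elim auto
  have bdB: "AE \<omega> in M. \<bar>B (\<tau> \<omega>) \<omega>\<bar> \<le> K \<and> \<bar>x\<^sub>0\<bar> \<le> K"
    using bd AE_regular by eventually_elim (metis \<tau>0 regular_space regular_start order_refl)
  \<comment> \<open>An almost sure statement about the constant \<open>x\<^sub>0\<close> holds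
    outright, because the space has probability 1.\<close>
  then have x0: "\<bar>x\<^sub>0\<bar> \<le> K"
    using eventually_happens[of _ "ae_filter M"] ae_filter_eq_bot_iff[of M] emeasure_space_1 by fastforce
  show "integrable M (\<lambda>\<omega>. L (\<tau> \<omega>) a \<omega>)" for a
    by (rule integrable_const_bound[of _ K]) (use bdL AE_space L_nonneg \<tau>0 in \<open>auto elim!: eventually_elim2\<close>)
  show iB: "integrable M (\<lambda>\<omega>. B (\<tau> \<omega>) \<omega>)"
    by (rule integrable_const_bound[of _ K]) (use bdB in \<open>auto elim!: eventually_mono\<close>)
  have L0: "AE \<omega> in M. L (\<tau> \<omega>) c \<omega> = 0" if "K < \<bar>c\<bar>" for c
    using AE_regular bd
  proof eventually_elim
    case (elim \<omega>)
    then show ?case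
      using that by (intro L_eq_0_outside_range[of \<omega> "\<tau> \<omega>" K] \<tau>0 regular_space) auto
  qed
  have *: "expectation (\<lambda>\<omega>. max 0 (B (\<tau> \<omega>) \<omega> - a)) = max 0 (x\<^sub>0 - a) + expectation (\<lambda>\<omega>. L (\<tau> \<omega>) a \<omega>) / 2" for a
  proof -
    have "expectation (\<lambda>\<omega>. max 0 (B (\<tau> \<omega>) \<omega> - a) - max 0 (B (\<tau> \<omega>) \<omega> - (K + 1))) = expectation (\<lambda>\<omega>. max 0 (B (\<tau> \<omega>) \<omega> - a))"
      by (rule integral_cong_AE) (use bdB in \<open>auto elim!: eventually_mono\<close>)
    moreover have "expectation (\<lambda>\<omega>. L (\<tau> \<omega>) a \<omega> - L (\<tau> \<omega>) (K + 1) \<omega>) = expectation (\<lambda>\<omega>. L (\<tau> \<omega>) a \<omega>)"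
      by (rule integral_cong_AE) (use L0[of "K + 1"] x0 in \<open>auto elim!: eventually_mono\<close>)
    moreover have "max 0 (x\<^sub>0 - (K + 1)) = 0"
      using x0 by auto
    ultimately show ?thesis
      using tanaka_difference[OF T \<tau> bdL, of a "K + 1"] by simp
  qed
  show "expectation (\<lambda>\<omega>. max 0 (B (\<tau> \<omega>) \<omega> - a)) = max 0 (x\<^sub>0 - a) + expectation (\<lambda>\<omega>. L (\<tau> \<omega>) a \<omega>) / 2" for a
    by (rule *)
  \<comment> \<open>At the level \<open>- K - 1\<close>, below the whole path, the ramp is linear
    and there is no local time; Tanaka's formula becomes the statement about the mean.\<close>
  have "expectation (\<lambda>\<omega>. max 0 (B (\<tau> \<omega>) \<omega> - (- K - 1))) = expectation (\<lambda>\<omega>. B (\<tau> \<omega>) \<omega> - (- K - 1))"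
    by (rule integral_cong_AE) (use bdB in \<open>auto elim!: eventually_mono\<close>)
  also have "\<dots> = expectation (\<lambda>\<omega>. B (\<tau> \<omega>) \<omega>) - (- K - 1)"
    using iB by (simp add: prob_space)
  moreover have "expectation (\<lambda>\<omega>. L (\<tau> \<omega>) (- K - 1) \<omega>) = expectation (\<lambda>\<omega>. 0)"
    by (rule integral_cong_AE) (use L0[of "- K - 1"] x0 in auto)
  moreover have "max 0 (x\<^sub>0 - (- K - 1)) = x\<^sub>0 - (- K - 1)"
    using x0 by auto
  ultimately show "expectation (\<lambda>\<omega>. B (\<tau> \<omega>) \<omega>) = x\<^sub>0"
    using *[of "- K - 1"] by simp
qed

end

section \<open>First passage times and the clock\<close>

text \<open>As the image of a weighted counting measure, the atomic measure turns integrals into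
  finite sums, infinite and repeated atoms included.\<close>

lemma atomic_measure_eq_distr:
  "atomic_measure n y b = distr (density (count_space {0..n+1}) b) borel y"
proof (rule measure_eqI)
  fix A assume "A \<in> sets (atomic_measure n y b)"
  then have A: "A \<in> sets borel" by simp
  have y: "y \<in> measurable (density (count_space {0..n+1}) b) borel"
    by simp
  have "emeasure (distr (density (count_space {0..n+1}) b) borel y) A
      = (\<integral>\<^sup>+i. b i * indicator (y -` A \<inter> {0..n+1}) i \<partial>count_space {0..n+1})"
    using A by (subst emeasure_distr[OF y]) (simp_all add: emeasure_density)
  also have "\<dots> = (\<Sum>i = 0..n+1. b i * indicator (y -` A \<inter> {0..n+1}) i)"
    by (rule nn_integral_count_space_finite) simp
  also have "\<dots> = (\<Sum>i = 0..n+1. b i * indicator A (y i))"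
    by (intro sum.cong) (auto simp: indicator_def)
  finally show "emeasure (atomic_measure n y b) A = emeasure (distr (density (count_space {0..n+1}) b) borel y) A"
    using A by (simp only: emeasure_atomic_measure)
qed simp

lemma nn_integral_atomic_measure:
  assumes "f \<in> borel_measurable borel"
  shows "(\<integral>\<^sup>+x. f x \<partial>atomic_measure n y b) = (\<Sum>i = 0..n+1. b i * f (y i))"
  unfolding atomic_measure_eq_distr using assms
  by (subst nn_integral_distr) (simp_all add: nn_integral_density nn_integral_count_space_finite)

text \<open>The first entrance time capped at \<open>T\<close>: inserting \<open>T\<close> makes the
  infimum one of a nonempty set and the time bounded.\<close>

definition debut :: "real \<Rightarrow> (real \<Rightarrow> 'a \<Rightarrow> bool) \<Rightarrow> 'a \<Rightarrow> real" where
  "debut T P \<omega> = Inf (insert T {u. 0 \<le> u \<and> u \<le> T \<and> P u \<omega>})"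

lemma debut_le_T: "0 \<le> T \<Longrightarrow> debut T P \<omega> \<le> T"
  unfolding debut_def by (intro cInf_lower bdd_belowI[of _ 0]) auto

lemma debut_nonneg: "0 \<le> T \<Longrightarrow> 0 \<le> debut T P \<omega>"
  unfolding debut_def by (intro cInf_greatest) auto

lemma debut_le: "0 \<le> u \<Longrightarrow> u \<le> T \<Longrightarrow> P u \<omega> \<Longrightarrow> debut T P \<omega> \<le> u"
  unfolding debut_def by (intro cInf_lower bdd_belowI[of _ 0]) auto

lemma debut_ge: "u \<le> T \<Longrightarrow> (\<And>v. 0 \<le> v \<Longrightarrow> v \<le> T \<Longrightarrow> P v \<omega> \<Longrightarrow> u \<le> v) \<Longrightarrow> u \<le> debut T P \<omega>"
  unfolding debut_def by (intro cInf_greatest) auto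

lemma not_before_debut: "0 \<le> u \<Longrightarrow> 0 \<le> T \<Longrightarrow> u < debut T P \<omega> \<Longrightarrow> \<not> P u \<omega>"
  using debut_le[of u T P \<omega>] debut_le_T[of T P \<omega>] by fastforce

lemma debut_approx:
  assumes "0 \<le> T" "debut T P \<omega> < w" "w \<le> T"
  obtains v where "debut T P \<omega> \<le> v" "v < w" "0 \<le> v" "P v \<omega>"
proof -
  have "\<exists>v\<in>insert T {u. 0 \<le> u \<and> u \<le> T \<and> P u \<omega>}. v < w"
    using assms(2) unfolding debut_def by (rule cInf_lessD[rotated]) simp
  then obtain v where v: "v < w" "0 \<le> v" "v \<le> T" "P v \<omega>"
    using assms by auto
  then show thesis
    using debut_le[of v T P \<omega>] by (intro that) auto
qed

lemma debut_antimono: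
  assumes "0 \<le> T" "\<And>u. 0 \<le> u \<Longrightarrow> P u \<omega> \<Longrightarrow> Q u \<omega>"
  shows "debut T Q \<omega> \<le> debut T P \<omega>"
proof (rule debut_ge)
  show "debut T Q \<omega> \<le> T"
    using assms(1) by (rule debut_le_T)
  fix v assume "0 \<le> v" "v \<le> T" "P v \<omega>"
  then show "debut T Q \<omega> \<le> v"
    using assms(2) by (intro debut_le) auto
qed

text \<open>A condition open in time that holds at \<open>u\<close> holds at some rational time just
  after, which reduces unions over all times to countable ones.\<close>

lemma eventually_at_within_right:
  fixes u w :: real
  assumes ev: "\<forall>\<^sub>F v in at u within {0..}. P v" and u: "0 \<le> u" "u < w"
  obtains q where "q \<in> \<rat>" "u < q" "q < w" "P q"
proof -
  obtain d where d: "0 < d" "\<And>v. v \<in> {0..} \<Longrightarrow> v \<noteq> u \<Longrightarrow> dist v u < d \<Longrightarrow> P v"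
    using ev unfolding eventually_at by blast
  obtain q where q: "q \<in> \<rat>" "u < q" "q < min w (u + d)"
    using Rats_dense_in_real[of u "min w (u + d)"] u d(1) by auto
  then have "P q"
    using u by (intro d(2)) (auto simp: dist_real_def)
  then show thesis
    using q by (intro that) auto
qed

lemma eventually_at_within_left:
  fixes u w :: real
  assumes ev: "\<forall>\<^sub>F v in at u within {0..}. P v" and u: "0 \<le> w" "w < u"
  obtains q where "w < q" "q < u" "P q"
proof -
  obtain d where d: "0 < d" "\<And>v. v \<in> {0..} \<Longrightarrow> v \<noteq> u \<Longrightarrow> dist v u < d \<Longrightarrow> P v"
    using ev unfolding eventually_at by blast
  obtain q where q: "max w (u - d) < q" "q < u"
    using dense[of "max w (u - d)" u] u d(1) by auto
  then have "P q"
    using u by (intro d(2)) (auto simp: dist_real_def)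
  then show thesis
    using q by (intro that) auto
qed

text \<open>If the condition held at the entrance time itself, openness would make it hold slightly
  earlier. Time 0 has no earlier times and is excluded by hypothesis.\<close>

lemma not_until_debut:
  assumes op: "\<And>u. 0 \<le> u \<Longrightarrow> P u \<omega> \<Longrightarrow> \<forall>\<^sub>F v in at u within {0..}. P v \<omega>"
    and 0: "\<not> P 0 \<omega>" and u: "0 \<le> u" "u \<le> debut T P \<omega>" and T: "0 \<le> T"
  shows "\<not> P u \<omega>"
proof
  assume P: "P u \<omega>"
  then have "u \<noteq> 0" using 0 by auto
  then have "0 < u" using u by simp
  from eventually_at_within_left[OF op[OF u(1) P] order_refl this]
  obtain q where "0 < q" "q < u" "P q \<omega>" .
  then show False
    using u not_before_debut[of q T P \<omega>] T by auto
qed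

context brownian_motion
begin

definition adapted_open :: "(real \<Rightarrow> 'a \<Rightarrow> bool) \<Rightarrow> bool" where
  "adapted_open P \<longleftrightarrow> (\<forall>u\<ge>0. {\<omega> \<in> space M. P u \<omega>} \<in> sets (filt u)) \<and>
    (\<forall>\<omega>\<in>space M. \<forall>u\<ge>0. P u \<omega> \<longrightarrow> (\<forall>\<^sub>F v in at u within {0..}. P v \<omega>))"

lemma adapted_open_disj: "adapted_open P \<Longrightarrow> adapted_open Q \<Longrightarrow> adapted_open (\<lambda>u \<omega>. P u \<omega> \<or> Q u \<omega>)"
proof -
  assume P: "adapted_open P" and Q: "adapted_open Q"
  have "{\<omega> \<in> space M. P u \<omega> \<or> Q u \<omega>} \<in> sets (filt u)" if "0 \<le> u" for u
  proof -
    have "{\<omega> \<in> space M. P u \<omega> \<or> Q u \<omega>} = {\<omega> \<in> space M. P u \<omega>} \<union> {\<omega> \<in> space M. Q u \<omega>}"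
      by auto
    then show ?thesis
      using P Q that by (auto simp: adapted_open_def)
  qed
  moreover have "\<forall>\<^sub>F v in at u within {0..}. P v \<omega> \<or> Q v \<omega>"
    if "\<omega> \<in> space M" "0 \<le> u" "P u \<omega> \<or> Q u \<omega>" for u \<omega>
    using that P Q unfolding adapted_open_def by (metis (mono_tags, lifting) eventually_mono)
  ultimately show ?thesis
    by (simp add: adapted_open_def)
qed

text \<open>By openness \<open>u \<le> debut T P \<omega>\<close> means that \<open>P\<close> fails
  at every rational time strictly before \<open>u\<close>. Only the past of \<open>u\<close> enters,
  so \<open>filt\<close> suffices although it is not made right-continuous.\<close>

lemma optional_time_debut:
  assumes P: "adapted_open P" and T: "0 \<le> T"
  shows "optional_time T (debut T P)"
proof -
  have eq: "{\<omega> \<in> space M. u \<le> debut T P \<omega>} = space (filt u) - (\<Union>q\<in>{q\<in>\<rat>. 0 \<le> q \<and> q < u}. {\<omega> \<in> space M. P q \<omega>})"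
    if u: "0 \<le> u" "u \<le> T" for u
  proof (intro set_eqI iffI)
    fix \<omega> assume "\<omega> \<in> {\<omega> \<in> space M. u \<le> debut T P \<omega>}"
    then show "\<omega> \<in> space (filt u) - (\<Union>q\<in>{q\<in>\<rat>. 0 \<le> q \<and> q < u}. {\<omega> \<in> space M. P q \<omega>})"
      using not_before_debut[of _ T P \<omega>] T by auto
  next
    fix \<omega> assume *: "\<omega> \<in> space (filt u) - (\<Union>q\<in>{q\<in>\<rat>. 0 \<le> q \<and> q < u}. {\<omega> \<in> space M. P q \<omega>})"
    have "u \<le> debut T P \<omega>"
    proof (rule debut_ge[OF u(2)], rule ccontr)
      fix v assume v: "0 \<le> v" "P v \<omega>" "\<not> u \<le> v"
      have "\<forall>\<^sub>F v in at v within {0..}. P v \<omega>"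
        using P v * by (auto simp: adapted_open_def)
      from eventually_at_within_right[OF this v(1), of u] obtain q where "q \<in> \<rat>" "v < q" "q < u" "P q \<omega>"
        using v by auto
      then show False
        using * v by auto
    qed
    with * show "\<omega> \<in> {\<omega> \<in> space M. u \<le> debut T P \<omega>}" by auto
  qed
  have filt: "{\<omega> \<in> space M. u \<le> debut T P \<omega>} \<in> sets (filt u)" if u: "0 \<le> u" "u \<le> T" for u
  proof -
    have "{\<omega> \<in> space M. P q \<omega>} \<in> sets (filt u)" if "0 \<le> q" "q < u" for q
      using P that sets_filt_mono[of q u] by (auto simp: adapted_open_def)
    moreover have "countable {q\<in>\<rat>. 0 \<le> q \<and> q < u}"
      by (rule countable_subset[OF _ countable_rat]) auto
    ultimately show ?thesis
      unfolding eq[OF u] by (intro sets.compl_sets sets.countable_UN') auto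
  qed
  moreover have "debut T P \<in> borel_measurable M"
  proof (rule borel_measurable_iff_ge[THEN iffD2], rule allI)
    fix a
    consider "a \<le> 0" | "0 \<le> a" "a \<le> T" | "T < a" by linarith
    then show "{\<omega> \<in> space M. a \<le> debut T P \<omega>} \<in> sets M"
    proof cases
      case 1
      then have "{\<omega> \<in> space M. a \<le> debut T P \<omega>} = space M"
        using debut_nonneg[OF T, of P] by (auto intro: order_trans)
      then show ?thesis by simp
    next
      case 2
      then show ?thesis
        using filt sets_filtD by blast
    next
      case 3
      then have "\<not> a \<le> debut T P \<omega>" for \<omega>
        using debut_le_T[OF T, of P \<omega>] by linarith
      then have "{\<omega> \<in> space M. a \<le> debut T P \<omega>} = {}"
        by auto
      then show ?thesis
        by (simp only: sets.empty_sets)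
    qed
  qed
  ultimately show ?thesis
    using debut_nonneg[OF T, of P] debut_le_T[OF T, of P] by (simp add: optional_time_def)
qed

end

section \<open>Localisation, the clock and one-sidedness\<close>

context brownian_local_time
begin

text \<open>Strict inequalities make this an open condition in time. Stopping at its debut yields
  exactly the bounds under which Tanaka's formula was proved, uniformly over all levels
  \<open>x\<close>.\<close>

definition unbounded_by :: "real \<Rightarrow> real \<Rightarrow> 'a \<Rightarrow> bool" where
  "unbounded_by K u \<omega> \<longleftrightarrow> K < \<bar>B u \<omega>\<bar> \<or> (\<exists>x. K < L u x \<omega>)"

lemma eventually_at_path:
  assumes c: "continuous_on {0..} f" and u: "0 \<le> u" "f u \<in> S" and S: "open S"
  shows "\<forall>\<^sub>F v in at u within {0..}. f (v :: real) \<in> S"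
proof -
  have "(f \<longlongrightarrow> f u) (at u within {0..})"
    using c u by (auto simp: continuous_on_def)
  then show ?thesis
    using S u(2) by (rule topological_tendstoD)
qed

lemma adapted_open_unbounded_by: "adapted_open (unbounded_by K)"
  unfolding adapted_open_def
proof (intro conjI allI impI ballI)
  fix u :: real assume u: "0 \<le> u"
  have "{\<omega> \<in> space M. unbounded_by K u \<omega>} = {\<omega> \<in> space M. K < \<bar>B u \<omega>\<bar>} \<union> (\<Union>x\<in>\<rat>. {\<omega> \<in> space M. K < L u x \<omega>})"
  proof (intro set_eqI iffI)
    fix \<omega> assume \<omega>: "\<omega> \<in> {\<omega> \<in> space M. unbounded_by K u \<omega>}"
    show "\<omega> \<in> {\<omega> \<in> space M. K < \<bar>B u \<omega>\<bar>} \<union> (\<Union>x\<in>\<rat>. {\<omega> \<in> space M. K < L u x \<omega>})"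
    proof (cases "K < \<bar>B u \<omega>\<bar>")
      case False
      with \<omega> obtain x where x: "K < L u x \<omega>" "\<omega> \<in> space M"
        by (auto simp: unbounded_by_def)
      have "open {x. K < L u x \<omega>}"
        using L_continuous_space[OF x(2) u] by (intro open_Collect_less) auto
      then obtain d where d: "0 < d" "ball x d \<subseteq> {x. K < L u x \<omega>}"
        using x(1) open_contains_ball by blast
      obtain q where "q \<in> \<rat>" "x < q" "q < x + d"
        using Rats_dense_in_real[of x "x + d"] d(1) by auto
      then have "q \<in> \<rat>" "q \<in> ball x d"
        by (auto simp: dist_real_def)
      then show ?thesis
        using d x by auto
    qed (use \<omega> in auto)
  qed (auto simp: unbounded_by_def)
  moreover have "{\<omega> \<in> space (filt u). K < \<bar>B u \<omega>\<bar>} \<in> sets (filt u)"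
    using B_measurable_filt[OF u order_refl] by measurable
  moreover have "{\<omega> \<in> space (filt u). K < L u x \<omega>} \<in> sets (filt u)" for x
    using L_measurable_filt[OF u] by measurable
  ultimately show "{\<omega> \<in> space M. unbounded_by K u \<omega>} \<in> sets (filt u)"
    using countable_rat by (auto intro!: sets.countable_UN')
next
  fix \<omega> and u :: real assume \<omega>: "\<omega> \<in> space M" and u: "0 \<le> u" and bad: "unbounded_by K u \<omega>"
  show "\<forall>\<^sub>F v in at u within {0..}. unbounded_by K v \<omega>"
  proof (cases "K < \<bar>B u \<omega>\<bar>")
    case True
    then have "\<forall>\<^sub>F v in at u within {0..}. \<bar>B v \<omega>\<bar> \<in> {K<..}"
      using u by (intro eventually_at_path continuous_on_rabs continuous_paths \<omega>) auto
    then show ?thesis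
      by eventually_elim (simp add: unbounded_by_def)
  next
    case False
    then obtain x where "K < L u x \<omega>"
      using bad by (auto simp: unbounded_by_def)
    then have "\<forall>\<^sub>F v in at u within {0..}. L v x \<omega> \<in> {K<..}"
      using u by (intro eventually_at_path L_continuous_time \<omega>) auto
    then show ?thesis
      by eventually_elim (auto simp: unbounded_by_def)
  qed
qed

lemma eventually_not_unbounded_by:
  assumes \<omega>: "regular \<omega>" and S: "0 \<le> S"
  shows "\<exists>K0. \<forall>K\<ge>K0. \<forall>s. 0 \<le> s \<longrightarrow> s \<le> S \<longrightarrow> \<not> unbounded_by K s \<omega>"
proof -
  obtain R where R: "\<And>s. 0 \<le> s \<Longrightarrow> s \<le> S \<Longrightarrow> \<bar>B s \<omega>\<bar> \<le> R"
    using B_bounded[OF regular_space[OF \<omega>], of S] by blast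
  obtain C where C: "\<And>x. L S x \<omega> \<le> C"
    using L_bounded[OF \<omega> S] by blast
  show ?thesis
  proof (intro exI[of _ "max R C"] allI impI)
    fix K s assume "max R C \<le> K" "0 \<le> s" "s \<le> S"
    then have "\<bar>B s \<omega>\<bar> \<le> K" "L s x \<omega> \<le> K" for x
      using R[of s] C[of x] L_mono[OF \<omega>, of s S x] by auto
    then show "\<not> unbounded_by K s \<omega>"
      unfolding unbounded_by_def not_less[symmetric] by auto
  qed
qed

lemma clock_atomic:
  "\<omega> \<in> space M \<Longrightarrow> 0 \<le> u \<Longrightarrow> clock L (atomic_measure n y b) u \<omega> = (\<Sum>i = 0..n+1. b i * ennreal (L u (y i) \<omega>))"
  unfolding clock_def using L_measurable_space[of \<omega> u] by (intro nn_integral_atomic_measure) measurable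

lemma clock_mono:
  "regular \<omega> \<Longrightarrow> 0 \<le> u \<Longrightarrow> u \<le> v \<Longrightarrow> clock L \<nu> u \<omega> \<le> clock L \<nu> v \<omega>"
  unfolding clock_def by (intro nn_integral_mono ennreal_leI L_mono)

lemma clock_0: "regular \<omega> \<Longrightarrow> clock L \<nu> 0 \<omega> = 0"
  by (simp add: clock_def L_0)

text \<open>By Fatou's lemma the clock is lower semicontinuous, although infinite atoms make it jump.\<close>

lemma eventually_clock_greater:
  assumes \<nu>: "sets \<nu> = sets borel" and \<omega>: "\<omega> \<in> space M" and u: "0 \<le> u" and t: "t < clock L \<nu> u \<omega>"
  shows "\<forall>\<^sub>F v in at u within {0..}. t < clock L \<nu> v \<omega>"
proof (rule sequentially_imp_eventually_within, intro allI impI)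
  fix f assume f: "(\<forall>n. f n \<in> {0..} \<and> f n \<noteq> u) \<and> f \<longlonglongrightarrow> u"
  have fn: "0 \<le> f n" for n
    using f by auto
  have lim: "(\<lambda>n. ennreal (L (f n) x \<omega>)) \<longlonglongrightarrow> ennreal (L u x \<omega>)" for x
    using f u by (intro tendsto_ennrealI continuous_on_tendsto_compose[OF L_continuous_time[OF \<omega>]]) auto
  have meas: "(\<lambda>x. ennreal (L (f n) x \<omega>)) \<in> borel_measurable \<nu>" for n
    using L_measurable_space[OF \<omega> fn[of n]] unfolding measurable_cong_sets[OF \<nu> refl] by measurable
  have "clock L \<nu> u \<omega> = (\<integral>\<^sup>+x. liminf (\<lambda>n. ennreal (L (f n) x \<omega>)) \<partial>\<nu>)"
    unfolding clock_def by (intro nn_integral_cong lim_imp_Liminf[symmetric] lim) simp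
  also have "\<dots> \<le> liminf (\<lambda>n. clock L \<nu> (f n) \<omega>)"
    unfolding clock_def by (rule nn_integral_liminf[OF meas])
  finally show "\<forall>\<^sub>F n in sequentially. t < clock L \<nu> (f n) \<omega>"
    using t by (intro less_LiminfD) (rule order_less_le_trans)
qed

lemma clock_measurable_filt:
  assumes u: "0 \<le> u"
  shows "clock L (atomic_measure n y b) u \<in> borel_measurable (filt u)"
proof -
  have "(\<lambda>\<omega>. \<Sum>i = 0..n+1. b i * ennreal (L u (y i) \<omega>)) \<in> borel_measurable (filt u)"
    using L_measurable_filt[OF u] by measurable
  then show ?thesis
    by (rule measurable_cong[THEN iffD1, rotated]) (simp add: clock_atomic u)
qed

lemma adapted_open_clock: "adapted_open (\<lambda>u \<omega>. t < clock L (atomic_measure n y b) u \<omega>)"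
  unfolding adapted_open_def
proof (intro conjI allI impI ballI)
  fix u :: real assume "0 \<le> u"
  then have "{\<omega> \<in> space (filt u). t < clock L (atomic_measure n y b) u \<omega>} \<in> sets (filt u)"
    using clock_measurable_filt[of u] by measurable
  then show "{\<omega> \<in> space M. t < clock L (atomic_measure n y b) u \<omega>} \<in> sets (filt u)"
    by simp
qed (simp add: eventually_clock_greater)

text \<open>If the clock exceeds \<open>t\<close> at some time, lower semicontinuity lets it exceed
  \<open>t\<close> at a slightly later rational time, so a countable union describes the
  event.\<close>

lemma time_change_measurable: "(\<lambda>\<omega>. time_change L (atomic_measure n y b) t \<omega>) \<in> borel_measurable M"
proof (rule borel_measurableI_less)
  fix c :: ennreal
  let ?\<Gamma> = "clock L (atomic_measure n y b)"
  have "{\<omega> \<in> space M. time_change L (atomic_measure n y b) t \<omega> < c}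
      = (\<Union>q\<in>{q\<in>\<rat>. 0 \<le> q \<and> ennreal q < c}. {\<omega> \<in> space M. ennreal t < ?\<Gamma> q \<omega>})"
  proof (intro set_eqI iffI)
    fix \<omega> assume "\<omega> \<in> {\<omega> \<in> space M. time_change L (atomic_measure n y b) t \<omega> < c}"
    then obtain u where u: "0 \<le> u" "ennreal u < c" "ennreal t < ?\<Gamma> u \<omega>" "\<omega> \<in> space M"
      unfolding time_change_def Inf_less_iff by auto
    obtain w where w: "u < w" "ennreal w \<le> c"
    proof (cases c)
      case (real r)
      then show thesis
        using u that[of r] by (simp add: ennreal_less_iff)
    next
      case top
      then show thesis
        using that[of "u + 1"] by simp
    qed
    from u have "\<forall>\<^sub>F v in at u within {0..}. ennreal t < ?\<Gamma> v \<omega>"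
      by (intro eventually_clock_greater) auto
    from eventually_at_within_right[OF this u(1) w(1)]
    obtain q where q: "q \<in> \<rat>" "u < q" "q < w" "ennreal t < ?\<Gamma> q \<omega>" .
    then have "ennreal q < ennreal w"
      using u by (intro ennreal_lessI) auto
    then have "ennreal q < c"
      using w(2) by (rule order_less_le_trans)
    then show "\<omega> \<in> (\<Union>q\<in>{q\<in>\<rat>. 0 \<le> q \<and> ennreal q < c}. {\<omega> \<in> space M. ennreal t < ?\<Gamma> q \<omega>})"
      using q u by auto
  next
    fix \<omega> assume "\<omega> \<in> (\<Union>q\<in>{q\<in>\<rat>. 0 \<le> q \<and> ennreal q < c}. {\<omega> \<in> space M. ennreal t < ?\<Gamma> q \<omega>})"
    then show "\<omega> \<in> {\<omega> \<in> space M. time_change L (atomic_measure n y b) t \<omega> < c}"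
      unfolding time_change_def Inf_less_iff by blast
  qed
  moreover have "{\<omega> \<in> space M. ennreal t < ?\<Gamma> q \<omega>} \<in> sets M" if "0 \<le> q" for q
    by (rule sets_filtD[of _ q]) (use adapted_open_clock[of "ennreal t" n y b] that in \<open>unfold adapted_open_def, blast\<close>)
  moreover have "countable {q\<in>\<rat>. 0 \<le> q \<and> ennreal q < c}"
    by (rule countable_subset[OF _ countable_rat]) auto
  ultimately show "{\<omega> \<in> space M. time_change L (atomic_measure n y b) t \<omega> < c} \<in> sets M"
    by (auto intro!: sets.countable_UN')
qed

lemma gen_diffusion_measurable: "gen_diffusion B L (atomic_measure n y b) t \<in> borel_measurable M"
  unfolding gen_diffusion_def[abs_def] using time_change_measurable
  by (intro random_time_measurable[OF random_variable_B continuous_paths]) auto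

text \<open>The common form of all stopping below: at \<open>P\<close>, at the bound
  \<open>K\<close>, or at the horizon \<open>T\<close>. None of the open conditions holds at time 0
  on regular paths, so by \<open>not_until_debut\<close> their negations persist up to and including
  the stopping time.\<close>

lemma
  assumes P: "adapted_open P" and P0: "\<forall>\<omega>. regular \<omega> \<longrightarrow> \<not> P 0 \<omega>" and K: "\<bar>x\<^sub>0\<bar> \<le> K" and T: "0 < T"
  defines "\<tau> \<equiv> debut T (\<lambda>u \<omega>. unbounded_by K u \<omega> \<or> P u \<omega>)"
  shows debut_unbounded_optional: "optional_time T \<tau>"
    and debut_unbounded_bounds: "regular \<omega> \<Longrightarrow> 0 \<le> s \<Longrightarrow> s \<le> \<tau> \<omega> \<Longrightarrow> \<bar>B s \<omega>\<bar> \<le> K \<and> (\<forall>x. L s x \<omega> \<le> K) \<and> \<not> P s \<omega>"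
    and debut_unbounded_integrable_L: "integrable M (\<lambda>\<omega>. L (\<tau> \<omega>) a \<omega>)"
    and debut_unbounded_integrable_B: "integrable M (\<lambda>\<omega>. B (\<tau> \<omega>) \<omega>)"
    and debut_unbounded_tanaka: "expectation (\<lambda>\<omega>. max 0 (B (\<tau> \<omega>) \<omega> - a)) = max 0 (x\<^sub>0 - a) + expectation (\<lambda>\<omega>. L (\<tau> \<omega>) a \<omega>) / 2"
    and debut_unbounded_expectation: "expectation (\<lambda>\<omega>. B (\<tau> \<omega>) \<omega>) = x\<^sub>0"
proof -
  have ao: "adapted_open (\<lambda>u \<omega>. unbounded_by K u \<omega> \<or> P u \<omega>)"
    by (intro adapted_open_disj adapted_open_unbounded_by P)
  show opt: "optional_time T \<tau>"
    unfolding \<tau>_def using T by (intro optional_time_debut ao) simp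
  show bds: "\<bar>B s \<omega>\<bar> \<le> K \<and> (\<forall>x. L s x \<omega> \<le> K) \<and> \<not> P s \<omega>" if \<omega>: "regular \<omega>" "0 \<le> s" "s \<le> \<tau> \<omega>" for s \<omega>
  proof -
    have "\<not> (unbounded_by K 0 \<omega> \<or> P 0 \<omega>)"
      using P0 K \<omega> by (auto simp: unbounded_by_def L_0 regular_start)
    then have "\<not> (unbounded_by K s \<omega> \<or> P s \<omega>)"
      using ao \<omega> T regular_space[OF \<omega>(1)] unfolding \<tau>_def adapted_open_def
      by (intro not_until_debut[of "\<lambda>u \<omega>. unbounded_by K u \<omega> \<or> P u \<omega>" \<omega> s T]) auto
    then show ?thesis
      unfolding unbounded_by_def by (auto simp: not_less)
  qed
  have bd: "AE \<omega> in M. (\<forall>s. 0 \<le> s \<longrightarrow> s \<le> \<tau> \<omega> \<longrightarrow> \<bar>B s \<omega>\<bar> \<le> K) \<and> (\<forall>x. L (\<tau> \<omega>) x \<omega> \<le> K)"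
    using AE_regular
  proof eventually_elim
    case (elim \<omega>)
    moreover have "0 \<le> \<tau> \<omega>"
      unfolding \<tau>_def using T by (intro debut_nonneg) simp
    ultimately show ?case
      using bds by blast
  qed
  show "integrable M (\<lambda>\<omega>. L (\<tau> \<omega>) a \<omega>)" "integrable M (\<lambda>\<omega>. B (\<tau> \<omega>) \<omega>)"
    "expectation (\<lambda>\<omega>. max 0 (B (\<tau> \<omega>) \<omega> - a)) = max 0 (x\<^sub>0 - a) + expectation (\<lambda>\<omega>. L (\<tau> \<omega>) a \<omega>) / 2"
    "expectation (\<lambda>\<omega>. B (\<tau> \<omega>) \<omega>) = x\<^sub>0"
    by (rule integrable_L_optional[OF T opt bd] integrable_B_optional[OF T opt bd] tanaka[OF T opt bd] expectation_B_optional[OF T opt bd])+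
qed

text \<open>Stopping when the local time at \<open>c\<close> becomes positive leaves no local time in Tanaka's formula.\<close>

lemma AE_same_side:
  "AE \<omega> in M. \<forall>u\<ge>0. L u c \<omega> = 0 \<longrightarrow> (c \<le> x\<^sub>0 \<longrightarrow> c \<le> B u \<omega>) \<and> (x\<^sub>0 \<le> c \<longrightarrow> B u \<omega> \<le> c)"
proof -
  \<comment> \<open>Positivity of the local time at \<open>c\<close>, written as positivity of the
    clock of infinite atoms at \<open>c\<close>, so that the facts about clocks provide adaptedness
    and openness.\<close>
  define P where "P u \<omega> \<longleftrightarrow> 0 < clock L (atomic_measure 0 (\<lambda>_. c) (\<lambda>_. \<infinity>)) u \<omega>" for u \<omega>
  have P_iff: "P u \<omega> \<longleftrightarrow> 0 < L u c \<omega>" if "\<omega> \<in> space M" "0 \<le> u" for u \<omega>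
    using that unfolding P_def by (subst clock_atomic) (auto simp: ennreal_zero_less_mult_iff)
  have P: "adapted_open P"
    unfolding P_def by (rule adapted_open_clock)
  have P0: "\<forall>\<omega>. regular \<omega> \<longrightarrow> \<not> P 0 \<omega>"
    by (simp add: P_def clock_0)
  define \<tau> where "\<tau> T K = debut T (\<lambda>u \<omega>. unbounded_by K u \<omega> \<or> P u \<omega>)" for T K
  have side: "AE \<omega> in M. (c \<le> x\<^sub>0 \<longrightarrow> c \<le> B (\<tau> T K \<omega>) \<omega>) \<and> (x\<^sub>0 \<le> c \<longrightarrow> B (\<tau> T K \<omega>) \<omega> \<le> c)"
    if T: "0 < T" and K: "\<bar>x\<^sub>0\<bar> \<le> K" for T K
  proof -
    note facts = debut_unbounded_optional[OF P P0 K T] debut_unbounded_bounds[OF P P0 K T]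
      debut_unbounded_integrable_B[OF P P0 K T] debut_unbounded_tanaka[OF P P0 K T, of c]
      debut_unbounded_expectation[OF P P0 K T]
    note facts = facts[folded \<tau>_def]
    have nn: "0 \<le> \<tau> T K \<omega>" for \<omega>
      unfolding \<tau>_def using T by (intro debut_nonneg) simp
    have "AE \<omega> in M. L (\<tau> T K \<omega>) c \<omega> = 0"
      using AE_regular
    proof eventually_elim
      case (elim \<omega>)
      then show ?case
        using facts(2)[OF elim nn[of \<omega>] order_refl] P_iff[OF regular_space[OF elim] nn[of \<omega>]]
          L_nonneg[OF regular_space[OF elim] nn[of \<omega>], of c]
        by simp
    qed
    then have "expectation (\<lambda>\<omega>. L (\<tau> T K \<omega>) c \<omega>) = 0"
      by (rule integral_eq_zero_AE)
    then have tan: "expectation (\<lambda>\<omega>. max 0 (B (\<tau> T K \<omega>) \<omega> - c)) = max 0 (x\<^sub>0 - c)"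
      using facts(4) by simp
    have i1: "integrable M (\<lambda>\<omega>. max 0 (B (\<tau> T K \<omega>) \<omega> - c))"
      using facts(3) by (intro integrable_max) auto
    have i2: "integrable M (\<lambda>\<omega>. max 0 (B (\<tau> T K \<omega>) \<omega> - c) - B (\<tau> T K \<omega>) \<omega> + c)"
      using i1 facts(3) by auto
    \<comment> \<open>\<open>max 0 z - z\<close> is the negative part of \<open>z = B - c\<close>.
      Both parts have the same mean as at the start, so the part that vanishes initially vanishes
      almost surely.\<close>
    have tan2: "expectation (\<lambda>\<omega>. max 0 (B (\<tau> T K \<omega>) \<omega> - c) - B (\<tau> T K \<omega>) \<omega> + c) = max 0 (x\<^sub>0 - c) - x\<^sub>0 + c"
      using i1 facts(3) tan facts(5) by (simp add: prob_space)
    have "AE \<omega> in M. c \<le> x\<^sub>0 \<longrightarrow> max 0 (B (\<tau> T K \<omega>) \<omega> - c) - B (\<tau> T K \<omega>) \<omega> + c = 0"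
      using integral_nonneg_eq_0_iff_AE[OF i2] tan2 by (cases "c \<le> x\<^sub>0") (auto simp: max_def)
    moreover have "AE \<omega> in M. x\<^sub>0 \<le> c \<longrightarrow> max 0 (B (\<tau> T K \<omega>) \<omega> - c) = 0"
      using integral_nonneg_eq_0_iff_AE[OF i1] tan by (cases "x\<^sub>0 \<le> c") auto
    ultimately show ?thesis
      by eventually_elim (auto simp: max_def split: if_splits)
  qed
  \<comment> \<open>Countably many horizons and bounds suffice: for a rational \<open>q\<close> with
    \<open>L q c \<omega> = 0\<close> and a large enough bound, the stopping time with horizon
    \<open>q\<close> is \<open>q\<close> itself.\<close>
  have "AE \<omega> in M. \<forall>T\<in>\<rat> \<inter> {0<..}. \<forall>k::nat. (c \<le> x\<^sub>0 \<longrightarrow> c \<le> B (\<tau> T (\<bar>x\<^sub>0\<bar> + real k) \<omega>) \<omega>) \<and>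
      (x\<^sub>0 \<le> c \<longrightarrow> B (\<tau> T (\<bar>x\<^sub>0\<bar> + real k) \<omega>) \<omega> \<le> c)"
    using side countable_rat by (intro AE_ball_countable' AE_all_countable[THEN iffD2] allI) auto
  then show ?thesis
    using AE_regular
  proof eventually_elim
    case (elim \<omega>)
    note \<omega> = elim(2)
    have rat: "(c \<le> x\<^sub>0 \<longrightarrow> c \<le> B q \<omega>) \<and> (x\<^sub>0 \<le> c \<longrightarrow> B q \<omega> \<le> c)"
      if q: "q \<in> \<rat>" "0 < q" "L q c \<omega> = 0" for q
    proof -
      have no_hit: "\<not> P s \<omega>" if "0 \<le> s" "s \<le> q" for s
        using that q P_iff[OF regular_space[OF \<omega>], of s] L_mono[OF \<omega>, of s q c] by auto
      obtain K0 where K0: "\<forall>K\<ge>K0. \<forall>s. 0 \<le> s \<longrightarrow> s \<le> q \<longrightarrow> \<not> unbounded_by K s \<omega>"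
        using eventually_not_unbounded_by[OF \<omega>, of q] q by auto
      obtain k :: nat where k: "K0 \<le> real k"
        using real_arch_simple by blast
      have "q \<le> \<tau> q (\<bar>x\<^sub>0\<bar> + real k) \<omega>"
        unfolding \<tau>_def
      proof (rule debut_ge)
        fix v assume "0 \<le> v" "v \<le> q" "unbounded_by (\<bar>x\<^sub>0\<bar> + real k) v \<omega> \<or> P v \<omega>"
        then show "q \<le> v"
          using no_hit K0 k by auto
      qed simp
      moreover have "\<tau> q (\<bar>x\<^sub>0\<bar> + real k) \<omega> \<le> q"
        unfolding \<tau>_def using q by (intro debut_le_T) simp
      ultimately have "\<tau> q (\<bar>x\<^sub>0\<bar> + real k) \<omega> = q" by simp
      moreover have "q \<in> \<rat> \<inter> {0<..}" using q by simp
      ultimately show ?thesis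
        using elim(1) by metis
    qed
    show ?case
    proof (intro allI impI)
      fix u :: real assume u: "0 \<le> u" "L u c \<omega> = 0"
      show "(c \<le> x\<^sub>0 \<longrightarrow> c \<le> B u \<omega>) \<and> (x\<^sub>0 \<le> c \<longrightarrow> B u \<omega> \<le> c)"
      proof (cases "u = 0")
        case True
        then show ?thesis
          using regular_start[OF \<omega>] by simp
      next
        case False
        then have u': "0 < u" using u by simp
        \<comment> \<open>Local time increases from 0, so \<open>L u c \<omega> = 0\<close> forces
          the same at earlier rational times; continuity of the path then carries the inequality to
          \<open>u\<close>.\<close>
        have inside: "(c \<le> x\<^sub>0 \<longrightarrow> c \<le> B q \<omega>) \<and> (x\<^sub>0 \<le> c \<longrightarrow> B q \<omega> \<le> c)" if "q \<in> \<rat>" "0 < q" "q < u" for q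
          using that u L_mono[OF \<omega>, of q u c] L_nonneg[OF regular_space[OF \<omega>], of q c] by (intro rat) auto
        have False if S: "open S" "B u \<omega> \<in> S" "\<And>q. q \<in> \<rat> \<Longrightarrow> 0 < q \<Longrightarrow> q < u \<Longrightarrow> B q \<omega> \<notin> S" for S
        proof -
          have "\<forall>\<^sub>F v in at u within {0..}. B v \<omega> \<in> S"
            using S u by (intro eventually_at_path continuous_paths regular_space[OF \<omega>])
          then obtain d where d: "0 < d" "\<And>v. v \<in> {0..} \<Longrightarrow> v \<noteq> u \<Longrightarrow> dist v u < d \<Longrightarrow> B v \<omega> \<in> S"
            unfolding eventually_at by blast
          obtain q where "q \<in> \<rat>" "max 0 (u - d) < q" "q < u"
            using Rats_dense_in_real[of "max 0 (u - d)" u] u' d(1) by auto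
          then show False
            using S(3)[of q] d(2)[of q] by (auto simp: dist_real_def)
        qed
        from this[of "{..<c}"] this[of "{c<..}"] inside show ?thesis
          by (metis greaterThan_iff lessThan_iff not_less open_greaterThan open_lessThan)
      qed
    qed
  qed
qed

end

section \<open>The discrete diffusion\<close>

lemma finite_gap_real:
  fixes S :: "real set"
  assumes S: "finite S" "lo \<in> S" "hi \<in> S" and x: "lo \<le> x" "x \<le> hi" "x \<notin> S"
  obtains a c where "a \<in> S" "c \<in> S" "a < x" "x < c" "S \<inter> {a<..<c} = {}"
proof -
  define A where "A = {s \<in> S. s < x}"
  define C where "C = {s \<in> S. x < s}"
  have fin: "finite A" "finite C"
    using S by (auto simp: A_def C_def)
  have "lo \<noteq> x" "hi \<noteq> x"
    using S x by auto
  then have "lo \<in> A" "hi \<in> C"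
    using S x by (auto simp: A_def C_def)
  then have ne: "A \<noteq> {}" "C \<noteq> {}" by auto
  have "S \<inter> {Max A<..<Min C} = {}"
  proof (rule ccontr)
    assume "S \<inter> {Max A<..<Min C} \<noteq> {}"
    then obtain s where s: "s \<in> S" "Max A < s" "s < Min C" by auto
    then have "s \<notin> A" "s \<notin> C"
      using fin by (auto dest: Max_ge[OF fin(1)] Min_le[OF fin(2)])
    then show False
      using s(1) x(3) by (auto simp: A_def C_def)
  qed
  moreover have "Max A \<in> A" "Min C \<in> C"
    using fin ne by (auto intro: Max_in Min_in)
  ultimately show thesis
    by (intro that[of "Max A" "Min C"]) (auto simp: A_def C_def)
qed

context brownian_motion
begin

lemma AE_B_neq:
  assumes T: "0 < T"
  shows "AE \<omega> in M. B T \<omega> \<noteq> c"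
proof -
  have D: "distributed M lborel (\<lambda>\<omega>. B T \<omega> - B 0 \<omega>) (normal_density 0 (sqrt (T - 0)))"
    using T by (intro normal_increments) auto
  have "emeasure M ((\<lambda>\<omega>. B T \<omega> - B 0 \<omega>) -` {c - x\<^sub>0} \<inter> space M)
      = (\<integral>\<^sup>+x. ennreal (normal_density 0 (sqrt (T - 0)) x) * indicator {c - x\<^sub>0} x \<partial>lborel)"
    by (rule distributed_emeasure[OF D]) simp
  also have "\<dots> = (\<integral>\<^sup>+x. 0 \<partial>(lborel :: real measure))"
    using AE_lborel_singleton[of "c - x\<^sub>0"] by (intro nn_integral_cong_AE) (auto elim!: eventually_mono simp: indicator_def)
  finally have "emeasure M ((\<lambda>\<omega>. B T \<omega> - B 0 \<omega>) -` {c - x\<^sub>0} \<inter> space M) = 0"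
    by simp
  moreover have "(\<lambda>\<omega>. B T \<omega> - B 0 \<omega>) -` {c - x\<^sub>0} \<inter> space M \<in> sets M"
    using T random_variable_B[of T] random_variable_B[of 0] by (intro measurable_sets[OF borel_measurable_diff]) auto
  ultimately have "(\<lambda>\<omega>. B T \<omega> - B 0 \<omega>) -` {c - x\<^sub>0} \<inter> space M \<in> null_sets M"
    by auto
  from AE_not_in[OF this] start AE_space show ?thesis
    by eventually_elim auto
qed

text \<open>The normal density is at most its peak. The decay in \<open>T\<close> is what forces the
  path to leave every bounded interval.\<close>

lemma prob_B_interval_le:
  assumes T: "0 < T" and le: "lo \<le> hi"
  shows "prob {\<omega> \<in> space M. lo \<le> B T \<omega> \<and> B T \<omega> \<le> hi} \<le> (hi - lo) / sqrt (2 * pi * T)"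
proof -
  have [measurable]: "B T \<in> borel_measurable M" "B 0 \<in> borel_measurable M"
    using T by (auto intro: random_variable_B)
  have D: "distributed M lborel (\<lambda>\<omega>. B T \<omega> - B 0 \<omega>) (normal_density 0 (sqrt (T - 0)))"
    using T by (intro normal_increments) auto
  have "emeasure M {\<omega> \<in> space M. lo \<le> B T \<omega> \<and> B T \<omega> \<le> hi}
      = emeasure M ((\<lambda>\<omega>. B T \<omega> - B 0 \<omega>) -` {lo - x\<^sub>0..hi - x\<^sub>0} \<inter> space M)"
    using start by (intro emeasure_eq_AE) (auto elim!: eventually_mono)
  also have "\<dots> = (\<integral>\<^sup>+x. ennreal (normal_density 0 (sqrt (T - 0)) x) * indicator {lo - x\<^sub>0..hi - x\<^sub>0} x \<partial>lborel)"
    by (rule distributed_emeasure[OF D]) simp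
  also have "\<dots> \<le> (\<integral>\<^sup>+x. ennreal (1 / sqrt (2 * pi * T)) * indicator {lo - x\<^sub>0..hi - x\<^sub>0} x \<partial>lborel)"
  proof (intro nn_integral_mono mult_right_mono ennreal_leI)
    fix x
    have "exp (- (x - 0)\<^sup>2 / (2 * (sqrt (T - 0))\<^sup>2)) \<le> 1"
      by simp
    then have "1 / sqrt (2 * pi * T) * exp (- (x - 0)\<^sup>2 / (2 * (sqrt (T - 0))\<^sup>2)) \<le> 1 / sqrt (2 * pi * T) * 1"
      using T by (intro mult_left_mono) auto
    then show "normal_density 0 (sqrt (T - 0)) x \<le> 1 / sqrt (2 * pi * T)"
      using T by (simp add: normal_density_def)
  qed simp
  also have "\<dots> = ennreal ((hi - lo) / sqrt (2 * pi * T))"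
    using T le by (simp add: nn_integral_cmult ennreal_mult'[symmetric])
  finally show ?thesis
    using T le by (simp add: emeasure_eq_measure ennreal_le_iff)
qed

end

locale discrete_diffusion = brownian_local_time M x\<^sub>0 B L
  for M :: "'a measure" and x\<^sub>0 :: real and B :: "real \<Rightarrow> 'a \<Rightarrow> real" and L :: "real \<Rightarrow> real \<Rightarrow> 'a \<Rightarrow> real" +
  fixes n :: nat and y :: "nat \<Rightarrow> real" and b :: "nat \<Rightarrow> ennreal"
  assumes infinite_ends: "b 0 = \<infinity>" "b (n+1) = \<infinity>"
    and start_between: "y 0 < x\<^sub>0" "x\<^sub>0 < y (n+1)"
begin

abbreviation \<Gamma> :: "real \<Rightarrow> 'a \<Rightarrow> ennreal" where
  "\<Gamma> \<equiv> clock L (atomic_measure n y b)"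

abbreviation X :: "real \<Rightarrow> 'a \<Rightarrow> real" where
  "X \<equiv> gen_diffusion B L (atomic_measure n y b)"

definition charged :: "real set" where
  "charged = y ` {i. i \<le> n + 1 \<and> b i \<noteq> 0}"

lemma finite_charged: "finite charged"
  by (simp add: charged_def)

lemma ends_charged: "y 0 \<in> charged" "y (n+1) \<in> charged"
  unfolding charged_def using infinite_ends by (auto intro!: imageI)

lemma clock_split:
  assumes "\<omega> \<in> space M" "0 \<le> u" "i \<le> n + 1"
  shows "\<Gamma> u \<omega> = b i * ennreal (L u (y i) \<omega>) + (\<Sum>k\<in>{0..n+1} - {i}. b k * ennreal (L u (y k) \<omega>))"
  unfolding clock_atomic[OF assms(1,2)] using assms(3) by (intro sum.remove) auto

lemma L_eq_0_at_infinite_atom: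
  assumes \<omega>: "\<omega> \<in> space M" "0 \<le> u" and fin: "\<Gamma> u \<omega> \<le> ennreal t" and i: "i \<le> n + 1" "b i = \<infinity>"
  shows "L u (y i) \<omega> = 0"
proof (rule ccontr)
  assume "L u (y i) \<omega> \<noteq> 0"
  then have "0 < L u (y i) \<omega>"
    using L_nonneg[OF \<omega>, of "y i"] by simp
  then have "b i * ennreal (L u (y i) \<omega>) = \<infinity>"
    using i(2) by (simp add: ennreal_top_mult)
  then have "\<Gamma> u \<omega> = \<infinity>"
    unfolding clock_split[OF \<omega> i(1)] by simp
  then show False
    using fin by (simp add: top_unique)
qed

text \<open>A finite clock allows no local time at an infinite atom, so \<open>AE_same_side\<close>
  applies at its position.\<close>

lemma AE_same_side_infinite_atom:
  assumes "k \<le> n + 1" "b k = \<infinity>"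
  shows "AE \<omega> in M. \<forall>u\<ge>0. \<forall>t. \<Gamma> u \<omega> \<le> ennreal t \<longrightarrow> (y k \<le> x\<^sub>0 \<longrightarrow> y k \<le> B u \<omega>) \<and> (x\<^sub>0 \<le> y k \<longrightarrow> B u \<omega> \<le> y k)"
  using AE_same_side[of "y k"] AE_space
proof eventually_elim
  case (elim \<omega>)
  then show ?case
    using L_eq_0_at_infinite_atom[OF elim(2) _ _ assms] by blast
qed

lemma AE_between_ends:
  "AE \<omega> in M. \<forall>u\<ge>0. \<forall>t. \<Gamma> u \<omega> \<le> ennreal t \<longrightarrow> y 0 \<le> B u \<omega> \<and> B u \<omega> \<le> y (n+1)"
  using AE_same_side_infinite_atom[OF le0 infinite_ends(1)] AE_same_side_infinite_atom[OF order_refl infinite_ends(2)]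
proof eventually_elim
  case (elim \<omega>)
  then show ?case
    using start_between by (metis less_imp_le)
qed

text \<open>Away from the finite set \<open>charged\<close> the path stays away for a while, no
  charged local time grows, and the clock is constant. This contradicts \<open>hit\<close>, by which
  the clock exceeds \<open>s\<close> arbitrarily soon after \<open>u\<close>.\<close>

lemma hits_charged:
  assumes \<omega>: "regular \<omega>" and u: "0 \<le> u" and le: "\<Gamma> u \<omega> \<le> s"
    and hit: "\<And>w. u < w \<Longrightarrow> \<exists>v. u \<le> v \<and> v < w \<and> s < \<Gamma> v \<omega>"
  shows "B u \<omega> \<in> charged"
proof (rule ccontr)
  assume nc: "B u \<omega> \<notin> charged"
  have "open (- charged)"
    using finite_charged by (intro open_Compl finite_imp_closed)
  then have "\<forall>\<^sub>F v in at u within {0..}. B v \<omega> \<in> - charged"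
    using nc u by (intro eventually_at_path continuous_paths regular_space[OF \<omega>]) auto
  then obtain d where d: "0 < d" "\<And>v. v \<in> {0..} \<Longrightarrow> v \<noteq> u \<Longrightarrow> dist v u < d \<Longrightarrow> B v \<omega> \<notin> charged"
    unfolding eventually_at by auto
  obtain v where v: "u \<le> v" "v < u + d" "s < \<Gamma> v \<omega>"
    using hit[of "u + d"] d(1) by auto
  have "B r \<omega> \<notin> charged" if "u \<le> r" "r \<le> v" for r
    using that d(2)[of r] nc u v by (cases "r = u") (auto simp: dist_real_def)
  then have "L u c \<omega> = L v c \<omega>" if "c \<in> charged" for c
    using that by (intro L_eq_if_not_hit \<omega> u v(1)) metis
  then have "b i * ennreal (L u (y i) \<omega>) = b i * ennreal (L v (y i) \<omega>)" if "i \<in> {0..n+1}" for i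
    using that by (cases "b i = 0") (auto simp: charged_def)
  then have "\<Gamma> u \<omega> = \<Gamma> v \<omega>"
    using u v regular_space[OF \<omega>] by (simp add: clock_atomic)
  then show False
    using le v(3) by simp
qed

text \<open>As long as the clock is at most \<open>t\<close>, the path is confined between the two
  infinite ends, while the probability of finding it there at time \<open>m\<close> is of order
  \<open>1 / sqrt m\<close>.\<close>

lemma AE_clock_unbounded: "AE \<omega> in M. \<exists>u\<ge>0. ennreal t < \<Gamma> u \<omega>"
proof -
  define E where "E m = {\<omega> \<in> space M. y 0 \<le> B (real (Suc m)) \<omega> \<and> B (real (Suc m)) \<omega> \<le> y (n+1)}" for m
  have [measurable]: "B (real (Suc m)) \<in> borel_measurable M" for m
    by (rule random_variable_B) simp
  have E [measurable]: "E m \<in> sets M" for m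
    unfolding E_def by measurable
  have le: "prob (\<Inter>m. E m) \<le> (y (n+1) - y 0) / sqrt (2 * pi * real (Suc m))" for m
  proof -
    have "prob (\<Inter>m. E m) \<le> prob (E m)"
      using E by (intro finite_measure_mono) auto
    also have "\<dots> \<le> (y (n+1) - y 0) / sqrt (2 * pi * real (Suc m))"
      unfolding E_def using start_between by (intro prob_B_interval_le) auto
    finally show ?thesis .
  qed
  have "(\<lambda>m. (y (n+1) - y 0) / sqrt (2 * pi * real (Suc m))) \<longlonglongrightarrow> 0"
    by real_asymp
  then have "prob (\<Inter>m. E m) \<le> 0"
    by (rule LIMSEQ_le_const) (use le in blast)
  then have "(\<Inter>m. E m) \<in> null_sets M"
    using E by (auto simp: emeasure_eq_measure measure_le_0_iff)
  from AE_not_in[OF this] AE_between_ends AE_space show ?thesis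
  proof eventually_elim
    case (elim \<omega>)
    then obtain m where "\<not> (y 0 \<le> B (real (Suc m)) \<omega> \<and> B (real (Suc m)) \<omega> \<le> y (n+1))"
      by (auto simp: E_def)
    then have "\<not> \<Gamma> (real (Suc m)) \<omega> \<le> ennreal t"
      using elim(2) by (metis of_nat_0_le_iff)
    then show ?case
      by (intro exI[of _ "real (Suc m)"]) auto
  qed
qed

text \<open>Replaces the extended infimum by a real time \<open>a\<close> characterised from both
  sides. Lower semicontinuity gives \<open>\<Gamma> \<le> t\<close> also at \<open>a\<close>; a jump
  to infinity can occur only immediately after \<open>a\<close>.\<close>

lemma time_change_finite:
  assumes \<omega>: "regular \<omega>" and ex: "\<exists>u\<ge>0. ennreal t < \<Gamma> u \<omega>"
  obtains a where "0 \<le> a" "time_change L (atomic_measure n y b) t \<omega> = ennreal a" "X t \<omega> = B a \<omega>"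
    "\<And>u. 0 \<le> u \<Longrightarrow> u \<le> a \<Longrightarrow> \<Gamma> u \<omega> \<le> ennreal t"
    "\<And>w. a < w \<Longrightarrow> \<exists>v. a \<le> v \<and> v < w \<and> ennreal t < \<Gamma> v \<omega>"
proof -
  define P where "P u \<omega> \<longleftrightarrow> ennreal t < \<Gamma> u \<omega>" for u \<omega>
  obtain T where T: "0 \<le> T" "P T \<omega>"
    using ex by (auto simp: P_def)
  \<comment> \<open>Any time at which the clock exceeds \<open>t\<close> may serve as horizon; the
    cap is then inactive.\<close>
  define a where "a = debut T P \<omega>"
  have a: "0 \<le> a" "a \<le> T"
    unfolding a_def using T(1) by (auto intro: debut_nonneg debut_le_T)
  have below: "\<Gamma> u \<omega> \<le> ennreal t" if "0 \<le> u" "u \<le> a" for u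
  proof -
    have "\<not> P u \<omega>"
      using that T(1) unfolding a_def
      by (intro not_until_debut[of P \<omega> u T]) (auto simp: P_def clock_0[OF \<omega>] intro!: eventually_clock_greater regular_space[OF \<omega>])
    then show ?thesis
      by (simp add: P_def not_less)
  qed
  have "a < T"
    using below[of T] T a by (cases "a = T") (auto simp: P_def)
  have above: "\<exists>v. a \<le> v \<and> v < w \<and> P v \<omega>" if "a < w" for w
    using debut_approx[of T P \<omega> "min w T"] T(1) \<open>a < T\<close> that unfolding a_def[symmetric] by (metis min.cobounded2 min_less_iff_conj)
  have tc: "time_change L (atomic_measure n y b) t \<omega> = ennreal a"
    unfolding time_change_def
  proof (rule antisym)
    show "Inf {ennreal u |u. 0 \<le> u \<and> ennreal t < \<Gamma> u \<omega>} \<le> ennreal a"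
    proof (rule ennreal_le_epsilon)
      fix e :: real assume "0 < e"
      then obtain v where "a \<le> v" "v < a + e" "P v \<omega>"
        using above[of "a + e"] by auto
      then have "Inf {ennreal u |u. 0 \<le> u \<and> ennreal t < \<Gamma> u \<omega>} \<le> ennreal v"
        using a by (intro Inf_lower) (auto simp: P_def)
      also have "\<dots> \<le> ennreal a + ennreal e"
        using \<open>v < a + e\<close> \<open>0 < e\<close> a by (simp add: ennreal_plus[symmetric] ennreal_leI del: ennreal_plus)
      finally show "Inf {ennreal u |u. 0 \<le> u \<and> ennreal t < \<Gamma> u \<omega>} \<le> ennreal a + ennreal e" .
    qed
    show "ennreal a \<le> Inf {ennreal u |u. 0 \<le> u \<and> ennreal t < \<Gamma> u \<omega>}"
    proof (rule Inf_greatest, clarify)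
      fix u :: real assume "0 \<le> u" "ennreal t < \<Gamma> u \<omega>"
      then have "\<not> u \<le> a"
        using below[of u] by (auto simp: not_le[symmetric])
      then show "ennreal a \<le> ennreal u"
        by (intro ennreal_leI) simp
    qed
  qed
  show thesis
  proof (rule that[OF a(1) tc _ below])
    show "X t \<omega> = B a \<omega>"
      using a(1) by (simp add: gen_diffusion_def tc)
  qed (use above in \<open>auto simp: P_def\<close>)
qed

lemma AE_X_charged: "AE \<omega> in M. X t \<omega> \<in> charged"
  using AE_regular AE_clock_unbounded[of t]
proof eventually_elim
  case (elim \<omega>)
  obtain a where a: "0 \<le> a" "X t \<omega> = B a \<omega>"
    "\<And>u. 0 \<le> u \<Longrightarrow> u \<le> a \<Longrightarrow> \<Gamma> u \<omega> \<le> ennreal t"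
    "\<And>w. a < w \<Longrightarrow> \<exists>v. a \<le> v \<and> v < w \<and> ennreal t < \<Gamma> v \<omega>"
    using time_change_finite[OF elim] by metis
  show ?case
    unfolding a(2) using a(3)[OF a(1) order_refl] a(4) by (rule hits_charged[OF elim(1) a(1)])
qed

lemma AE_X_same_side_infinite_atom:
  assumes "k \<le> n + 1" "b k = \<infinity>"
  shows "AE \<omega> in M. (y k \<le> x\<^sub>0 \<longrightarrow> y k \<le> X t \<omega>) \<and> (x\<^sub>0 \<le> y k \<longrightarrow> X t \<omega> \<le> y k)"
  using AE_regular AE_clock_unbounded[of t] AE_same_side_infinite_atom[OF assms]
proof eventually_elim
  case (elim \<omega>)
  obtain a where "0 \<le> a" "X t \<omega> = B a \<omega>" "\<And>u. 0 \<le> u \<Longrightarrow> u \<le> a \<Longrightarrow> \<Gamma> u \<omega> \<le> ennreal t"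
    using time_change_finite[OF elim(1,2)] by metis
  then show ?case
    using elim(3) by auto
qed

text \<open>The localised times \<open>\<sigma> m\<close> are eventually equal to the true passage
  time on each path, and the positions at these times stay between the ends, so bounded convergence
  transfers the mean.\<close>

lemma expectation_X: "expectation (X t) = x\<^sub>0"
proof -
  define P where "P u \<omega> \<longleftrightarrow> ennreal t < \<Gamma> u \<omega>" for u \<omega>
  have P: "adapted_open P"
    unfolding P_def by (rule adapted_open_clock)
  have P0: "\<forall>\<omega>. regular \<omega> \<longrightarrow> \<not> P 0 \<omega>"
    by (simp add: P_def clock_0)
  define \<sigma> where "\<sigma> m = debut (real (Suc m)) (\<lambda>u \<omega>. unbounded_by (\<bar>x\<^sub>0\<bar> + real m) u \<omega> \<or> P u \<omega>)" for m
  have K: "\<bar>x\<^sub>0\<bar> \<le> \<bar>x\<^sub>0\<bar> + real m" and T: "0 < real (Suc m)" for m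
    by simp_all
  have opt: "optional_time (real (Suc m)) (\<sigma> m)" for m
    unfolding \<sigma>_def by (rule debut_unbounded_optional[OF P P0 K T])
  have bds: "\<not> P s \<omega>" if "regular \<omega>" "0 \<le> s" "s \<le> \<sigma> m \<omega>" for m s \<omega>
    using debut_unbounded_bounds[OF P P0 K T that(1,2) that(3)[unfolded \<sigma>_def]] by simp
  have ex: "expectation (\<lambda>\<omega>. B (\<sigma> m \<omega>) \<omega>) = x\<^sub>0" for m
    unfolding \<sigma>_def by (rule debut_unbounded_expectation[OF P P0 K T])
  have nn: "0 \<le> \<sigma> m \<omega>" for m \<omega>
    unfolding \<sigma>_def by (rule debut_nonneg) simp
  have "(\<lambda>m. expectation (\<lambda>\<omega>. B (\<sigma> m \<omega>) \<omega>)) \<longlonglongrightarrow> expectation (X t)"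
  proof (rule integral_dominated_convergence[where w = "\<lambda>_. \<bar>y 0\<bar> + \<bar>y (n+1)\<bar>"])
    show "X t \<in> borel_measurable M"
      by (rule gen_diffusion_measurable)
    show "(\<lambda>\<omega>. B (\<sigma> m \<omega>) \<omega>) \<in> borel_measurable M" for m
      using opt by (rule B_optional_measurable)
    show "AE \<omega> in M. norm (B (\<sigma> m \<omega>) \<omega>) \<le> \<bar>y 0\<bar> + \<bar>y (n+1)\<bar>" for m
      using AE_regular AE_between_ends
    proof eventually_elim
      case (elim \<omega>)
      have "\<Gamma> (\<sigma> m \<omega>) \<omega> \<le> ennreal t"
        using bds[OF elim(1) nn order_refl] by (simp add: P_def not_less)
      then have "y 0 \<le> B (\<sigma> m \<omega>) \<omega> \<and> B (\<sigma> m \<omega>) \<omega> \<le> y (n+1)"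
        using elim(2) nn by blast
      then show ?case by auto
    qed
    show "AE \<omega> in M. (\<lambda>m. B (\<sigma> m \<omega>) \<omega>) \<longlonglongrightarrow> X t \<omega>"
      using AE_regular AE_clock_unbounded[of t]
    proof eventually_elim
      case (elim \<omega>)
      obtain a where a: "0 \<le> a" "X t \<omega> = B a \<omega>" "\<And>u. 0 \<le> u \<Longrightarrow> u \<le> a \<Longrightarrow> \<Gamma> u \<omega> \<le> ennreal t"
        "\<And>w. a < w \<Longrightarrow> \<exists>v. a \<le> v \<and> v < w \<and> ennreal t < \<Gamma> v \<omega>"
        using time_change_finite[OF elim] by metis
      obtain K0 where K0: "\<forall>K\<ge>K0. \<forall>s. 0 \<le> s \<longrightarrow> s \<le> a \<longrightarrow> \<not> unbounded_by K s \<omega>"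
        using eventually_not_unbounded_by[OF elim(1) a(1)] by auto
      obtain m0 :: nat where m0: "max K0 a \<le> real m0"
        using real_arch_simple by blast
      \<comment> \<open>For large \<open>m\<close> neither the bound nor the horizon interferes up
        to time \<open>a\<close>, and directly after \<open>a\<close> the clock condition stops the
        path.\<close>
      have "\<sigma> m \<omega> = a" if m: "m0 \<le> m" for m
      proof (rule antisym)
        have m': "K0 \<le> \<bar>x\<^sub>0\<bar> + real m" "a < real (Suc m)"
          using m m0 by auto
        show "a \<le> \<sigma> m \<omega>"
          unfolding \<sigma>_def
        proof (rule debut_ge)
          fix v assume v: "0 \<le> v" "unbounded_by (\<bar>x\<^sub>0\<bar> + real m) v \<omega> \<or> P v \<omega>"
          show "a \<le> v"
          proof (rule ccontr)
            assume "\<not> a \<le> v"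
            then show False
              using v K0 m'(1) a(3)[of v] by (auto simp: P_def not_le[symmetric])
          qed
        qed (use m' in simp)
        show "\<sigma> m \<omega> \<le> a"
        proof (rule ccontr)
          assume "\<not> \<sigma> m \<omega> \<le> a"
          then obtain v where v: "a \<le> v" "v < \<sigma> m \<omega>" "P v \<omega>"
            using a(4)[of "\<sigma> m \<omega>"] by (auto simp: P_def)
          then show False
            using bds[OF elim(1), of v m] a(1) by simp
        qed
      qed
      then have "\<forall>\<^sub>F m in sequentially. B (\<sigma> m \<omega>) \<omega> = X t \<omega>"
        unfolding a(2) by (auto simp: eventually_sequentially)
      then show ?case
        by (rule tendsto_eventually)
    qed
  qed simp
  then show ?thesis
    unfolding ex by (simp add: LIMSEQ_const_iff)
qed

text \<open>The weight \<open>b i\<close> and the clock may be infinite. A finite lower bound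
  \<open>\<beta>\<close> of the weight and an additive formulation avoid subtraction of infinite
  values.\<close>

lemma clock_increment:
  assumes \<omega>: "regular \<omega>" and uv: "0 \<le> u" "u \<le> v" and i: "i \<le> n + 1" and \<beta>: "0 \<le> \<beta>" "ennreal \<beta> \<le> b i"
  shows "\<Gamma> u \<omega> + ennreal (\<beta> * (L v (y i) \<omega> - L u (y i) \<omega>)) \<le> \<Gamma> v \<omega>"
proof -
  have v: "0 \<le> v" using uv by simp
  note sp = regular_space[OF \<omega>]
  have mono: "L u (y k) \<omega> \<le> L v (y k) \<omega>" for k
    using L_mono[OF \<omega> uv] .
  have "ennreal (L v (y i) \<omega>) = ennreal (L u (y i) \<omega>) + ennreal (L v (y i) \<omega> - L u (y i) \<omega>)"
    using mono[of i] L_nonneg[OF sp uv(1), of "y i"] by (simp add: ennreal_plus[symmetric] del: ennreal_plus)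
  then have e1: "b i * ennreal (L u (y i) \<omega>) + b i * ennreal (L v (y i) \<omega> - L u (y i) \<omega>) = b i * ennreal (L v (y i) \<omega>)"
    by (simp add: distrib_left)
  have e2: "ennreal (\<beta> * (L v (y i) \<omega> - L u (y i) \<omega>)) \<le> b i * ennreal (L v (y i) \<omega> - L u (y i) \<omega>)"
    using \<beta> mono[of i] by (simp add: ennreal_mult mult_right_mono)
  have e3: "(\<Sum>k\<in>{0..n+1} - {i}. b k * ennreal (L u (y k) \<omega>)) \<le> (\<Sum>k\<in>{0..n+1} - {i}. b k * ennreal (L v (y k) \<omega>))"
    by (intro sum_mono mult_left_mono ennreal_leI mono) simp
  have "\<Gamma> u \<omega> + ennreal (\<beta> * (L v (y i) \<omega> - L u (y i) \<omega>))
      = (b i * ennreal (L u (y i) \<omega>) + ennreal (\<beta> * (L v (y i) \<omega> - L u (y i) \<omega>))) + (\<Sum>k\<in>{0..n+1} - {i}. b k * ennreal (L u (y k) \<omega>))"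
    unfolding clock_split[OF sp uv(1) i] by (simp only: ac_simps)
  also have "\<dots> \<le> (b i * ennreal (L u (y i) \<omega>) + b i * ennreal (L v (y i) \<omega> - L u (y i) \<omega>)) + (\<Sum>k\<in>{0..n+1} - {i}. b k * ennreal (L v (y k) \<omega>))"
    by (intro add_mono order_refl e2 e3)
  also have "\<dots> = \<Gamma> v \<omega>"
    unfolding e1 clock_split[OF sp v i] ..
  finally show ?thesis .
qed

text \<open>
  The clock has no flat stretch at a fixed level: between the times at which it exceeds \<open>s j\<close> and \<open>t\<close>
  the local times at charged points grow by \<open>O(t - s j)\<close>, so by Tanaka's formula the Brownian
  motion, which starts this period at a charged point, cannot be found inside a gap at its end.
\<close>

lemma AE_gap_avoided:
  assumes t: "0 < t" and T: "0 < T" and K: "\<bar>x\<^sub>0\<bar> \<le> K"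
    and ac: "a \<in> charged" "c \<in> charged" "a < c" "charged \<inter> {a<..<c} = {}"
  shows "AE \<omega> in M. \<Gamma> T \<omega> = ennreal t \<longrightarrow>
    debut T (\<lambda>u \<omega>. unbounded_by K u \<omega> \<or> ennreal t < \<Gamma> u \<omega>) \<omega> = T \<longrightarrow> B T \<omega> \<notin> {a<..<c}"
proof -
  \<comment> \<open>Levels increasing to \<open>t\<close>; the offset 2 keeps all of them positive
    and strictly below \<open>t\<close>.\<close>
  define s where "s j = t - t / real (j + 2)" for j :: nat
  have s: "0 \<le> s j" "s j < t" for j
    using t by (auto simp: s_def field_simps)
  have ao: "adapted_open (\<lambda>u \<omega>. ennreal r < \<Gamma> u \<omega>)" for r
    by (rule adapted_open_clock)
  have P0: "\<forall>\<omega>. regular \<omega> \<longrightarrow> \<not> ennreal r < \<Gamma> 0 \<omega>" for r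
    by (simp add: clock_0)
  define \<rho> where "\<rho> r = debut T (\<lambda>u \<omega>. unbounded_by K u \<omega> \<or> ennreal r < \<Gamma> u \<omega>)" for r
  note opt = debut_unbounded_optional[OF ao P0 K T, folded \<rho>_def]
  note bds = debut_unbounded_bounds[OF ao P0 K T, folded \<rho>_def]
  note iL [simp] = debut_unbounded_integrable_L[OF ao P0 K T, folded \<rho>_def]
  note iB [simp] = debut_unbounded_integrable_B[OF ao P0 K T, folded \<rho>_def]
  note tan = debut_unbounded_tanaka[OF ao P0 K T, folded \<rho>_def]
  have \<rho>: "0 \<le> \<rho> r \<omega>" "\<rho> r \<omega> \<le> T" for r \<omega>
    unfolding \<rho>_def using T by (auto intro: debut_nonneg debut_le_T)
  have [measurable]: "(\<lambda>\<omega>. B (\<rho> r \<omega>) \<omega>) \<in> borel_measurable M" "\<rho> r \<in> borel_measurable M" for r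
    using B_optional_measurable[OF opt] opt[unfolded optional_time_def] by auto
  have \<Gamma>_meas [measurable]: "\<Gamma> T \<in> borel_measurable M"
    using T by (intro measurable_filtD[OF clock_measurable_filt]) simp
  have le: "\<rho> (s j) \<omega> \<le> \<rho> t \<omega>" for j \<omega>
  proof -
    have "ennreal (s j) \<le> ennreal t"
      using s[of j] by (intro ennreal_leI) simp
    then show ?thesis
      unfolding \<rho>_def using T by (intro debut_antimono) (auto dest: order_le_less_trans)
  qed
  \<comment> \<open>Before \<open>\<rho> t \<omega>\<close> the bound \<open>K\<close> cannot have
    been exceeded, so what ended the wait for \<open>\<rho> (s j) \<omega>\<close> is the clock
    passing \<open>s j\<close>.\<close>
  have hit: "\<exists>v. \<rho> (s j) \<omega> \<le> v \<and> v < w \<and> v < \<rho> t \<omega> \<and> ennreal (s j) < \<Gamma> v \<omega>"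
    if \<omega>: "regular \<omega>" and w: "\<rho> (s j) \<omega> < w" and lt: "\<rho> (s j) \<omega> < \<rho> t \<omega>" for j \<omega> w
  proof -
    have w': "\<rho> (s j) \<omega> < min w (\<rho> t \<omega>)" "min w (\<rho> t \<omega>) \<le> T"
      using w lt \<rho>(2)[of t \<omega>] by auto
    obtain v where v: "\<rho> (s j) \<omega> \<le> v" "v < min w (\<rho> t \<omega>)" "0 \<le> v" "unbounded_by K v \<omega> \<or> ennreal (s j) < \<Gamma> v \<omega>"
      using debut_approx[OF less_imp_le[OF T] w'(1)[unfolded \<rho>_def[of "s j"]] w'(2)] unfolding \<rho>_def[of "s j", symmetric] by metis
    have "\<not> unbounded_by K v \<omega>"
      using bds[OF \<omega> v(3), of t] v(2) by (auto simp: unbounded_by_def not_less)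
    then show ?thesis
      using v by auto
  qed
  have start_charged: "B (\<rho> (s j) \<omega>) \<omega> \<in> charged" if \<omega>: "regular \<omega>" and lt: "\<rho> (s j) \<omega> < \<rho> t \<omega>" for j \<omega>
  proof (rule hits_charged[OF \<omega> \<rho>(1)])
    show "\<Gamma> (\<rho> (s j) \<omega>) \<omega> \<le> ennreal (s j)"
      using bds[OF \<omega> \<rho>(1) order_refl, of "s j"] by (simp add: not_less)
    show "\<exists>v\<ge>\<rho> (s j) \<omega>. v < w \<and> ennreal (s j) < \<Gamma> v \<omega>" if "\<rho> (s j) \<omega> < w" for w
      using hit[OF \<omega> that lt] by blast
  qed
  have growth: "\<exists>\<beta>>0. \<forall>j \<omega>. regular \<omega> \<longrightarrow> \<beta> * (L (\<rho> t \<omega>) z \<omega> - L (\<rho> (s j) \<omega>) z \<omega>) \<le> t - s j" if z: "z \<in> charged" for z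
  proof -
    obtain i where i: "i \<le> n + 1" "b i \<noteq> 0" "z = y i"
      using z by (auto simp: charged_def)
    \<comment> \<open>A positive finite lower bound of the weight: the weight itself, or 1 if it is
      infinite.\<close>
    obtain \<beta> where \<beta>: "0 < \<beta>" "ennreal \<beta> \<le> b i"
    proof (cases "b i")
      case (real r)
      then show thesis
        using i(2) that[of r] by (auto simp: less_le)
    next
      case top
      then show thesis
        using that[of 1] by simp
    qed
    have "\<beta> * (L (\<rho> t \<omega>) z \<omega> - L (\<rho> (s j) \<omega>) z \<omega>) \<le> t - s j" if \<omega>: "regular \<omega>" for j \<omega>
    proof (cases "\<rho> (s j) \<omega> < \<rho> t \<omega>")
      case False
      then have "\<rho> (s j) \<omega> = \<rho> t \<omega>"
        using le[of j \<omega>] by simp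
      then show ?thesis
        using s[of j] by simp
    next
      case True
      show ?thesis
      proof (rule ccontr)
        assume "\<not> \<beta> * (L (\<rho> t \<omega>) z \<omega> - L (\<rho> (s j) \<omega>) z \<omega>) \<le> t - s j"
        then have big: "\<beta> * (L (\<rho> t \<omega>) z \<omega> - L (\<rho> (s j) \<omega>) z \<omega>) \<in> {t - s j<..}" by simp
        \<comment> \<open>At \<open>\<rho> (s j) \<omega>\<close> itself the clock is still at most
          \<open>s j\<close>. Continuity of local time moves the supposed excess to a slightly later
          \<open>v\<close>, where the clock already exceeds \<open>s j\<close> and
          \<open>clock_increment\<close> gives a contradiction with level \<open>t\<close>.\<close>
        have "continuous_on {0..} (\<lambda>v. \<beta> * (L (\<rho> t \<omega>) z \<omega> - L v z \<omega>))"
          by (intro continuous_intros L_continuous_time regular_space[OF \<omega>])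
        from eventually_at_path[OF this \<rho>(1) big open_greaterThan]
        obtain d where d: "0 < d" "\<And>v. v \<in> {0..} \<Longrightarrow> v \<noteq> \<rho> (s j) \<omega> \<Longrightarrow> dist v (\<rho> (s j) \<omega>) < d \<Longrightarrow> t - s j < \<beta> * (L (\<rho> t \<omega>) z \<omega> - L v z \<omega>)"
          unfolding eventually_at by auto
        obtain v where v: "\<rho> (s j) \<omega> \<le> v" "v < \<rho> (s j) \<omega> + d" "v < \<rho> t \<omega>" "ennreal (s j) < \<Gamma> v \<omega>"
          using hit[OF \<omega> _ True, of "\<rho> (s j) \<omega> + d"] d(1) by auto
        have v0: "0 \<le> v" using v(1) \<rho>(1)[of "s j" \<omega>] by simp
        have lt: "t - s j < \<beta> * (L (\<rho> t \<omega>) z \<omega> - L v z \<omega>)"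
          using v v0 d(2)[of v] big by (cases "v = \<rho> (s j) \<omega>") (auto simp: dist_real_def)
        have "ennreal (s j) + ennreal (\<beta> * (L (\<rho> t \<omega>) z \<omega> - L v z \<omega>)) \<le> \<Gamma> v \<omega> + ennreal (\<beta> * (L (\<rho> t \<omega>) z \<omega> - L v z \<omega>))"
          using v(4) by (intro add_right_mono) simp
        also have "\<dots> \<le> \<Gamma> (\<rho> t \<omega>) \<omega>"
          unfolding i(3) using v v0 \<beta> by (intro clock_increment[OF \<omega>] i) auto
        also have "\<dots> \<le> ennreal t"
          using bds[OF \<omega> \<rho>(1) order_refl, of t] by (simp add: not_less)
        finally have "ennreal (s j + \<beta> * (L (\<rho> t \<omega>) z \<omega> - L v z \<omega>)) \<le> ennreal t"
          using lt s[of j] by (subst ennreal_plus) auto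
        then have "s j + \<beta> * (L (\<rho> t \<omega>) z \<omega> - L v z \<omega>) \<le> t"
          using t by (simp add: ennreal_le_iff)
        then show False
          using lt by simp
      qed
    qed
    then show ?thesis
      using \<beta>(1) by blast
  qed
  define m where "m = (a + c) / 2"
  \<comment> \<open>The tent over \<open>[a,c]\<close> with its peak at the midpoint: positive
    inside the gap and zero at all charged points.\<close>
  define f where "f x = max 0 (x - a) - 2 * max 0 (x - m) + max 0 (x - c)" for x
  have f_nonneg: "0 \<le> f x" for x
    using ac(3) by (auto simp: f_def m_def max_def field_simps)
  have f_pos: "0 < f x" if "x \<in> {a<..<c}" for x
    using that by (auto simp: f_def m_def max_def field_simps)
  have f_charged: "f x = 0" if "x \<in> charged" for x
  proof -
    have "x \<le> a \<or> c \<le> x"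
      using that ac(4) by force
    then show ?thesis
      using ac(3) by (auto simp: f_def m_def max_def field_simps)
  qed
  have [measurable]: "f \<in> borel_measurable borel"
    unfolding f_def[abs_def] by measurable
  have imax [simp]: "integrable M (\<lambda>\<omega>. max 0 (B (\<rho> r \<omega>) \<omega> - z))" for r z
    using iB[of r] by (intro integrable_max Bochner_Integration.integrable_diff) auto
  have if_ [simp]: "integrable M (\<lambda>\<omega>. f (B (\<rho> r \<omega>) \<omega>))" for r
    unfolding f_def by (intro Bochner_Integration.integrable_add Bochner_Integration.integrable_diff integrable_mult_right imax)
  \<comment> \<open>The concave kink at \<open>m\<close> contributes its local time with a negative
    sign. For an upper bound only the growth at the charged ends \<open>a\<close> and
    \<open>c\<close> counts.\<close>
  have Ef: "expectation (\<lambda>\<omega>. f (B (\<rho> r \<omega>) \<omega>)) = f x\<^sub>0 + (expectation (\<lambda>\<omega>. L (\<rho> r \<omega>) a \<omega>)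
      - 2 * expectation (\<lambda>\<omega>. L (\<rho> r \<omega>) m \<omega>) + expectation (\<lambda>\<omega>. L (\<rho> r \<omega>) c \<omega>)) / 2" for r
    unfolding f_def by (simp add: tan field_simps)
  obtain \<beta>a \<beta>c where \<beta>: "0 < \<beta>a" "0 < \<beta>c"
    "\<And>j \<omega>. regular \<omega> \<Longrightarrow> \<beta>a * (L (\<rho> t \<omega>) a \<omega> - L (\<rho> (s j) \<omega>) a \<omega>) \<le> t - s j"
    "\<And>j \<omega>. regular \<omega> \<Longrightarrow> \<beta>c * (L (\<rho> t \<omega>) c \<omega> - L (\<rho> (s j) \<omega>) c \<omega>) \<le> t - s j"
    using growth[OF ac(1)] growth[OF ac(2)] by metis
  have dL: "expectation (\<lambda>\<omega>. L (\<rho> t \<omega>) z \<omega>) - expectation (\<lambda>\<omega>. L (\<rho> (s j) \<omega>) z \<omega>) \<le> (t - s j) / \<beta>"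
    if "0 < \<beta>" "\<And>\<omega>. regular \<omega> \<Longrightarrow> \<beta> * (L (\<rho> t \<omega>) z \<omega> - L (\<rho> (s j) \<omega>) z \<omega>) \<le> t - s j" for z \<beta> j
  proof -
    have "expectation (\<lambda>\<omega>. L (\<rho> t \<omega>) z \<omega> - L (\<rho> (s j) \<omega>) z \<omega>) \<le> expectation (\<lambda>\<omega>. (t - s j) / \<beta>)"
      using AE_regular that by (intro integral_mono_AE) (auto elim!: eventually_mono simp: pos_le_divide_eq mult.commute)
    then show ?thesis
      by (simp add: prob_space)
  qed
  have dLm: "expectation (\<lambda>\<omega>. L (\<rho> (s j) \<omega>) m \<omega>) \<le> expectation (\<lambda>\<omega>. L (\<rho> t \<omega>) m \<omega>)" for j
    using AE_regular by (intro integral_mono_AE) (auto elim!: eventually_mono intro!: L_mono le \<rho>)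
  define F where "F = {\<omega> \<in> space M. \<Gamma> T \<omega> = ennreal t \<and> \<rho> t \<omega> = T}"
  have [measurable]: "F \<in> sets M"
    unfolding F_def by measurable
  \<comment> \<open>On \<open>F\<close> the level \<open>t > s j\<close> is attained at
    \<open>T\<close>; by lower semicontinuity the clock exceeds \<open>s j\<close> strictly before
    \<open>T\<close>.\<close>
  have lt_F: "\<rho> (s j) \<omega> < \<rho> t \<omega>" if "\<omega> \<in> F" for j \<omega>
  proof -
    have \<omega>: "\<omega> \<in> space M" "\<Gamma> T \<omega> = ennreal t" "\<rho> t \<omega> = T"
      using that by (auto simp: F_def)
    have "ennreal (s j) < \<Gamma> T \<omega>"
      unfolding \<omega>(2) using s[of j] by (intro ennreal_lessI) auto
    then have "\<forall>\<^sub>F v in at T within {0..}. ennreal (s j) < \<Gamma> v \<omega>"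
      using T \<omega> by (intro eventually_clock_greater) auto
    from eventually_at_within_left[OF this order_refl T] obtain q where "0 < q" "q < T" "ennreal (s j) < \<Gamma> q \<omega>" .
    then have "\<rho> (s j) \<omega> \<le> q"
      unfolding \<rho>_def by (intro debut_le) auto
    then show ?thesis
      using \<open>q < T\<close> \<omega>(3) by simp
  qed
  have iF: "integrable M (\<lambda>\<omega>. indicator F \<omega> * f (B (\<rho> t \<omega>) \<omega>))"
    using integrable_real_mult_indicator[of F M "\<lambda>\<omega>. f (B (\<rho> t \<omega>) \<omega>)"] by (simp add: mult.commute)
  have "expectation (\<lambda>\<omega>. indicator F \<omega> * f (B (\<rho> t \<omega>) \<omega>)) \<le> (t - s j) / \<beta>a / 2 + (t - s j) / \<beta>c / 2" for j
  proof -
    \<comment> \<open>If the two times differ, the tent vanishes at the earlier one by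
      \<open>start_charged\<close>; if they agree, the path is not in \<open>F\<close> and both
      sides are 0.\<close>
    have "expectation (\<lambda>\<omega>. indicator F \<omega> * f (B (\<rho> t \<omega>) \<omega>)) \<le> expectation (\<lambda>\<omega>. f (B (\<rho> t \<omega>) \<omega>) - f (B (\<rho> (s j) \<omega>) \<omega>))"
    proof (rule integral_mono_AE[OF iF])
      show "AE \<omega> in M. indicator F \<omega> * f (B (\<rho> t \<omega>) \<omega>) \<le> f (B (\<rho> t \<omega>) \<omega>) - f (B (\<rho> (s j) \<omega>) \<omega>)"
        using AE_regular
      proof eventually_elim
        case (elim \<omega>)
        show ?case
        proof (cases "\<rho> (s j) \<omega> < \<rho> t \<omega>")
          case True
          then have "f (B (\<rho> (s j) \<omega>) \<omega>) = 0"
            using start_charged[OF elim] f_charged by blast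
          then show ?thesis
            using f_nonneg by (simp add: indicator_def)
        next
          case False
          then have "\<rho> (s j) \<omega> = \<rho> t \<omega>" "\<omega> \<notin> F"
            using le[of j \<omega>] lt_F[of \<omega> j] by auto
          then show ?thesis by simp
        qed
      qed
    qed simp
    also have "\<dots> = expectation (\<lambda>\<omega>. f (B (\<rho> t \<omega>) \<omega>)) - expectation (\<lambda>\<omega>. f (B (\<rho> (s j) \<omega>) \<omega>))"
      by simp
    also have "\<dots> \<le> (t - s j) / \<beta>a / 2 + (t - s j) / \<beta>c / 2"
      unfolding Ef using dL[OF \<beta>(1,3), of j] dL[OF \<beta>(2,4), of j] dLm[of j] by (simp add: add_divide_distrib diff_divide_distrib)
    finally show ?thesis .
  qed
  moreover have "(\<lambda>j. (t - s j) / \<beta>a / 2 + (t - s j) / \<beta>c / 2) \<longlonglongrightarrow> 0"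
  proof -
    have "(\<lambda>j. t / real (j + 2)) \<longlonglongrightarrow> 0"
      by real_asymp
    then have "(\<lambda>j. t - s j) \<longlonglongrightarrow> 0"
      by (simp add: s_def)
    then have "(\<lambda>j. (t - s j) / \<beta>a / 2 + (t - s j) / \<beta>c / 2) \<longlonglongrightarrow> 0 / \<beta>a / 2 + 0 / \<beta>c / 2"
      using \<beta> by (intro tendsto_intros) auto
    then show ?thesis by simp
  qed
  ultimately have "expectation (\<lambda>\<omega>. indicator F \<omega> * f (B (\<rho> t \<omega>) \<omega>)) \<le> 0"
    by (intro LIMSEQ_le_const) auto
  moreover have "0 \<le> expectation (\<lambda>\<omega>. indicator F \<omega> * f (B (\<rho> t \<omega>) \<omega>))"
    using f_nonneg by (intro Bochner_Integration.integral_nonneg) auto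
  ultimately have "expectation (\<lambda>\<omega>. indicator F \<omega> * f (B (\<rho> t \<omega>) \<omega>)) = 0"
    by simp
  then have "AE \<omega> in M. indicator F \<omega> * f (B (\<rho> t \<omega>) \<omega>) = 0"
    using integral_nonneg_eq_0_iff_AE[OF iF] f_nonneg by simp
  then have "AE \<omega> in M. \<Gamma> T \<omega> = ennreal t \<longrightarrow> \<rho> t \<omega> = T \<longrightarrow> B T \<omega> \<notin> {a<..<c}"
    using AE_space
  proof eventually_elim
    case (elim \<omega>)
    show ?case
    proof (intro impI notI)
      assume *: "\<Gamma> T \<omega> = ennreal t" "\<rho> t \<omega> = T" "B T \<omega> \<in> {a<..<c}"
      then have "\<omega> \<in> F"
        using elim(2) by (simp add: F_def)
      then show False
        using elim(1) *(2) f_pos[OF *(3)] by simp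
    qed
  qed
  then show ?thesis
    by (simp add: \<rho>_def)
qed

text \<open>At a fixed \<open>T\<close> the path almost surely avoids the finitely many charged
  points. If the clock equalled \<open>t\<close>, the path would be between the ends, hence inside a
  gap, which \<open>AE_gap_avoided\<close> excludes once the bound is large.\<close>

lemma AE_clock_neq:
  assumes t: "0 < t" and T: "0 < T"
  shows "AE \<omega> in M. \<Gamma> T \<omega> \<noteq> ennreal t"
proof -
  define G where "G = {(a, c). a \<in> charged \<and> c \<in> charged \<and> a < c \<and> charged \<inter> {a<..<c} = {}}"
  have "G \<subseteq> charged \<times> charged"
    by (auto simp: G_def)
  then have cG: "countable G"
    using finite_charged by (intro countable_finite) (rule finite_subset, auto)
  have "AE \<omega> in M. \<forall>p\<in>G. \<forall>k::nat. \<Gamma> T \<omega> = ennreal t \<longrightarrow>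
      debut T (\<lambda>u \<omega>. unbounded_by (\<bar>x\<^sub>0\<bar> + real k) u \<omega> \<or> ennreal t < \<Gamma> u \<omega>) \<omega> = T \<longrightarrow> B T \<omega> \<notin> {fst p<..<snd p}"
    using cG by (intro AE_ball_countable' AE_all_countable[THEN iffD2] allI AE_gap_avoided t T) (auto simp: G_def)
  moreover have "AE \<omega> in M. \<forall>c\<in>charged. B T \<omega> \<noteq> c"
    using finite_charged by (intro AE_ball_countable' AE_B_neq T) (auto intro: countable_finite)
  ultimately show ?thesis
    using AE_regular AE_between_ends
  proof eventually_elim
    case (elim \<omega>)
    show ?case
    proof
      assume eq: "\<Gamma> T \<omega> = ennreal t"
      have "y 0 \<le> B T \<omega> \<and> B T \<omega> \<le> y (n+1)"
        using elim(4) T eq by (metis less_imp_le order_refl)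
      moreover have "B T \<omega> \<notin> charged"
        using elim(2) by auto
      ultimately obtain a c where ac: "a \<in> charged" "c \<in> charged" "a < B T \<omega>" "B T \<omega> < c" "charged \<inter> {a<..<c} = {}"
        using finite_gap_real[OF finite_charged ends_charged] by metis
      then have "(a, c) \<in> G"
        by (auto simp: G_def)
      obtain K0 where K0: "\<forall>K\<ge>K0. \<forall>s. 0 \<le> s \<longrightarrow> s \<le> T \<longrightarrow> \<not> unbounded_by K s \<omega>"
        using eventually_not_unbounded_by[OF elim(3), of T] T by auto
      obtain k :: nat where k: "K0 \<le> real k"
        using real_arch_simple by blast
      have "debut T (\<lambda>u \<omega>. unbounded_by (\<bar>x\<^sub>0\<bar> + real k) u \<omega> \<or> ennreal t < \<Gamma> u \<omega>) \<omega> = T"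
      proof (rule antisym)
        show "T \<le> debut T (\<lambda>u \<omega>. unbounded_by (\<bar>x\<^sub>0\<bar> + real k) u \<omega> \<or> ennreal t < \<Gamma> u \<omega>) \<omega>"
        proof (rule debut_ge[OF order_refl])
          fix v assume v: "0 \<le> v" "v \<le> T" "unbounded_by (\<bar>x\<^sub>0\<bar> + real k) v \<omega> \<or> ennreal t < \<Gamma> v \<omega>"
          have "\<not> ennreal t < \<Gamma> v \<omega>"
            using clock_mono[OF elim(3) v(1,2), of "atomic_measure n y b"] eq by (simp add: not_less)
          moreover have "K0 \<le> \<bar>x\<^sub>0\<bar> + real k"
            using k by simp
          ultimately show "T \<le> v"
            using v K0 by blast
        qed
      qed (use T in \<open>simp add: debut_le_T\<close>)
      then have "B T \<omega> \<notin> {fst (a, c)<..<snd (a, c)}"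
        using elim(1) \<open>(a, c) \<in> G\<close> eq by blast
      then show False
        using ac by simp
    qed
  qed
qed

text \<open>Clocks converge at each time, so passage times converge unless the limiting clock rests
  at level \<open>t\<close>. Path continuity then gives convergence of the positions, and in a
  finite state space convergent positions are eventually constant.\<close>

lemma prob_X_tendsto:
  assumes bm: "\<And>m. bm m 0 = \<infinity>" "\<And>m. bm m (n+1) = \<infinity>" "\<And>i. i \<le> n + 1 \<Longrightarrow> (\<lambda>m. bm m i) \<longlonglongrightarrow> b i"
    and t: "0 < t"
  shows "(\<lambda>m. prob {\<omega> \<in> space M. gen_diffusion B L (atomic_measure n y (bm m)) t \<omega> = x})
    \<longlonglongrightarrow> prob {\<omega> \<in> space M. X t \<omega> = x}"
proof -
  have loc: "discrete_diffusion M x\<^sub>0 B L n y (bm m)" for m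
    using bm start_between by unfold_locales auto
  define Xm where "Xm m = gen_diffusion B L (atomic_measure n y (bm m)) t" for m
  define \<Gamma>m where "\<Gamma>m m = clock L (atomic_measure n y (bm m))" for m
  have "AE \<omega> in M. \<forall>q\<in>\<rat> \<inter> {0<..}. \<Gamma> q \<omega> \<noteq> ennreal t"
    using countable_rat by (intro AE_ball_countable' AE_clock_neq t) auto
  moreover have "AE \<omega> in M. \<forall>m. \<exists>u\<ge>0. ennreal t < \<Gamma>m m u \<omega>"
    unfolding \<Gamma>m_def by (intro AE_all_countable[THEN iffD2] allI discrete_diffusion.AE_clock_unbounded[OF loc])
  moreover have "AE \<omega> in M. \<forall>m. Xm m \<omega> \<in> y ` {..n+1}"
  proof (intro AE_all_countable[THEN iffD2] allI)
    fix m
    show "AE \<omega> in M. Xm m \<omega> \<in> y ` {..n+1}"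
      using discrete_diffusion.AE_X_charged[OF loc, of m t]
      unfolding discrete_diffusion.charged_def[OF loc] Xm_def by eventually_elim auto
  qed
  ultimately have ev: "AE \<omega> in M. \<forall>\<^sub>F m in sequentially. Xm m \<omega> = X t \<omega>"
    using AE_regular AE_clock_unbounded[of t] AE_X_charged[of t]
  proof eventually_elim
    case (elim \<omega>)
    note \<omega> = elim(4)
    obtain a where a: "0 \<le> a" "X t \<omega> = B a \<omega>" "\<And>u. 0 \<le> u \<Longrightarrow> u \<le> a \<Longrightarrow> \<Gamma> u \<omega> \<le> ennreal t"
      "\<And>w. a < w \<Longrightarrow> \<exists>v. a \<le> v \<and> v < w \<and> ennreal t < \<Gamma> v \<omega>"
      using time_change_finite[OF elim(4,5)] by metis
    have "\<forall>m. \<exists>a. 0 \<le> a \<and> Xm m \<omega> = B a \<omega> \<and> (\<forall>u. 0 \<le> u \<longrightarrow> u \<le> a \<longrightarrow> \<Gamma>m m u \<omega> \<le> ennreal t) \<and>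
        (\<forall>w. a < w \<longrightarrow> (\<exists>v. a \<le> v \<and> v < w \<and> ennreal t < \<Gamma>m m v \<omega>))"
    proof
      fix m
      show "\<exists>a. 0 \<le> a \<and> Xm m \<omega> = B a \<omega> \<and> (\<forall>u. 0 \<le> u \<longrightarrow> u \<le> a \<longrightarrow> \<Gamma>m m u \<omega> \<le> ennreal t) \<and>
        (\<forall>w. a < w \<longrightarrow> (\<exists>v. a \<le> v \<and> v < w \<and> ennreal t < \<Gamma>m m v \<omega>))"
        using discrete_diffusion.time_change_finite[OF loc elim(4), of t m] elim(2) unfolding Xm_def \<Gamma>m_def by metis
    qed
    then obtain am where am: "\<And>m. 0 \<le> am m" "\<And>m. Xm m \<omega> = B (am m) \<omega>"
      "\<And>m u. 0 \<le> u \<Longrightarrow> u \<le> am m \<Longrightarrow> \<Gamma>m m u \<omega> \<le> ennreal t"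
      "\<And>m w. am m < w \<Longrightarrow> \<exists>v. am m \<le> v \<and> v < w \<and> ennreal t < \<Gamma>m m v \<omega>"
      by metis
    have \<Gamma>_lim: "(\<lambda>m. \<Gamma>m m u \<omega>) \<longlonglongrightarrow> \<Gamma> u \<omega>" if "0 \<le> u" for u
    proof -
      \<comment> \<open>The local time factor is finite, so multiplication by it is continuous even
        at an infinite limiting weight; where it is 0 the terms are identically 0.\<close>
      have "(\<lambda>m. \<Sum>i = 0..n+1. ennreal (L u (y i) \<omega>) * bm m i) \<longlonglongrightarrow> (\<Sum>i = 0..n+1. ennreal (L u (y i) \<omega>) * b i)"
        using bm(3) by (intro tendsto_sum ennreal_tendsto_cmult) auto
      then show ?thesis
        using that regular_space[OF \<omega>] by (simp only: \<Gamma>m_def clock_atomic mult.commute)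
    qed
    have "am \<longlonglongrightarrow> a"
    proof (rule order_tendstoI)
      fix w assume w: "w < a"
      show "\<forall>\<^sub>F m in sequentially. w < am m"
      proof (cases "w < 0")
        case True
        then show ?thesis
          using am(1) by (auto intro: always_eventually less_le_trans)
      next
        case False
        then obtain q where q: "q \<in> \<rat>" "w < q" "q < a" "0 < q"
          using Rats_dense_in_real[of w a] w by auto
        \<comment> \<open>Here the absence of a flat stretch enters: strictness below
          \<open>t\<close> passes to the approximating clocks, whereas the weak inequality would
          not.\<close>
        have "\<Gamma> q \<omega> \<noteq> ennreal t"
          using elim(1) q by blast
        moreover have "\<Gamma> q \<omega> \<le> ennreal t"
          using a(3)[of q] q by simp
        ultimately have "\<Gamma> q \<omega> < ennreal t" by simp
        then have "\<forall>\<^sub>F m in sequentially. \<Gamma>m m q \<omega> < ennreal t"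
          using q by (intro order_tendstoD(2)[OF \<Gamma>_lim]) auto
        then show ?thesis
        proof eventually_elim
          case (elim m)
          show ?case
          proof (rule ccontr)
            assume "\<not> w < am m"
            then obtain v where v: "am m \<le> v" "v < q" "ennreal t < \<Gamma>m m v \<omega>"
              using am(4)[of m q] q by auto
            have "\<Gamma>m m v \<omega> \<le> \<Gamma>m m q \<omega>"
              unfolding \<Gamma>m_def using v am(1)[of m] by (intro clock_mono[OF \<omega>]) auto
            then show False
              using v(3) elim by (metis less_asym less_le_trans)
          qed
        qed
      qed
    next
      fix w assume w: "a < w"
      obtain v where v: "a \<le> v" "v < w" "ennreal t < \<Gamma> v \<omega>"
        using a(4)[OF w] by auto
      then have "\<forall>\<^sub>F m in sequentially. ennreal t < \<Gamma>m m v \<omega>"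
        using a(1) by (intro order_tendstoD(1)[OF \<Gamma>_lim]) auto
      then show "\<forall>\<^sub>F m in sequentially. am m < w"
      proof eventually_elim
        case (elim m)
        then show ?case
          using am(3)[of v m] v a(1) by (cases "v \<le> am m") (auto simp: not_le[symmetric])
      qed
    qed
    then have lim: "(\<lambda>m. Xm m \<omega>) \<longlonglongrightarrow> X t \<omega>"
      unfolding a(2) am(2) using a(1) am(1)
      by (intro continuous_on_tendsto_compose[OF continuous_paths[OF regular_space[OF \<omega>]]]) auto
    \<comment> \<open>Removing the limit from the finite state space leaves a closed set, so its
      complement is a neighbourhood in which the only possible state is the limit.\<close>
    have "open (- (y ` {..n+1} - {X t \<omega>}))"
      by (intro open_Compl finite_imp_closed) auto
    then have "\<forall>\<^sub>F m in sequentially. Xm m \<omega> \<in> - (y ` {..n+1} - {X t \<omega>})"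
      by (intro topological_tendstoD[OF lim]) auto
    then show ?case
      by eventually_elim (use elim(3) in auto)
  qed
  have [measurable]: "Xm m \<in> borel_measurable M" "X t \<in> borel_measurable M" for m
    unfolding Xm_def by (rule gen_diffusion_measurable)+
  have "(\<lambda>m. expectation (\<lambda>\<omega>. indicator {x} (Xm m \<omega>) :: real)) \<longlonglongrightarrow> expectation (\<lambda>\<omega>. indicator {x} (X t \<omega>))"
  proof (rule integral_dominated_convergence[where w = "\<lambda>_. 1"])
    show "AE \<omega> in M. (\<lambda>m. indicator {x} (Xm m \<omega>) :: real) \<longlonglongrightarrow> indicator {x} (X t \<omega>)"
      using ev
    proof eventually_elim
      case (elim \<omega>)
      then show ?case
        by (intro tendsto_eventually) (auto elim!: eventually_mono)
    qed
  qed (auto simp: indicator_def)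
  moreover have "expectation (\<lambda>\<omega>. indicator {x} (Z \<omega>) :: real) = prob {\<omega> \<in> space M. Z \<omega> = x}"
    if [measurable]: "Z \<in> borel_measurable M" for Z :: "'a \<Rightarrow> real"
  proof -
    have "expectation (\<lambda>\<omega>. indicator {x} (Z \<omega>) :: real) = expectation (indicator {\<omega> \<in> space M. Z \<omega> = x})"
      by (intro Bochner_Integration.integral_cong) (auto simp: indicator_def)
    then show ?thesis
      by simp
  qed
  ultimately show ?thesis
    by (simp add: Xm_def[symmetric])
qed

end

section \<open>The inverse problem\<close>

lemma common_convergent_subsequence:
  fixes Q :: "nat \<Rightarrow> nat \<Rightarrow> real"
  assumes "\<And>m j. Q m j \<in> {0..1}"
  shows "\<exists>\<phi> v. strict_mono \<phi> \<and> (\<forall>j<n. v j \<in> {0..1} \<and> (\<lambda>m. Q (\<phi> m) j) \<longlonglongrightarrow> v j)"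
proof (induction n)
  case 0
  show ?case
    by (intro exI[of _ id]) (auto simp: strict_mono_id)
next
  case (Suc n)
  then obtain \<phi> v where \<phi>: "strict_mono \<phi>" "\<And>j. j < n \<Longrightarrow> v j \<in> {0..1} \<and> (\<lambda>m. Q (\<phi> m) j) \<longlonglongrightarrow> v j"
    by blast
  have "seq_compact {0..1::real}"
    by (rule compact_imp_seq_compact) simp
  then obtain l \<psi> where \<psi>: "l \<in> {0..1}" "strict_mono \<psi>" "((\<lambda>m. Q (\<phi> m) n) \<circ> \<psi>) \<longlonglongrightarrow> l"
    using assms by (elim seq_compactE[where f = "\<lambda>m. Q (\<phi> m) n"]) auto
  have "(\<lambda>m. Q ((\<phi> \<circ> \<psi>) m) j) \<longlonglongrightarrow> (v(n := l)) j" if "j < Suc n" for j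
    using that \<psi>(3) LIMSEQ_subseq_LIMSEQ[OF conjunct2[OF \<phi>(2)] \<psi>(2), of j] by (cases "j = n") (auto simp: comp_def)
  then show ?case
    using \<phi> \<psi> strict_mono_o[OF \<phi>(1) \<psi>(2)]
    by (intro exI[of _ "\<phi> \<circ> \<psi>"] exI[of _ "v(n := l)"]) (auto simp: comp_def)
qed

text \<open>Kuhn's lemma on ever finer grids gives small cells in which each \<open>f i\<close>
  takes both signs at nearby points; a limit cell is a common zero. Continuity is stated
  coordinatewise along sequences because points of the cube are functions on all of
  \<open>nat\<close>.\<close>

lemma poincare_miranda:
  fixes f :: "nat \<Rightarrow> (nat \<Rightarrow> real) \<Rightarrow> real"
  assumes cont: "\<And>i u v. i < n \<Longrightarrow> (\<And>m j. u m j \<in> {0..1}) \<Longrightarrow> (\<And>j. v j \<in> {0..1}) \<Longrightarrow>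
      (\<And>j. (\<lambda>m. u m j) \<longlonglongrightarrow> v j) \<Longrightarrow> (\<lambda>m. f i (u m)) \<longlonglongrightarrow> f i v"
    and lo: "\<And>i s. i < n \<Longrightarrow> (\<And>j. s j \<in> {0..1}) \<Longrightarrow> s i = 0 \<Longrightarrow> f i s \<le> 0"
    and hi: "\<And>i s. i < n \<Longrightarrow> (\<And>j. s j \<in> {0..1}) \<Longrightarrow> s i = 1 \<Longrightarrow> 0 \<le> f i s"
  shows "\<exists>s. (\<forall>j. s j \<in> {0..1}) \<and> (\<forall>i<n. f i s = 0)"
proof -
  define P where "P p x j = (if j < n then real (x j) / real p else 0)" for p :: nat and x :: "nat \<Rightarrow> nat" and j
  have P01: "P p x j \<in> {0..1}" if "\<forall>i<n. x i \<le> p" for p x j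
    using that by (auto simp: P_def divide_le_eq_1)
  have step: "\<exists>q. (\<forall>i<n. q i < p) \<and> (\<forall>i<n. \<exists>a b. (\<forall>j<n. q j \<le> a j \<and> a j \<le> q j + 1) \<and>
      (\<forall>j<n. q j \<le> b j \<and> b j \<le> q j + 1) \<and> f i (P p a) \<le> 0 \<and> 0 \<le> f i (P p b))" if p: "0 < p" for p
  proof -
    \<comment> \<open>The label is the sign of \<open>f i\<close>, overridden on the two faces as
      Kuhn's lemma prescribes; \<open>lo\<close> and \<open>hi\<close> say that the prescribed
      labels agree with the weak signs there.\<close>
    define label where "label x i = (if x i = 0 then 0 else if x i = p then 1 else if f i (P p x) < 0 then 0 else (1::nat))" for x i
    have l0: "f i (P p x) \<le> 0" if "\<forall>i<n. x i \<le> p" "i < n" "label x i = 0" for x i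
    proof (cases "x i = 0")
      case True
      then show ?thesis
        using that p by (intro lo P01) (auto simp: P_def)
    qed (use that in \<open>auto simp: label_def split: if_splits\<close>)
    have l1: "0 \<le> f i (P p x)" if "\<forall>i<n. x i \<le> p" "i < n" "label x i = 1" for x i
    proof (cases "x i = p")
      case True
      then show ?thesis
        using that p by (intro hi P01) (auto simp: P_def)
    qed (use that in \<open>auto simp: label_def split: if_splits\<close>)
    have c1: "\<forall>x. (\<forall>i<n. x i \<le> p) \<longrightarrow> (\<forall>i<n. label x i = 0 \<or> label x i = 1)"
      by (auto simp: label_def)
    have c2: "\<forall>x. (\<forall>i<n. x i \<le> p) \<longrightarrow> (\<forall>i<n. x i = 0 \<longrightarrow> label x i = 0)"
      by (auto simp: label_def)
    have c3: "\<forall>x. (\<forall>i<n. x i \<le> p) \<longrightarrow> (\<forall>i<n. x i = p \<longrightarrow> label x i = 1)"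
      using p by (auto simp: label_def)
    obtain q where q: "\<forall>i<n. q i < p"
      "\<forall>i<n. \<exists>r s. (\<forall>j<n. q j \<le> r j \<and> r j \<le> q j + 1) \<and> (\<forall>j<n. q j \<le> s j \<and> s j \<le> q j + 1) \<and> label r i \<noteq> label s i"
      by (rule kuhn_lemma[OF p c1 c2 c3]) blast
    show ?thesis
    proof (rule exI[of _ q], rule conjI, rule q(1), intro allI impI)
      fix i assume i: "i < n"
      obtain r s where rs: "\<forall>j<n. q j \<le> r j \<and> r j \<le> q j + 1" "\<forall>j<n. q j \<le> s j \<and> s j \<le> q j + 1" "label r i \<noteq> label s i"
        using q(2) i by blast
      have le: "\<forall>j<n. r j \<le> p" "\<forall>j<n. s j \<le> p"
        using rs(1,2) q(1) by (metis Suc_eq_plus1 Suc_leI order_trans)+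
      then consider "label r i = 0" "label s i = 1" | "label r i = 1" "label s i = 0"
        using c1 i rs(3) by metis
      then show "\<exists>a b. (\<forall>j<n. q j \<le> a j \<and> a j \<le> q j + 1) \<and> (\<forall>j<n. q j \<le> b j \<and> b j \<le> q j + 1) \<and>
          f i (P p a) \<le> 0 \<and> 0 \<le> f i (P p b)"
      proof cases
        case 1
        then show ?thesis
          using rs(1,2) l0[OF le(1) i] l1[OF le(2) i] by (intro exI[of _ r] exI[of _ s] conjI) simp_all
      next
        case 2
        then show ?thesis
          using rs(1,2) l1[OF le(1) i] l0[OF le(2) i] by (intro exI[of _ s] exI[of _ r] conjI) simp_all
      qed
    qed
  qed
  have "\<forall>m. \<exists>q. (\<forall>i<n. q i < Suc m) \<and> (\<forall>i<n. \<exists>a b. (\<forall>j<n. q j \<le> a j \<and> a j \<le> q j + 1) \<and>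
      (\<forall>j<n. q j \<le> b j \<and> b j \<le> q j + 1) \<and> f i (P (Suc m) a) \<le> 0 \<and> 0 \<le> f i (P (Suc m) b))"
    using step by simp
  then obtain q where q: "\<And>m i. i < n \<Longrightarrow> q m i < Suc m"
    "\<And>m i. i < n \<Longrightarrow> \<exists>a b. (\<forall>j<n. q m j \<le> a j \<and> a j \<le> q m j + 1) \<and>
      (\<forall>j<n. q m j \<le> b j \<and> b j \<le> q m j + 1) \<and> f i (P (Suc m) a) \<le> 0 \<and> 0 \<le> f i (P (Suc m) b)"
    by metis
  have "P (Suc m) (q m) j \<in> {0..1}" for m j
    using q(1)[of _ m] by (intro P01) (auto intro: less_imp_le)
  from common_convergent_subsequence[of "\<lambda>m. P (Suc m) (q m)", OF this, of n]
  obtain \<phi> v where \<phi>: "strict_mono \<phi>" "\<And>j. j < n \<Longrightarrow> v j \<in> {0..1}" "\<And>j. j < n \<Longrightarrow> (\<lambda>m. P (Suc (\<phi> m)) (q (\<phi> m)) j) \<longlonglongrightarrow> v j"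
    by metis
  define w where "w j = (if j < n then v j else 0)" for j
  have w01: "w j \<in> {0..1}" for j
    using \<phi>(2) by (auto simp: w_def)
  \<comment> \<open>Any choice of grid points within one mesh width of the cell corners has the same
    limit, so the points of either sign for every \<open>f i\<close> converge to one
    \<open>w\<close>.\<close>
  have near: "(\<lambda>m. P (Suc (\<phi> m)) (c m) j) \<longlonglongrightarrow> w j"
    if c: "\<And>m j. j < n \<Longrightarrow> q (\<phi> m) j \<le> c m j \<and> c m j \<le> q (\<phi> m) j + 1" for c j
  proof (cases "j < n")
    case True
    have d: "norm (P (Suc (\<phi> m)) (c m) j - P (Suc (\<phi> m)) (q (\<phi> m)) j) \<le> 1 / real (Suc m)" for m
    proof -
      have "real (q (\<phi> m) j) \<le> real (c m j)" "real (c m j) \<le> real (q (\<phi> m) j) + 1"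
        using c[OF True, of m] by linarith+
      then have "\<bar>real (c m j) - real (q (\<phi> m) j)\<bar> / real (Suc (\<phi> m)) \<le> 1 / real (Suc (\<phi> m))"
        by (intro divide_right_mono) auto
      also have "\<dots> \<le> 1 / real (Suc m)"
        using strict_mono_imp_increasing[OF \<phi>(1), of m] by (intro divide_left_mono) auto
      finally show ?thesis
        using True by (simp add: P_def diff_divide_distrib[symmetric])
    qed
    have "(\<lambda>m. P (Suc (\<phi> m)) (c m) j - P (Suc (\<phi> m)) (q (\<phi> m)) j) \<longlonglongrightarrow> 0"
      by (rule Lim_null_comparison[OF _ LIMSEQ_Suc[OF lim_1_over_n]]) (use d in auto)
    from Lim_transform[OF \<phi>(3)[OF True] this] show ?thesis
      using True by (simp add: w_def)
  next
    case False
    then show ?thesis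
      by (simp add: P_def w_def)
  qed
  have "f i w = 0" if i: "i < n" for i
  proof -
    obtain a b where ab: "\<And>m j. j < n \<Longrightarrow> q m j \<le> a m j \<and> a m j \<le> q m j + 1"
      "\<And>m j. j < n \<Longrightarrow> q m j \<le> b m j \<and> b m j \<le> q m j + 1"
      "\<And>m. f i (P (Suc m) (a m)) \<le> 0" "\<And>m. 0 \<le> f i (P (Suc m) (b m))"
      using q(2)[OF i] by metis
    have in01: "P (Suc (\<phi> m)) (c (\<phi> m)) j \<in> {0..1}" if "\<And>m j. j < n \<Longrightarrow> q m j \<le> c m j \<and> c m j \<le> q m j + 1" for c :: "nat \<Rightarrow> nat \<Rightarrow> nat" and m j
    proof (rule P01, intro allI impI)
      fix k assume "k < n"
      then show "c (\<phi> m) k \<le> Suc (\<phi> m)"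
        using q(1)[of k "\<phi> m"] that[of k "\<phi> m"] by linarith
    qed
    have "(\<lambda>m. f i (P (Suc (\<phi> m)) (a (\<phi> m)))) \<longlonglongrightarrow> f i w"
      by (intro cont i w01 in01 near) (use ab(1) in auto)
    then have "f i w \<le> 0"
      by (rule LIMSEQ_le_const2) (use ab(3) in blast)
    moreover have "(\<lambda>m. f i (P (Suc (\<phi> m)) (b (\<phi> m)))) \<longlonglongrightarrow> f i w"
      by (intro cont i w01 in01 near) (use ab(2) in auto)
    then have "0 \<le> f i w"
      by (rule LIMSEQ_le_const) (use ab(4) in blast)
    ultimately show ?thesis by simp
  qed
  then show ?thesis
    using w01 by blast
qed

text \<open>At the leftmost positive maximum the slope before is positive. The relation with
  \<open>s\<close> excludes \<open>s i = 1\<close> and makes \<open>d i\<close> nonnegative, so the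
  slope stays positive and the next value is larger still.\<close>

lemma discrete_maximum_principle:
  fixes D C d \<delta> s :: "nat \<Rightarrow> real"
  assumes D: "D 0 = 0" "D (Suc n) = 0" "\<And>k. k \<le> n \<Longrightarrow> D (Suc k) = D k + \<delta> k * C k"
    and \<delta>: "\<And>k. k \<le> n \<Longrightarrow> 0 < \<delta> k"
    and C: "\<And>k. k < n \<Longrightarrow> C (Suc k) = C k + d (Suc k)"
    and s: "\<And>k. 1 \<le> k \<Longrightarrow> k \<le> n \<Longrightarrow> s k \<in> {0..1} \<and> (1 - s k) * d k = s k * D k"
    and k: "k \<le> Suc n"
  shows "D k \<le> 0"
proof (rule ccontr)
  assume neg: "\<not> D k \<le> 0"
  define A where "A = Max (D ` {..Suc n})"
  have A: "D j \<le> A" if "j \<le> Suc n" for j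
    using that by (auto simp: A_def)
  have "A \<in> D ` {..Suc n}"
    unfolding A_def by (intro Max_in) auto
  then have ex: "\<exists>j. j \<le> Suc n \<and> D j = A" by auto
  \<comment> \<open>The leftmost maximiser, so that the step leading to it is strictly
    upwards.\<close>
  define i where "i = (LEAST j. j \<le> Suc n \<and> D j = A)"
  have i: "i \<le> Suc n" "D i = A"
    using LeastI_ex[OF ex] by (auto simp: i_def)
  have least: "D j < A" if "j < i" for j
    using not_less_Least[of j "\<lambda>j. j \<le> Suc n \<and> D j = A"] that i(1) A[of j] by (auto simp: i_def less_le)
  have Apos: "0 < A"
    using A[OF k] neg by simp
  then have "i \<noteq> 0" "i \<noteq> Suc n"
    using D(1,2) i(2) by (metis less_irrefl)+
  then obtain j where j: "i = Suc j" "j < n"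
    using i(1) by (cases i) auto
  have "D j < D (Suc j)"
    using least[of j] i j by simp
  then have "0 < C j"
    using D(3)[of j] \<delta>[of j] j by (simp add: zero_less_mult_iff)
  moreover have "0 \<le> d i"
  proof -
    have si: "s i \<in> {0..1}" "(1 - s i) * d i = s i * D i"
      using s[of i] j by auto
    then have "s i \<noteq> 1"
      using Apos i(2) by auto
    moreover have "0 \<le> (1 - s i) * d i"
      using si Apos i(2) by simp
    ultimately show ?thesis
      using si(1) by (simp add: zero_le_mult_iff)
  qed
  ultimately have "0 < C i"
    using C[of j] j by simp
  then have "D i < D (Suc i)"
    using D(3)[of i] \<delta>[of i] j by simp
  then show False
    using A[of "Suc i"] i j by simp
qed

text \<open>
  \<open>D k = \<Sum>j. d j * \<bar>y j - y k\<bar>\<close> is a discrete potential: its slopes are the partial sums of \<open>d\<close>.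
\<close>

lemma potential_relation_imp_zero:
  fixes y d s :: "nat \<Rightarrow> real"
  assumes y: "strict_mono_on {0..n+1} y"
    and d: "(\<Sum>j = 0..n+1. d j) = 0" "(\<Sum>j = 0..n+1. y j * d j) = 0"
    and s: "\<And>k. 1 \<le> k \<Longrightarrow> k \<le> n \<Longrightarrow> s k \<in> {0..1} \<and> (1 - s k) * d k = s k * (\<Sum>j = 0..n+1. d j * \<bar>y j - y k\<bar>)"
    and k: "k \<le> n + 1"
  shows "d k = 0"
proof -
  define D where "D k = (\<Sum>j = 0..n+1. d j * \<bar>y j - y k\<bar>)" for k
  define C where "C k = (\<Sum>j = 0..k. d j)" for k
  \<comment> \<open>The factor 2 arises because \<open>d\<close> has total 0: between
    \<open>y k\<close> and \<open>y (Suc k)\<close> the slope is the sum of \<open>d\<close> on the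
    left minus that on the right, which is twice \<open>C k\<close>.\<close>
  define \<delta> where "\<delta> k = 2 * (y (Suc k) - y k)" for k
  have mono: "y i \<le> y j" if "i \<le> j" "j \<le> n + 1" for i j
    using strict_mono_onD[OF y, of i j] that by (cases "i = j") auto
  \<comment> \<open>From an end point all distances have one sign, so the potential is a combination
    of the two vanishing moments of \<open>d\<close>.\<close>
  have D0: "D 0 = 0"
  proof -
    have "D 0 = (\<Sum>j = 0..n+1. y j * d j - y 0 * d j)"
      unfolding D_def using mono[of 0] by (intro sum.cong) (auto simp: algebra_simps)
    also have "\<dots> = (\<Sum>j = 0..n+1. y j * d j) - y 0 * (\<Sum>j = 0..n+1. d j)"
      by (simp only: sum_subtractf sum_distrib_left)
    finally show ?thesis using d by simp
  qed
  have D1: "D (Suc n) = 0"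
  proof -
    have "D (Suc n) = (\<Sum>j = 0..n+1. y (Suc n) * d j - y j * d j)"
      unfolding D_def using mono[of _ "Suc n"] by (intro sum.cong) (auto simp: algebra_simps)
    also have "\<dots> = y (Suc n) * (\<Sum>j = 0..n+1. d j) - (\<Sum>j = 0..n+1. y j * d j)"
      by (simp only: sum_subtractf sum_distrib_left)
    finally show ?thesis using d by simp
  qed
  have DS: "D (Suc k) = D k + \<delta> k * C k" if "k \<le> n" for k
  proof -
    have split: "(\<Sum>j = 0..n+1. g j) = (\<Sum>j = 0..k. g j) + (\<Sum>j = Suc k..n+1. g j)" for g :: "nat \<Rightarrow> real"
    proof -
      have "{0..n+1} = {0..k} \<union> {Suc k..n+1}"
        using that by auto
      then show ?thesis
        by (simp only:) (rule sum.union_disjoint, auto)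
    qed
    have "D (Suc k) - D k = (\<Sum>j = 0..n+1. d j * (\<bar>y j - y (Suc k)\<bar> - \<bar>y j - y k\<bar>))"
      by (simp only: D_def sum_subtractf[symmetric] right_diff_distrib)
    also have "\<dots> = (\<Sum>j = 0..k. d j * (y (Suc k) - y k)) + (\<Sum>j = Suc k..n+1. d j * (y k - y (Suc k)))"
      unfolding split using that mono[of _ k] mono[of _ "Suc k"] mono[of "Suc k"] mono[of k]
      by (intro arg_cong2[where f = "(+)"] sum.cong) auto
    also have "\<dots> = (y (Suc k) - y k) * (C k - (\<Sum>j = Suc k..n+1. d j))"
      by (simp only: C_def sum_distrib_right[symmetric]) (simp only: algebra_simps)
    also have "(\<Sum>j = Suc k..n+1. d j) = - C k"
      using d(1) unfolding split C_def by linarith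
    finally show ?thesis
      by (simp add: \<delta>_def algebra_simps)
  qed
  have \<delta>: "0 < \<delta> k" if "k \<le> n" for k
    using strict_mono_onD[OF y, of k "Suc k"] that by (simp add: \<delta>_def)
  have CS: "C (Suc k) = C k + d (Suc k)" for k
    by (simp add: C_def)
  have "D k \<le> 0" if "k \<le> Suc n" for k
    using D0 D1 DS \<delta> CS s[folded D_def] that by (rule discrete_maximum_principle)
  \<comment> \<open>The relations are linear and invariant under changing the sign of
    \<open>D\<close>, \<open>C\<close> and \<open>d\<close>, so the principle also bounds the
    potential from below.\<close>
  moreover have "- D k \<le> 0" if "k \<le> Suc n" for k
  proof (rule discrete_maximum_principle[where D = "\<lambda>k. - D k" and C = "\<lambda>k. - C k" and d = "\<lambda>k. - d k" and s = s, OF _ _ _ \<delta> _ _ that])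
    show "- D (Suc k) = - D k + \<delta> k * - C k" if "k \<le> n" for k
      using DS[OF that] by simp
    show "s k \<in> {0..1} \<and> (1 - s k) * - d k = s k * - D k" if "1 \<le> k" "k \<le> n" for k
      using s[folded D_def, OF that] by simp
  qed (use D0 D1 CS in auto)
  ultimately have D_0: "D k = 0" if "k \<le> Suc n" for k
    using that by (metis antisym neg_le_0_iff_le)
  have C0: "C k = 0" if "k \<le> n" for k
    using DS[OF that] D_0[of k] D_0[of "Suc k"] \<delta>[OF that] that by simp
  show "d k = 0"
  proof (cases k)
    case 0
    then show ?thesis
      using C0[of 0] by (simp add: C_def)
  next
    case (Suc j)
    have "C (Suc n) = 0"
      using d(1) by (simp add: C_def)
    then show ?thesis
      using CS[of j] C0[of j] C0[of "Suc j"] k Suc by (cases "j = n") auto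
  qed
qed

lemma atomic_measure_cong: "(\<And>i. i \<le> n + 1 \<Longrightarrow> b i = b' i) \<Longrightarrow> atomic_measure n y b = atomic_measure n y b'"
  unfolding atomic_measure_def by (intro arg_cong[where f = "measure_of _ _"] ext sum.cong) auto

section \<open>Identities for the law of the diffusion\<close>

context discrete_diffusion
begin

lemma expectation_X_sum:
  fixes h :: "real \<Rightarrow> real"
  assumes y: "inj_on y {0..n+1}" and h [measurable]: "h \<in> borel_measurable borel"
  shows "expectation (\<lambda>\<omega>. h (X t \<omega>)) = (\<Sum>j = 0..n+1. prob {\<omega> \<in> space M. X t \<omega> = y j} * h (y j))"
proof -
  have [measurable]: "X t \<in> borel_measurable M"
    by (rule gen_diffusion_measurable)
  have ev: "{\<omega> \<in> space M. X t \<omega> = y j} \<in> sets M" for j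
    by measurable
  have ae: "AE \<omega> in M. h (X t \<omega>) = (\<Sum>j = 0..n+1. indicator {\<omega> \<in> space M. X t \<omega> = y j} \<omega> * h (y j))"
    using AE_X_charged[of t] AE_space
  proof eventually_elim
    case (elim \<omega>)
    then obtain i where i: "i \<in> {0..n+1}" "X t \<omega> = y i"
      by (auto simp: charged_def)
    have "(\<Sum>j = 0..n+1. indicator {\<omega> \<in> space M. X t \<omega> = y j} \<omega> * h (y j)) = (\<Sum>j = 0..n+1. if j = i then h (y i) else 0)"
      using elim(2) i inj_onD[OF y] by (intro sum.cong refl) (auto simp: indicator_def)
    then show ?case
      using i by simp
  qed
  have "expectation (\<lambda>\<omega>. \<Sum>j = 0..n+1. indicator {\<omega> \<in> space M. X t \<omega> = y j} \<omega> * h (y j))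
      = (\<Sum>j = 0..n+1. expectation (\<lambda>\<omega>. indicator {\<omega> \<in> space M. X t \<omega> = y j} \<omega> * h (y j)))"
    using ev by (intro Bochner_Integration.integral_sum integrable_mult_left integrable_real_indicator) (auto simp: emeasure_eq_measure)
  also have "\<dots> = (\<Sum>j = 0..n+1. prob {\<omega> \<in> space M. X t \<omega> = y j} * h (y j))"
    using ev by (intro sum.cong) (auto simp: measure_space_inter)
  also have "expectation (\<lambda>\<omega>. \<Sum>j = 0..n+1. indicator {\<omega> \<in> space M. X t \<omega> = y j} \<omega> * h (y j)) = expectation (\<lambda>\<omega>. h (X t \<omega>))"
  proof -
    have m1: "(\<lambda>\<omega>. \<Sum>j = 0..n+1. indicator {\<omega> \<in> space M. X t \<omega> = y j} \<omega> * h (y j)) \<in> borel_measurable M"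
      using ev by measurable
    show ?thesis
      using m1 ae by (intro integral_cong_AE) (auto elim!: eventually_mono)
  qed
  finally show ?thesis .
qed

lemma sum_prob_X:
  assumes y: "inj_on y {0..n+1}"
  shows "(\<Sum>j = 0..n+1. prob {\<omega> \<in> space M. X t \<omega> = y j}) = 1"
    and "(\<Sum>j = 0..n+1. y j * prob {\<omega> \<in> space M. X t \<omega> = y j}) = x\<^sub>0"
  using expectation_X_sum[OF y, of "\<lambda>_. 1" t] expectation_X_sum[OF y, of "\<lambda>x. x" t] expectation_X[of t]
  by (simp_all add: prob_space mult.commute)

text \<open>An infinite atom is not crossed, so \<open>X t - y k\<close> has a constant sign and the
  absolute value is linear on the support; the mean then determines the potential.\<close>

lemma sum_prob_X_abs_diff:
  assumes y: "inj_on y {0..n+1}" and k: "k \<le> n + 1" "b k = \<infinity>"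
  shows "(\<Sum>j = 0..n+1. prob {\<omega> \<in> space M. X t \<omega> = y j} * \<bar>y j - y k\<bar>) = \<bar>x\<^sub>0 - y k\<bar>"
proof -
  define e :: real where "e = (if y k \<le> x\<^sub>0 then 1 else - 1)"
  have [measurable]: "X t \<in> borel_measurable M"
    by (rule gen_diffusion_measurable)
  have "(\<Sum>j = 0..n+1. prob {\<omega> \<in> space M. X t \<omega> = y j} * \<bar>y j - y k\<bar>) = expectation (\<lambda>\<omega>. \<bar>X t \<omega> - y k\<bar>)"
    using expectation_X_sum[OF y, of "\<lambda>x. \<bar>x - y k\<bar>" t] by simp
  also have "\<dots> = expectation (\<lambda>\<omega>. e * (X t \<omega> - y k))"
  proof (rule integral_cong_AE)
    show "AE \<omega> in M. \<bar>X t \<omega> - y k\<bar> = e * (X t \<omega> - y k)"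
      using AE_X_same_side_infinite_atom[OF k, of t] by eventually_elim (auto simp: e_def)
  qed measurable
  also have "\<dots> = (\<Sum>j = 0..n+1. prob {\<omega> \<in> space M. X t \<omega> = y j} * (e * (y j - y k)))"
    using expectation_X_sum[OF y, of "\<lambda>x. e * (x - y k)" t] by simp
  also have "\<dots> = (\<Sum>j = 0..n+1. e * (y j * prob {\<omega> \<in> space M. X t \<omega> = y j}) - e * y k * prob {\<omega> \<in> space M. X t \<omega> = y j})"
    by (intro sum.cong refl) (simp add: algebra_simps)
  also have "\<dots> = e * (\<Sum>j = 0..n+1. y j * prob {\<omega> \<in> space M. X t \<omega> = y j}) - e * y k * (\<Sum>j = 0..n+1. prob {\<omega> \<in> space M. X t \<omega> = y j})"
    by (simp only: sum_subtractf sum_distrib_left)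
  also have "\<dots> = e * x\<^sub>0 - e * y k"
    by (simp only: sum_prob_X[OF y])
  also have "\<dots> = \<bar>x\<^sub>0 - y k\<bar>"
    by (simp add: e_def)
  finally show ?thesis .
qed

text \<open>Injectivity of \<open>y\<close> ensures that no other index of positive weight shares
  the position \<open>y k\<close>.\<close>

lemma prob_X_uncharged:
  assumes y: "inj_on y {0..n+1}" and k: "k \<le> n + 1" "b k = 0"
  shows "prob {\<omega> \<in> space M. X t \<omega> = y k} = 0"
proof -
  have nc: "y k \<notin> charged"
    using k inj_onD[OF y] by (force simp: charged_def)
  have "AE \<omega> in M. X t \<omega> \<noteq> y k"
    using AE_X_charged[of t] by eventually_elim (use nc in auto)
  then have "AE \<omega> in M. \<omega> \<notin> {\<omega> \<in> space M. X t \<omega> = y k}"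
    by eventually_elim simp
  moreover have "{\<omega> \<in> space M. X t \<omega> = y k} \<in> sets M"
    using gen_diffusion_measurable[of n y b t] by measurable
  ultimately show ?thesis
    by (simp add: prob_eq_0)
qed

end

context brownian_local_time
begin

text \<open>
  In the variable \<open>s k = b k / (1 + b k)\<close> the map \<open>(1 - s k) (p k - \<pi> k) - s k D k\<close>, with \<open>D\<close> the
  difference of the potentials of \<open>p\<close> and \<open>\<pi>\<close>, has the sign pattern needed for the
  Poincare--Miranda theorem even at \<open>s k = 1\<close>, where \<open>p k\<close> itself is not controlled.
\<close>

lemma discrete_inverse_problem:
  assumes y: "strict_mono_on {0..n+1} y" and x0: "x\<^sub>0 \<in> {y 0 <..< y (n+1)}"
    and \<pi>: "\<And>i. i \<in> {0..n+1} \<Longrightarrow> 0 \<le> \<pi> i" "(\<Sum>i = 0..n+1. \<pi> i) = 1" "(\<Sum>i = 0..n+1. y i * \<pi> i) = x\<^sub>0"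
    and t: "0 < t"
  shows "\<exists>b :: nat \<Rightarrow> ennreal. b 0 = \<infinity> \<and> b (n+1) = \<infinity> \<and> (\<forall>i\<in>{0..n+1}.
    prob {\<omega> \<in> space M. gen_diffusion B L (atomic_measure n y b) t \<omega> = y i} = \<pi> i)"
proof -
  \<comment> \<open>Cube coordinate \<open>k - 1\<close> governs the weight with index
    \<open>k\<close>. In \<open>ennreal\<close> the quotient \<open>1 / 0\<close> is infinite, so
    the face \<open>s = 1\<close> is an infinite atom and \<open>s = 0\<close> an absent
    one.\<close>
  define bs :: "(nat \<Rightarrow> real) \<Rightarrow> nat \<Rightarrow> ennreal" where
    "bs s k = (if k = 0 \<or> n < k then \<infinity> else ennreal (s (k - 1)) / ennreal (1 - s (k - 1)))" for s k
  define p where "p s k = prob {\<omega> \<in> space M. gen_diffusion B L (atomic_measure n y (bs s)) t \<omega> = y k}" for s k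
  define D where "D s k = (\<Sum>j = 0..n+1. (p s j - \<pi> j) * \<bar>y j - y k\<bar>)" for s k
  define f where "f i s = (1 - s i) * (p s (Suc i) - \<pi> (Suc i)) - s i * D s (Suc i)" for i s
  have inj: "inj_on y {0..n+1}"
    using y by (rule strict_mono_on_imp_inj_on)
  have dd: "discrete_diffusion M x\<^sub>0 B L n y (bs s)" for s
    using x0 by unfold_locales (auto simp: bs_def)
  have inv: "continuous_on UNIV (inverse :: ennreal \<Rightarrow> ennreal)"
    by (intro continuous_on_inverse_ennreal continuous_on_id)
  have bs_lim: "(\<lambda>m. bs (u m) k) \<longlonglongrightarrow> bs v k"
    if "\<And>m j. u m j \<in> {0..1}" "\<And>j. v j \<in> {0..1}" "\<And>j. (\<lambda>m. u m j) \<longlonglongrightarrow> v j" for u v k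
  proof (cases "k = 0 \<or> n < k")
    case False
    have "(\<lambda>m. ennreal (u m (k - 1)) * inverse (ennreal (1 - u m (k - 1)))) \<longlonglongrightarrow> ennreal (v (k - 1)) * inverse (ennreal (1 - v (k - 1)))"
    proof (rule tendsto_mult_ennreal)
      show "(\<lambda>m. ennreal (u m (k - 1))) \<longlonglongrightarrow> ennreal (v (k - 1))"
        by (intro tendsto_ennrealI that)
      have "(\<lambda>m. ennreal (1 - u m (k - 1))) \<longlonglongrightarrow> ennreal (1 - v (k - 1))"
        by (intro tendsto_ennrealI tendsto_diff tendsto_const that)
      then show "(\<lambda>m. inverse (ennreal (1 - u m (k - 1)))) \<longlonglongrightarrow> inverse (ennreal (1 - v (k - 1)))"
        by (rule continuous_on_tendsto_compose[OF inv]) auto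
      show "\<not> (ennreal (v (k - 1)) = 0 \<and> inverse (ennreal (1 - v (k - 1))) = \<infinity> \<or>
          ennreal (v (k - 1)) = \<infinity> \<and> inverse (ennreal (1 - v (k - 1))) = 0)"
        \<comment> \<open>The form \<open>0 * \<infinity>\<close> cannot occur: where the numerator
          vanishes, the denominator is 1.\<close>
        using that(2)[of "k - 1"] by (cases "v (k - 1) = 0") (auto simp: ennreal_eq_0_iff)
    qed
    then show ?thesis
      using False by (simp add: bs_def divide_ennreal_def)
  qed (simp add: bs_def)
  have p_lim: "(\<lambda>m. p (u m) k) \<longlonglongrightarrow> p v k"
    if "\<And>m j. u m j \<in> {0..1}" "\<And>j. v j \<in> {0..1}" "\<And>j. (\<lambda>m. u m j) \<longlonglongrightarrow> v j" for u v k
    unfolding p_def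
  proof (rule discrete_diffusion.prob_X_tendsto[OF dd _ _ _ t])
    show "(\<lambda>m. bs (u m) i) \<longlonglongrightarrow> bs v i" for i
      by (rule bs_lim) (rule that)+
  qed (simp_all add: bs_def)
  have "\<exists>s. (\<forall>j. s j \<in> {0..1}) \<and> (\<forall>i<n. f i s = 0)"
  proof (rule poincare_miranda)
    fix i :: nat and u :: "nat \<Rightarrow> nat \<Rightarrow> real" and v :: "nat \<Rightarrow> real"
    assume uv: "\<And>m j. u m j \<in> {0..1}" "\<And>j. v j \<in> {0..1}" "\<And>j. (\<lambda>m. u m j) \<longlonglongrightarrow> v j"
    show "(\<lambda>m. f i (u m)) \<longlonglongrightarrow> f i v"
      unfolding f_def D_def by (intro tendsto_intros uv(3) p_lim uv)
  next
    fix i :: nat and s :: "nat \<Rightarrow> real"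
    assume i: "i < n" and s: "\<And>j. s j \<in> {0..1}" and 0: "s i = 0"
    \<comment> \<open>On this face the weight is 0, so the mass difference is
      \<open>- \<pi> (Suc i)\<close> and the potential term is switched off.\<close>
    have "p s (Suc i) = 0"
      unfolding p_def using i 0 by (intro discrete_diffusion.prob_X_uncharged[OF dd inj]) (auto simp: bs_def)
    then show "f i s \<le> 0"
      using \<pi>(1)[of "Suc i"] i 0 by (simp add: f_def)
  next
    fix i :: nat and s :: "nat \<Rightarrow> real"
    assume i: "i < n" and s: "\<And>j. s j \<in> {0..1}" and 1: "s i = 1"
    have "(\<Sum>j = 0..n+1. p s j * \<bar>y j - y (Suc i)\<bar>) = \<bar>x\<^sub>0 - y (Suc i)\<bar>"
      unfolding p_def using i 1 by (intro discrete_diffusion.sum_prob_X_abs_diff[OF dd inj]) (auto simp: bs_def)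
    also have "x\<^sub>0 - y (Suc i) = (\<Sum>j = 0..n+1. y j * \<pi> j) - y (Suc i) * (\<Sum>j = 0..n+1. \<pi> j)"
      using \<pi> by simp
    also have "\<dots> = (\<Sum>j = 0..n+1. \<pi> j * (y j - y (Suc i)))"
      by (simp only: sum_distrib_left sum_subtractf[symmetric]) (simp only: algebra_simps)
    \<comment> \<open>Jensen's inequality for \<open>\<pi>\<close>, which has mean
      \<open>x\<^sub>0\<close>: at an infinite atom the law of \<open>X\<close> has the smallest
      possible potential among all such distributions.\<close>
    also have "\<bar>\<dots>\<bar> \<le> (\<Sum>j = 0..n+1. \<pi> j * \<bar>y j - y (Suc i)\<bar>)"
      using \<pi>(1) by (intro order_trans[OF sum_abs] sum_mono) (simp add: abs_mult)
    finally have "D s (Suc i) \<le> 0"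
      unfolding D_def by (simp only: left_diff_distrib sum_subtractf)
    then show "0 \<le> f i s"
      using 1 by (simp add: f_def)
  qed
  then obtain s where s: "\<And>j. s j \<in> {0..1}" "\<And>i. i < n \<Longrightarrow> f i s = 0"
    by blast
  have p1: "(\<Sum>j = 0..n+1. p s j) = 1" "(\<Sum>j = 0..n+1. y j * p s j) = x\<^sub>0"
    unfolding p_def by (rule discrete_diffusion.sum_prob_X[OF dd inj])+
  have "p s k - \<pi> k = 0" if "k \<le> n + 1" for k
  proof (rule potential_relation_imp_zero[OF y _ _ _ that, where s = "\<lambda>k. s (k - 1)"])
    show "(\<Sum>j = 0..n+1. p s j - \<pi> j) = 0"
      by (simp only: sum_subtractf p1 \<pi> diff_self)
    show "(\<Sum>j = 0..n+1. y j * (p s j - \<pi> j)) = 0"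
      by (simp only: right_diff_distrib sum_subtractf p1 \<pi> diff_self)
    show "s (k - 1) \<in> {0..1} \<and> (1 - s (k - 1)) * (p s k - \<pi> k) = s (k - 1) * (\<Sum>j = 0..n+1. (p s j - \<pi> j) * \<bar>y j - y k\<bar>)"
      if "1 \<le> k" "k \<le> n" for k
      using s(2)[of "k - 1"] s(1)[of "k - 1"] that unfolding D_def[symmetric] by (simp add: f_def)
  qed
  then have "p s k = \<pi> k" if "k \<in> {0..n+1}" for k
    using that by simp
  moreover have "bs s 0 = \<infinity>" "bs s (n+1) = \<infinity>"
    by (simp_all add: bs_def)
  ultimately show ?thesis
    unfolding p_def by blast
qed

end

theorem theorem4p4:
  fixes M :: "'a measure"
    and B :: "real \<Rightarrow> 'a \<Rightarrow> real"
    and L :: "real \<Rightarrow> real \<Rightarrow> 'a \<Rightarrow> real"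
    and n :: nat and y :: "nat \<Rightarrow> real" and x\<^sub>0 :: real
  assumes "n \<ge> 1"
    and "strict_mono_on {0..n+1} y"
    and "x\<^sub>0 \<in> {y 0 <..< y (n+1)}"
    and "brownian_local_time M x\<^sub>0 B L"
  shows "G_map M B L n y ` ({1..n} \<rightarrow>\<^sub>E (UNIV :: ennreal set)) = Pi_set n y x\<^sub>0
    \<and> (\<forall>\<pi> :: nat \<Rightarrow> real.
         (\<forall>i\<in>{0..n+1}. \<pi> i \<in> {0..1}) \<and>
         (\<Sum>i = 0..n+1. \<pi> i) = 1 \<and> (\<Sum>i = 0..n+1. y i * \<pi> i) = x\<^sub>0 \<longrightarrow>
         (\<exists>b :: nat \<Rightarrow> ennreal. b 0 = \<infinity> \<and> b (n+1) = \<infinity> \<and>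
            (\<forall>i\<in>{0..n+1}.
               measure M {\<omega> \<in> space M. gen_diffusion B L (atomic_measure n y b) 1 \<omega> = y i} = \<pi> i)))"
proof -
  interpret brownian_local_time M x\<^sub>0 B L
    by fact
  have inj: "inj_on y {0..n+1}"
    using assms(2) by (rule strict_mono_on_imp_inj_on)
  have inverse: "\<exists>b :: nat \<Rightarrow> ennreal. b 0 = \<infinity> \<and> b (n+1) = \<infinity> \<and>
      (\<forall>i\<in>{0..n+1}. measure M {\<omega> \<in> space M. gen_diffusion B L (atomic_measure n y b) 1 \<omega> = y i} = \<pi> i)"
    if "\<forall>i\<in>{0..n+1}. \<pi> i \<in> {0..1}" "(\<Sum>i = 0..n+1. \<pi> i) = 1" "(\<Sum>i = 0..n+1. y i * \<pi> i) = x\<^sub>0" for \<pi>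
    using that by (intro discrete_inverse_problem assms(2,3)) auto
  \<comment> \<open>Equality rather than one inclusion also records that \<open>G_map\<close> takes
    its values in \<open>Pi_set\<close>.\<close>
  have "G_map M B L n y ` ({1..n} \<rightarrow>\<^sub>E UNIV) = Pi_set n y x\<^sub>0"
  proof (intro subset_antisym subsetI)
    fix \<pi> assume "\<pi> \<in> G_map M B L n y ` ({1..n} \<rightarrow>\<^sub>E UNIV)"
    then obtain b where b: "\<pi> = G_map M B L n y b" by blast
    define b' where "b' = b(0 := \<infinity>, n+1 := \<infinity>)"
    have dd: "discrete_diffusion M x\<^sub>0 B L n y b'"
      using assms(3) by unfold_locales (auto simp: b'_def)
    have \<pi>_eq: "\<pi> i = prob {\<omega> \<in> space M. gen_diffusion B L (atomic_measure n y b') 1 \<omega> = y i}" if "i \<in> {0..n+1}" for i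
      using that unfolding b G_map_def b'_def by (rule restrict_apply')
    have "(\<Sum>i = 0..n+1. \<pi> i) = (\<Sum>i = 0..n+1. prob {\<omega> \<in> space M. gen_diffusion B L (atomic_measure n y b') 1 \<omega> = y i})"
      "(\<Sum>i = 0..n+1. y i * \<pi> i) = (\<Sum>i = 0..n+1. y i * prob {\<omega> \<in> space M. gen_diffusion B L (atomic_measure n y b') 1 \<omega> = y i})"
      by (intro sum.cong refl, simp only: \<pi>_eq)+
    then have "(\<Sum>i = 0..n+1. \<pi> i) = 1" "(\<Sum>i = 0..n+1. y i * \<pi> i) = x\<^sub>0"
      by (simp_all only: discrete_diffusion.sum_prob_X[OF dd inj])
    moreover have "\<pi> \<in> {0..n+1} \<rightarrow>\<^sub>E {0..1}"
    proof (rule PiE_I)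
      fix i assume "i \<in> {0..n+1}"
      then show "\<pi> i \<in> {0..1}"
        by (simp add: \<pi>_eq)
    next
      fix i assume "i \<notin> {0..n+1}"
      then show "\<pi> i = undefined"
        by (simp add: b G_map_def)
    qed
    ultimately show "\<pi> \<in> Pi_set n y x\<^sub>0"
      by (simp add: Pi_set_def)
  next
    fix \<pi> assume \<pi>: "\<pi> \<in> Pi_set n y x\<^sub>0"
    then have "\<forall>i\<in>{0..n+1}. \<pi> i \<in> {0..1}" "(\<Sum>i = 0..n+1. \<pi> i) = 1" "(\<Sum>i = 0..n+1. y i * \<pi> i) = x\<^sub>0"
      unfolding Pi_set_def by (blast dest: PiE_mem)+
    from inverse[OF this] obtain b :: "nat \<Rightarrow> ennreal" where b: "b 0 = \<infinity>" "b (n+1) = \<infinity>"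
      "\<And>i. i \<in> {0..n+1} \<Longrightarrow> prob {\<omega> \<in> space M. gen_diffusion B L (atomic_measure n y b) 1 \<omega> = y i} = \<pi> i"
      by blast
    \<comment> \<open>\<open>G_map\<close> overwrites the two end weights by infinity, so
      restricting a solution to the interior indices loses nothing.\<close>
    define b' where "b' = restrict b {1..n}"
    have eq: "atomic_measure n y (b'(0 := \<infinity>, n+1 := \<infinity>)) = atomic_measure n y b"
      using b(1,2) by (intro atomic_measure_cong) (auto simp: b'_def)
    have "G_map M B L n y b' = \<pi>"
    proof
      fix i
      show "G_map M B L n y b' i = \<pi> i"
      proof (cases "i \<in> {0..n+1}")
        case True
        then show ?thesis
          using b(3) unfolding G_map_def eq by (simp only: restrict_apply')
      next
        case False
        have "\<pi> \<in> {0..n+1} \<rightarrow>\<^sub>E {0..1}"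
          using \<pi> by (simp add: Pi_set_def)
        then have "\<pi> i = undefined"
          using False by (rule PiE_arb)
        then show ?thesis
          unfolding G_map_def restrict_def if_not_P[OF False] ..
      qed
    qed
    moreover have "b' \<in> {1..n} \<rightarrow>\<^sub>E UNIV"
      by (auto simp: b'_def)
    ultimately show "\<pi> \<in> G_map M B L n y ` ({1..n} \<rightarrow>\<^sub>E UNIV)"
      by blast
  qed
  then show ?thesis
    using inverse by blast
qed

end
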